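(* Let $\Omega\subset\mathbb{R}^n$, $n\ge2$, be a bounded region, let $a\in L^2(\Omega)$ be a non-negative function, let $f\in H^{1/2}(\partial\Omega)$, and let $\lambda>0$. Assume that the minimization problem $$\min\Big\{\int_\Omega a(x)|\nabla v|\,dx:\ v\in H^1(\Omega),\ v|_{\partial\Omega}=f\Big\}\qquad(\ast)$$ has an optimal solution in $H^1(\Omega)$. If $\{\alpha_k\}_{k\ge1}$ is a sequence of non-negative numbers with $\sum_{k=1}^\infty\alpha_k<\infty$, then for any $u_f\in H^1(\Omega)$ with $u_f|_{\partial\Omega}=f$ and any $b^0,d^0\in(L^2(\Omega))^n$, the sequences $\{b^k\}$, $\{d^k\}$ and $\{u^k\}$ produced by the approximate alternating split Bregman algorithm (described in the context) with error bounds $\alpha_k$ converge weakly to some $\hat b$, $\hat d$ and $\hat u$, respectively ($b^k,d^k$ in $(L^2(\Omega))^n$ and $u^k$ in $H^1_0(\Omega)$). Moreover $\{\nabla u^{k+1}-d^k\}_k$ converges strongly to zero in $(L^2(\Omega))^n$ and $$\sum_{k=0}^\infty\|\nabla u^{k+1}-d^k\|^2<\infty.$$ Furthermore $\bar u:=\hat u+u_f$ is a solution of the minimization problem $(\ast)$, $\lambda\hat b$ is a solution of the dual problem $$(D)\qquad \max\{\langle\nabla u_f,b\rangle:\ b\in(L^2(\Omega))^n,\ |b(x)|\le a(x)\ \text{a.e. in }\Omega,\ \nabla\cdot b\equiv0\},$$ $\hat d=\nabla\hat u$, $\nabla\cdot\hat b\equiv0$, and $$\hat b=\frac1\lambda\,a\,\frac{\nabla\bar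 u}{|\nabla\bar u|}\quad\text{a.e. in }\Omega\setminus\{x:\ |\nabla\bar u(x)|=0,\ a(x)\neq0\},$$ where the right-hand side is read as $0$ at points where $a(x)=0$.
   Context: Boundary values are understood in the sense of traces: $v|_{\partial\Omega}=f$ means $v-u_f\in H^1_0(\Omega)$. $\|\cdot\|$ and $\langle\cdot,\cdot\rangle$ are the norm and inner product of $(L^2(\Omega))^n$, and $\nabla\cdot$ is the distributional divergence. Approximate alternating split Bregman algorithm (with parameter $\lambda>0$ and error bounds $\alpha_k$): given $u_f$, $b^0,d^0$ as in the claim, for $k=0,1,2,\dots$: (1) find an approximate solution $u^{k+1}\in H^1_0(\Omega)$ of $\Delta u=\nabla\cdot(d^k-b^k)$ in $\Omega$, $u|_{\partial\Omega}=0$, in the sense that $\|\nabla u^{k+1}-\nabla u^{k+1}_{ex}\|\le\alpha_{k+1}$, where $u^{k+1}_{ex}\in H^1_0(\Omega)$ is the exact (weak) solution of this problem; (2) with $w^{k+1}:=\nabla u^{k+1}+\nabla u_f+b^k$, set $$d^{k+1}(x):=\begin{cases}\max\{|w^{k+1}(x)|-\frac{a(x)}{\lambda},0\}\,\frac{w^{k+1}(x)}{|w^{k+1}(x)|}-\nabla u_f(x) & \text{if } |w^{k+1}(x)|\neq0,\\ -\nabla u_f(x) & \text{if } |w^{k+1}(x)|=0;\end{cases}$$ (3) set $b^{k+1}:=b^k+\nabla u^{k+1}-d^{k+1}$. The sequences are any sequences generated in this way. *)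

theory Defs
  imports "HOL-Analysis.Analysis"
begin

text \<open>
  Elements of $L^2(\Omega)$ are represented by functions on the whole space; only their
  almost-everywhere class on \<open>\<Omega>\<close> matters, and all pointwise relations between them are
  therefore stated with \<open>AE x in lebesgue_on \<Omega>\<close>.
\<close>

definition L2_space :: "(real^'n) set \<Rightarrow> (real^'n \<Rightarrow> 'b::euclidean_space) set" where
  "L2_space \<Omega> = {g. g \<in> borel_measurable (lebesgue_on \<Omega>) \<and>
     integrable (lebesgue_on \<Omega>) (\<lambda>x. (norm (g x))\<^sup>2)}"

definition L2_inner ::
  "(real^'n) set \<Rightarrow> (real^'n \<Rightarrow> 'b::euclidean_space) \<Rightarrow> (real^'n \<Rightarrow> 'b) \<Rightarrow> real" where
  "L2_inner \<Omega> g h = (LINT x|lebesgue_on \<Omega>. g x \<bullet> h x)"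

definition L2_norm :: "(real^'n) set \<Rightarrow> (real^'n \<Rightarrow> 'b::euclidean_space) \<Rightarrow> real" where
  "L2_norm \<Omega> g = sqrt (L2_inner \<Omega> g g)"

definition partial_deriv :: "'n \<Rightarrow> (real^'n \<Rightarrow> real) \<Rightarrow> real^'n \<Rightarrow> real" where
  "partial_deriv i \<phi> x = frechet_derivative \<phi> (at x) (axis i 1)"

primrec C_k :: "nat \<Rightarrow> (real^'n \<Rightarrow> real) \<Rightarrow> bool" where
  "C_k 0 \<phi> \<longleftrightarrow> continuous_on UNIV \<phi>"
| "C_k (Suc k) \<phi> \<longleftrightarrow>
     (\<forall>x. \<phi> differentiable (at x)) \<and> (\<forall>i. C_k k (partial_deriv i \<phi>))"

text \<open>$C_c^\infty(\Omega)$; test functions are extended by zero outside \<open>\<Omega>\<close>.\<close>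

definition test_functions :: "(real^'n) set \<Rightarrow> (real^'n \<Rightarrow> real) set" where
  "test_functions \<Omega> = {\<phi>. (\<forall>k. C_k k \<phi>) \<and>
     compact (closure {x. \<phi> x \<noteq> 0}) \<and> closure {x. \<phi> x \<noteq> 0} \<subseteq> \<Omega>}"

definition has_weak_grad ::
  "(real^'n) set \<Rightarrow> (real^'n \<Rightarrow> real) \<Rightarrow> (real^'n \<Rightarrow> real^'n) \<Rightarrow> bool" where
  "has_weak_grad \<Omega> u G \<longleftrightarrow> (\<forall>\<phi>\<in>test_functions \<Omega>. \<forall>i.
     (LINT x|lebesgue_on \<Omega>. u x * partial_deriv i \<phi> x) =
       - (LINT x|lebesgue_on \<Omega>. G x $ i * \<phi> x))"

definition H1 :: "(real^'n) set \<Rightarrow> (real^'n \<Rightarrow> real) set" where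
  "H1 \<Omega> = {u \<in> L2_space \<Omega>. \<exists>G\<in>L2_space \<Omega>. has_weak_grad \<Omega> u G}"

text \<open>On \<^term>\<open>H1 \<Omega>\<close> the following is a representative of the weak gradient, which is
  unique up to null sets; elsewhere the value is meaningless.\<close>

definition weak_grad :: "(real^'n) set \<Rightarrow> (real^'n \<Rightarrow> real) \<Rightarrow> real^'n \<Rightarrow> real^'n" where
  "weak_grad \<Omega> u = (SOME G. G \<in> L2_space \<Omega> \<and> has_weak_grad \<Omega> u G)"

definition H1_inner :: "(real^'n) set \<Rightarrow> (real^'n \<Rightarrow> real) \<Rightarrow> (real^'n \<Rightarrow> real) \<Rightarrow> real" where
  "H1_inner \<Omega> u v = L2_inner \<Omega> u v + L2_inner \<Omega> (weak_grad \<Omega> u) (weak_grad \<Omega> v)"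

definition H1_norm :: "(real^'n) set \<Rightarrow> (real^'n \<Rightarrow> real) \<Rightarrow> real" where
  "H1_norm \<Omega> u = sqrt (H1_inner \<Omega> u u)"

definition H10 :: "(real^'n) set \<Rightarrow> (real^'n \<Rightarrow> real) set" where
  "H10 \<Omega> = {u \<in> H1 \<Omega>. \<exists>\<phi>. (\<forall>j. \<phi> j \<in> test_functions \<Omega>) \<and>
     (\<lambda>j. H1_norm \<Omega> (\<lambda>x. \<phi> j x - u x)) \<longlonglongrightarrow> 0}"

text \<open>
  No regularity of the boundary is assumed, so $H^{1/2}(\partial\Omega)$ is the trace space
  $H^1(\Omega)/H^1_0(\Omega)$: the boundary value of \<open>v\<close> is its coset, and two functions have
  the same boundary value iff their difference lies in $H^1_0(\Omega)$.
\<close>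

definition boundary_trace :: "(real^'n) set \<Rightarrow> (real^'n \<Rightarrow> real) \<Rightarrow> (real^'n \<Rightarrow> real) set" where
  "boundary_trace \<Omega> v = {w \<in> H1 \<Omega>. (\<lambda>x. w x - v x) \<in> H10 \<Omega>}"

definition H_half :: "(real^'n) set \<Rightarrow> (real^'n \<Rightarrow> real) set set" where
  "H_half \<Omega> = boundary_trace \<Omega> ` H1 \<Omega>"

text \<open>The distribution $\nabla\cdot g$, as a functional on test functions.\<close>

definition distr_div ::
  "(real^'n) set \<Rightarrow> (real^'n \<Rightarrow> real^'n) \<Rightarrow> (real^'n \<Rightarrow> real) \<Rightarrow> real" where
  "distr_div \<Omega> g \<phi> = - (LINT x|lebesgue_on \<Omega>. g x \<bullet> (\<chi> i. partial_deriv i \<phi> x))"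

definition divergence_free :: "(real^'n) set \<Rightarrow> (real^'n \<Rightarrow> real^'n) \<Rightarrow> bool" where
  "divergence_free \<Omega> g \<longleftrightarrow> (\<forall>\<phi>\<in>test_functions \<Omega>. distr_div \<Omega> g \<phi> = 0)"

text \<open>The weak solution of $\Delta u = \nabla\cdot g$ in \<open>\<Omega>\<close>, $u|_{\partial\Omega} = 0$, where
  $\Delta u = \nabla\cdot\nabla u$ in the sense of distributions.\<close>

definition weak_poisson_solution ::
  "(real^'n) set \<Rightarrow> (real^'n \<Rightarrow> real^'n) \<Rightarrow> (real^'n \<Rightarrow> real) \<Rightarrow> bool" where
  "weak_poisson_solution \<Omega> g u \<longleftrightarrow> u \<in> H10 \<Omega> \<and>
     (\<forall>\<phi>\<in>test_functions \<Omega>. distr_div \<Omega> (weak_grad \<Omega> u) \<phi> = distr_div \<Omega> g \<phi>)"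

definition primal_solution ::
  "(real^'n) set \<Rightarrow> (real^'n \<Rightarrow> real) \<Rightarrow> (real^'n \<Rightarrow> real) set \<Rightarrow> (real^'n \<Rightarrow> real) \<Rightarrow> bool" where
  "primal_solution \<Omega> a f v \<longleftrightarrow>
     is_arg_min (\<lambda>v. LINT x|lebesgue_on \<Omega>. a x * norm (weak_grad \<Omega> v x))
       (\<lambda>v. v \<in> H1 \<Omega> \<and> boundary_trace \<Omega> v = f) v"

definition dual_solution ::
  "(real^'n) set \<Rightarrow> (real^'n \<Rightarrow> real) \<Rightarrow> (real^'n \<Rightarrow> real) \<Rightarrow> (real^'n \<Rightarrow> real^'n) \<Rightarrow> bool" where
  "dual_solution \<Omega> a uf b \<longleftrightarrow>
     is_arg_max (\<lambda>b. L2_inner \<Omega> (weak_grad \<Omega> uf) b)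
       (\<lambda>b. b \<in> L2_space \<Omega> \<and> (AE x in lebesgue_on \<Omega>. norm (b x) \<le> a x) \<and>
         divergence_free \<Omega> b) b"

text \<open>The sequences generated from \<open>b 0\<close> and \<open>d 0\<close>; the values \<open>u 0\<close> and \<open>\<alpha> 0\<close> are not used.\<close>

definition approx_split_bregman ::
  "(real^'n) set \<Rightarrow> (real^'n \<Rightarrow> real) \<Rightarrow> real \<Rightarrow> (nat \<Rightarrow> real) \<Rightarrow> (real^'n \<Rightarrow> real) \<Rightarrow>
   (nat \<Rightarrow> real^'n \<Rightarrow> real^'n) \<Rightarrow> (nat \<Rightarrow> real^'n \<Rightarrow> real^'n) \<Rightarrow> (nat \<Rightarrow> real^'n \<Rightarrow> real) \<Rightarrow> bool" where
  "approx_split_bregman \<Omega> a lam \<alpha> uf b d u \<longleftrightarrow> (\<forall>k.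
     u (Suc k) \<in> H10 \<Omega> \<and>
     (\<exists>uex. weak_poisson_solution \<Omega> (\<lambda>x. d k x - b k x) uex \<and>
        L2_norm \<Omega> (\<lambda>x. weak_grad \<Omega> (u (Suc k)) x - weak_grad \<Omega> uex x) \<le> \<alpha> (Suc k)) \<and>
     (AE x in lebesgue_on \<Omega>.
        let w = weak_grad \<Omega> (u (Suc k)) x + weak_grad \<Omega> uf x + b k x in
        d (Suc k) x =
          (if norm w \<noteq> 0
           then (max (norm w - a x / lam) 0) *\<^sub>R (w /\<^sub>R norm w) - weak_grad \<Omega> uf x
           else - weak_grad \<Omega> uf x)) \<and>
     (AE x in lebesgue_on \<Omega>.
        b (Suc k) x = b k x + weak_grad \<Omega> (u (Suc k)) x - d (Suc k) x))"

text \<open>Weak convergence of a sequence in a Hilbert space with carrier \<open>V\<close> and inner product \<open>ip\<close>;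
  by the Riesz theorem the bounded functionals are the maps \<open>\<lambda>g. ip g h\<close> with \<open>h \<in> V\<close>.\<close>

definition weakly_converges ::
  "('c set) \<Rightarrow> ('c \<Rightarrow> 'c \<Rightarrow> real) \<Rightarrow> (nat \<Rightarrow> 'c) \<Rightarrow> 'c \<Rightarrow> bool" where
  "weakly_converges V ip F g \<longleftrightarrow> (\<forall>k. F k \<in> V) \<and> g \<in> V \<and>
     (\<forall>h\<in>V. (\<lambda>k. ip (F k) h) \<longlonglongrightarrow> ip g h)"

end

theory Submission
  imports Defs
begin

text \<open>
  The algorithm is Douglas--Rachford splitting in disguise. Let \<open>H\<close> be the Hilbert space $(L^2(\Omega))^n$, let
  \<open>V\<close> be the subspace of gradients of functions in $H^1_0(\Omega)$ and \<open>P\<close> the orthogonal projection onto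
  it; the kernel of \<open>P\<close> consists of the divergence-free fields (\<open>orthogonal_iff_divergence_free\<close>), and \<open>V\<close>
  is closed by the Poincare inequality (\<open>closed_H10_grads\<close>). The primal problem is to minimise
  \<open>G d = (1 / \<lambda>) * \<integral> a * norm (d + \<nabla>u_f)\<close> over \<open>d \<in> V\<close>. The update of \<open>d\<close> is
  \<open>d = J z\<close> at \<open>z = b + \<nabla>u\<close>, where the shrinkage map \<open>J\<close> is the resolvent of \<open>G\<close>, the update of \<open>b\<close>
  then reads \<open>b = z - J z\<close>, and the Poisson problem computes \<open>P (d - b)\<close> up to the error \<open>\<alpha>\<close>. In terms of \<open>z\<close> one round is
  \<open>z \<mapsto> T z + e\<close> with \<open>T z = z - J z + P (2 J z - z)\<close> and \<open>norm e \<le> \<alpha>\<close>.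

  The map \<open>T\<close> is firmly nonexpansive, and its fixed points are the sums \<open>d + b\<close> of a minimiser \<open>d \<in> V\<close> of
  \<open>G\<close> and a subgradient \<open>b\<close> of \<open>G\<close> at \<open>d\<close> that is orthogonal to \<open>V\<close>. A fixed point exists because a
  primal solution does: the solution keeps the fixed points of nearby contractions bounded, and a bounded
  sequence of approximate fixed points of a nonexpansive map has an exact one as its asymptotic centre
  (\<open>dr_map_fixed_point_exists\<close>). Given a fixed point, the distances of the iterates to fixed points converge
  and the squared residuals are summable; by Opial's argument, carried out with asymptotic centres, the
  iterates converge weakly to a fixed point (\<open>inexact_firmly_nonexpansive_iteration\<close>).

  Weak convergence of \<open>z\<close> does not pass through the nonlinear map \<open>J\<close>. But the residual \<open>z - T z\<close> tends to
  zero in norm, and since \<open>V\<close> is a subspace this splits into \<open>P b \<rightarrow> 0\<close> and \<open>(1 - P) d \<rightarrow> 0\<close>. So \<open>b\<close> and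
  \<open>d\<close> follow the linear images \<open>(1 - P) z\<close> and \<open>P z\<close> and converge weakly too
  (\<open>inexact_douglas_rachford\<close>). Weak convergence of gradients gives weak convergence in $H^1_0(\Omega)$
  because the functional \<open>u \<mapsto> \<langle>u, h\<rangle>\<close> is represented by a gradient (\<open>weakly_converges_H10\<close>).

  A fixed point provides a divergence-free field \<open>q = \<lambda> b\<close> with \<open>norm q \<le> a\<close> and
  \<open>q \<bullet> \<nabla>u = a * norm (\<nabla>u)\<close> almost everywhere. Divergence-free fields pair with the gradients of all
  competitors \<open>v\<close> in the same way, so \<open>\<langle>\<nabla>u_f, q\<rangle> = \<langle>\<nabla>v, q\<rangle> \<le> \<integral> a * norm (\<nabla>v)\<close> with equality at \<open>v = u\<close>.
  This yields optimality on both sides, and the equality case of Cauchy--Schwarz yields the formula for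
  the dual limit.

  The iterates and the weak gradients are determined only almost everywhere. The Hilbert space is
  therefore built as a quotient, and uniqueness of weak gradients is derived from the fundamental lemma of
  the calculus of variations.
\<close>

section \<open>Minimisation and asymptotic centres in Hilbert spaces\<close>

text \<open>
  The parallelogram law, in the form that makes the square of the distance to a given point strongly
  convex at midpoints. All minimisation arguments below rest on it.
\<close>

lemma midpoint_norm_identity:
  fixes x y z :: "'h::real_inner"
  shows "(dist z (midpoint x y))\<^sup>2 = ((dist z x)\<^sup>2 + (dist z y)\<^sup>2) / 2 - (dist x y)\<^sup>2 / 4"
  unfolding dist_norm midpoint_def power2_norm_eq_inner
  by (simp add: inner_simps inner_commute field_simps)

text \<open>
  Strong convexity at midpoints makes every minimising sequence Cauchy: the midpoint of two
  almost-minimisers would lie below the infimum if they were far apart. Projections, asymptotic centres and the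
  representation of functionals on $H^1_0$ are all obtained from this.
\<close>

lemma strongly_midpoint_convex_attains_min:
  fixes F :: "'h::{real_inner,complete_space} \<Rightarrow> real"
  assumes S: "closed S" "S \<noteq> {}"
    and mid: "\<And>x y. x \<in> S \<Longrightarrow> y \<in> S \<Longrightarrow> midpoint x y \<in> S"
    and conv: "\<And>x y. x \<in> S \<Longrightarrow> y \<in> S \<Longrightarrow> F (midpoint x y) \<le> (F x + F y) / 2 - c * (dist x y)\<^sup>2"
    and c: "c > 0"
    and cont: "continuous_on S F"
    and bdd: "\<And>x. x \<in> S \<Longrightarrow> B \<le> F x"
  obtains x where "x \<in> S" "\<And>y. y \<in> S \<Longrightarrow> F x \<le> F y"
proof -
  define m where "m = Inf (F ` S)"
  have bb: "bdd_below (F ` S)" using bdd by (auto intro!: bdd_belowI)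
  have m_le: "m \<le> F x" if "x \<in> S" for x
    unfolding m_def using bb that by (simp add: cInf_lower)
  have "\<exists>x\<in>S. F x < m + 1 / real (Suc n)" for n
    using cInf_lessD[of "F ` S" "m + 1 / real (Suc n)"] S unfolding m_def by auto
  then obtain x where xS: "\<And>n. x n \<in> S" and xm: "\<And>n. F (x n) < m + 1 / real (Suc n)"
    by metis
  have near: "c * (dist (x i) (x j))\<^sup>2 \<le> 1 / real (Suc n)" if "n \<le> i" "n \<le> j" for n i j
  proof -
    have "1 / real (Suc i) \<le> 1 / real (Suc n)" "1 / real (Suc j) \<le> 1 / real (Suc n)"
      using that by (auto simp: field_simps)
    then show ?thesis
      using conv[OF xS[of i] xS[of j]] m_le[OF mid[OF xS[of i] xS[of j]]] xm[of i] xm[of j] by argo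
  qed
  have "Cauchy x"
  proof (rule metric_CauchyI)
    fix e :: real assume e: "0 < e"
    then have "0 < c * e\<^sup>2" using c by simp
    then obtain n where n: "1 / real (Suc n) < c * e\<^sup>2"
      using nat_approx_posE by blast
    have "dist (x i) (x j) < e" if "n \<le> i" "n \<le> j" for i j
    proof -
      have "c * (dist (x i) (x j))\<^sup>2 < c * e\<^sup>2" using near[OF that] n by linarith
      then have "(dist (x i) (x j))\<^sup>2 < e\<^sup>2" using c by simp
      then show ?thesis using e by (simp add: power2_less_imp_less)
    qed
    then show "\<exists>M. \<forall>m\<ge>M. \<forall>n\<ge>M. dist (x m) (x n) < e" by blast
  qed
  then obtain l where l: "x \<longlonglongrightarrow> l" using Cauchy_convergent convergent_def by blast
  have lS: "l \<in> S" using closed_sequentially[OF S(1)] xS l by blast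
  have "(\<lambda>n. F (x n)) \<longlonglongrightarrow> F l"
    by (rule continuous_on_tendsto_compose[OF cont l lS]) (use xS in auto)
  moreover have "(\<lambda>n. m + 1 / real (Suc n)) \<longlonglongrightarrow> m"
    using LIMSEQ_inverse_real_of_nat_add[of m] by (simp add: inverse_eq_divide)
  ultimately have "F l \<le> m"
    using xm by (meson LIMSEQ_le less_imp_le)
  then show thesis using that lS m_le by (meson order_trans)
qed

text \<open>
  The asymptotic radius \<open>limsup (dist (z k) c)\<close>, taken along a filter on the indices. The filter
  serves to restrict a sequence to an infinite set of indices without passing to a subsequence, and the
  infimum of eventual bounds keeps the value real.
\<close>

definition asym_radius :: "nat filter \<Rightarrow> (nat \<Rightarrow> 'h::metric_space) \<Rightarrow> 'h \<Rightarrow> real" where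
  "asym_radius Fl z c = Inf {r. eventually (\<lambda>k. dist (z k) c \<le> r) Fl}"

context
  fixes Fl :: "nat filter" and z :: "nat \<Rightarrow> 'h::{real_inner,complete_space}"
  assumes nb: "Fl \<noteq> bot" and bz: "bounded (range z)"
begin

lemma asym_radius_nonneg_bound: "eventually (\<lambda>k. dist (z k) c \<le> r) Fl \<Longrightarrow> 0 \<le> r"
  using eventually_happens'[OF nb] by (meson order_trans zero_le_dist)

lemma asym_radius_nonempty: "{r. eventually (\<lambda>k. dist (z k) c \<le> r) Fl} \<noteq> {}"
proof -
  obtain e where "\<forall>y\<in>range z. dist c y \<le> e" using bz bounded_any_center by blast
  then have "eventually (\<lambda>k. dist (z k) c \<le> e) Fl" by (simp add: dist_commute)
  then show ?thesis by blast
qed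

lemma asym_radius_le: "eventually (\<lambda>k. dist (z k) c \<le> r) Fl \<Longrightarrow> asym_radius Fl z c \<le> r"
  unfolding asym_radius_def
  by (rule cInf_lower) (auto intro!: bdd_belowI[of _ 0] dest: asym_radius_nonneg_bound)

lemma asym_radius_nonneg: "0 \<le> asym_radius Fl z c"
  unfolding asym_radius_def
  by (rule cInf_greatest[OF asym_radius_nonempty]) (auto dest: asym_radius_nonneg_bound)

lemma eventually_asym_radius: 
  assumes "asym_radius Fl z c < r" shows "eventually (\<lambda>k. dist (z k) c \<le> r) Fl"
proof -
  obtain s where "eventually (\<lambda>k. dist (z k) c \<le> s) Fl" "s < r"
    using cInf_lessD[OF asym_radius_nonempty assms[unfolded asym_radius_def]] by auto
  then show ?thesis by (auto elim!: eventually_mono)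
qed

lemma asym_radius_lipschitz: "asym_radius Fl z c \<le> asym_radius Fl z c' + dist c c'"
proof (rule field_le_epsilon)
  fix e :: real assume "0 < e"
  then have "eventually (\<lambda>k. dist (z k) c' \<le> asym_radius Fl z c' + e) Fl"
    by (intro eventually_asym_radius) simp
  then have "eventually (\<lambda>k. dist (z k) c \<le> asym_radius Fl z c' + e + dist c c') Fl"
    by eventually_elim (metis add.commute add_right_mono dist_commute dist_triangle order_trans)
  from asym_radius_le[OF this]
  show "asym_radius Fl z c \<le> asym_radius Fl z c' + dist c c' + e" by simp
qed

lemma asym_radius_midpoint:
  "(asym_radius Fl z (midpoint x y))\<^sup>2
     \<le> ((asym_radius Fl z x)\<^sup>2 + (asym_radius Fl z y)\<^sup>2) / 2 - (1/4) * (dist x y)\<^sup>2"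
proof -
  let ?r = "asym_radius Fl z"
  have *: "(?r (midpoint x y))\<^sup>2 \<le> ((?r x + e)\<^sup>2 + (?r y + e)\<^sup>2) / 2 - (dist x y)\<^sup>2 / 4" (is "_ \<le> ?B")
    if "0 < e" for e
  proof -
    have "eventually (\<lambda>k. dist (z k) x \<le> ?r x + e) Fl" "eventually (\<lambda>k. dist (z k) y \<le> ?r y + e) Fl"
      using that by (auto intro!: eventually_asym_radius)
    then have ev: "eventually (\<lambda>k. (dist (z k) (midpoint x y))\<^sup>2 \<le> ?B) Fl"
    proof eventually_elim
      case (elim k)
      have "(dist (z k) x)\<^sup>2 \<le> (?r x + e)\<^sup>2" "(dist (z k) y)\<^sup>2 \<le> (?r y + e)\<^sup>2"
        using elim by (auto intro!: power_mono)
      then show ?case unfolding midpoint_norm_identity by (simp add: field_simps)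
    qed
    then have "0 \<le> ?B"
      using eventually_happens'[OF nb] by (meson order_trans zero_le_power2)
    moreover have "eventually (\<lambda>k. dist (z k) (midpoint x y) \<le> sqrt ?B) Fl"
      using ev by eventually_elim (rule real_le_rsqrt)
    ultimately show ?thesis
      using asym_radius_le asym_radius_nonneg
      by (metis power_mono real_sqrt_pow2)
  qed
  have "((\<lambda>e. ((?r x + e)\<^sup>2 + (?r y + e)\<^sup>2) / 2 - (dist x y)\<^sup>2 / 4) \<longlongrightarrow>
      ((?r x + 0)\<^sup>2 + (?r y + 0)\<^sup>2) / 2 - (dist x y)\<^sup>2 / 4) (at_right 0)"
    by (intro tendsto_intros) simp_all
  then have "(?r (midpoint x y))\<^sup>2 \<le> ((?r x + 0)\<^sup>2 + (?r y + 0)\<^sup>2) / 2 - (dist x y)\<^sup>2 / 4"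
    by (rule tendsto_lowerbound) (auto simp: eventually_at_filter intro!: always_eventually *[simplified])
  then show ?thesis by simp
qed

text \<open>
  The squared asymptotic radius inherits the parallelogram inequality, so it has a unique minimiser. This
  asymptotic centre takes the part of a weak limit of a bounded sequence.
\<close>

lemma asymptotic_centre:
  obtains c where "\<forall>x. asym_radius Fl z x \<le> asym_radius Fl z c \<longrightarrow> x = c"
proof -
  let ?r = "asym_radius Fl z"
  have "1-lipschitz_on UNIV ?r"
  proof (rule lipschitz_onI)
    show "dist (?r x) (?r y) \<le> 1 * dist x y" for x y
      using asym_radius_lipschitz[of x y] asym_radius_lipschitz[of y x]
      by (simp add: dist_real_def dist_commute)
  qed simp
  then have cont: "continuous_on UNIV ?r" by (rule lipschitz_on_continuous_on)
  then have cont2: "continuous_on UNIV (\<lambda>x. (?r x)\<^sup>2)" by (rule continuous_on_power)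
  obtain c where "\<And>y. y \<in> UNIV \<Longrightarrow> (?r c)\<^sup>2 \<le> (?r y)\<^sup>2"
    by (rule strongly_midpoint_convex_attains_min[OF _ _ _ asym_radius_midpoint _ cont2, of 0]) auto
  then have c: "\<And>y. (?r c)\<^sup>2 \<le> (?r y)\<^sup>2" by simp
  have "\<forall>x. ?r x \<le> ?r c \<longrightarrow> x = c"
  proof (intro allI impI)
    fix x assume "?r x \<le> ?r c"
    then have "(?r x)\<^sup>2 \<le> (?r c)\<^sup>2" using asym_radius_nonneg by (intro power_mono)
    with asym_radius_midpoint[of x c] c[of "midpoint x c"]
    have "(dist x c)\<^sup>2 \<le> 0" by argo
    then show "x = c" by simp
  qed
  then show thesis by (rule that)
qed

lemma asym_radius_eq_lim:
  assumes "((\<lambda>k. dist (z k) p) \<longlongrightarrow> l) Fl" shows "asym_radius Fl z p = l"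
proof (rule antisym; rule field_le_epsilon)
  fix e :: real assume e: "0 < e"
  have "eventually (\<lambda>k. dist (z k) p \<le> l + e) Fl"
    using order_tendstoD(2)[OF assms, of "l + e"] e by (auto elim!: eventually_mono)
  then show "asym_radius Fl z p \<le> l + e" by (rule asym_radius_le)
  have "eventually (\<lambda>k. dist (z k) p \<le> asym_radius Fl z p + e) Fl"
    using e by (intro eventually_asym_radius) simp
  then show "l \<le> asym_radius Fl z p + e"
    by (rule tendsto_upperbound[OF assms _ nb])
qed

text \<open>
  A nonexpansive map with \<open>z k - T (z k) \<longlonglongrightarrow> 0\<close> does not increase the asymptotic radius, so it has
  to leave the unique minimiser of the radius where it is.
\<close>

lemma asymptotic_centre_fixed:
  assumes T: "\<And>x y. dist (T x) (T y) \<le> dist x y"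
    and app: "((\<lambda>k. dist (z k) (T (z k))) \<longlongrightarrow> 0) Fl"
    and c: "\<forall>x. asym_radius Fl z x \<le> asym_radius Fl z c \<longrightarrow> x = c"
  shows "T c = c"
proof (rule c[rule_format], rule field_le_epsilon)
  fix e :: real assume e: "0 < e"
  have "eventually (\<lambda>k. dist (z k) c \<le> asym_radius Fl z c + e / 2) Fl"
    using e by (intro eventually_asym_radius) simp
  moreover have "eventually (\<lambda>k. dist (z k) (T (z k)) < e / 2) Fl"
    using order_tendstoD(2)[OF app, of "e/2"] e by simp
  ultimately have "eventually (\<lambda>k. dist (z k) (T c) \<le> asym_radius Fl z c + e) Fl"
  proof eventually_elim
    case (elim k)
    then show ?case using dist_triangle[of "z k" "T c" "T (z k)"] T[of "z k" c] by argo
  qed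
  then show "asym_radius Fl z (T c) \<le> asym_radius Fl z c + e" by (rule asym_radius_le)
qed

end

lemma nonexpansive_fixed_point_if_approximate:
  fixes T :: "'h::{real_inner,complete_space} \<Rightarrow> 'h"
  assumes "bounded (range z)" "\<And>x y. dist (T x) (T y) \<le> dist x y"
    "(\<lambda>k. dist (z k) (T (z k))) \<longlonglongrightarrow> 0"
  obtains c where "T c = c"
proof -
  obtain c where c: "\<forall>x. asym_radius sequentially z x \<le> asym_radius sequentially z c \<longrightarrow> x = c"
    using asymptotic_centre[OF sequentially_bot assms(1)] by blast
  have "T c = c"
    by (rule asymptotic_centre_fixed[where T = T and z = z, OF sequentially_bot assms(1) _ _ c]) (fact assms)+
  then show thesis by (rule that)
qed

text \<open>
  The distances \<open>dist (z k) p\<close> to fixed points \<open>p\<close> converge, so on fixed points the asymptotic radius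
  is the same along every sub-filter; since centres are fixed points, all sub-filters share one centre \<open>c\<close>.
  If \<open>z k \<bullet> h\<close> did not converge to \<open>c \<bullet> h\<close>, then along the indices where it stays away from it a small
  shift of \<open>c\<close> in direction \<open>h\<close> or \<open>- h\<close> would decrease the radius below its minimum.
\<close>

lemma opial_weak_convergence:
  fixes T :: "'h::{real_inner,complete_space} \<Rightarrow> 'h"
  assumes bz: "bounded (range z)" and T: "\<And>x y. dist (T x) (T y) \<le> dist x y"
    and app: "(\<lambda>k. dist (z k) (T (z k))) \<longlonglongrightarrow> 0"
    and conv: "\<And>p. T p = p \<Longrightarrow> convergent (\<lambda>k. dist (z k) p)"
  obtains c where "T c = c" "\<And>h. (\<lambda>k. z k \<bullet> h) \<longlonglongrightarrow> c \<bullet> h"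
proof -
  let ?r = "asym_radius sequentially z"
  obtain c where c: "\<forall>x. ?r x \<le> ?r c \<longrightarrow> x = c"
    using asymptotic_centre[OF sequentially_bot bz] by blast
  have Tc: "T c = c" by (rule asymptotic_centre_fixed[where T = T and z = z, OF sequentially_bot bz T app c])
  have half: "eventually (\<lambda>k. (z k - c) \<bullet> g < e) sequentially" if e: "0 < e" for g e
  proof (rule ccontr)
    assume neg: "\<not> ?thesis"
    \<comment> \<open>Restricting to the indices that violate the claim leaves a nontrivial filter.\<close>
    define Fl where "Fl = inf sequentially (principal {k. (z k - c) \<bullet> g \<ge> e})"
    have le: "Fl \<le> sequentially" unfolding Fl_def by simp
    have ev: "eventually (\<lambda>k. (z k - c) \<bullet> g \<ge> e) Fl"
      unfolding Fl_def eventually_inf_principal by simp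
    have nb: "Fl \<noteq> bot"
    proof
      assume "Fl = bot"
      then have "eventually (\<lambda>k. False) Fl" by simp
      then have "eventually (\<lambda>k. (z k - c) \<bullet> g < e) sequentially"
        unfolding Fl_def eventually_inf_principal by (simp add: not_le)
      with neg show False by contradiction
    qed
    let ?q = "asym_radius Fl z"
    obtain c' where c': "\<forall>x. ?q x \<le> ?q c' \<longrightarrow> x = c'"
      using asymptotic_centre[OF nb bz] by blast
    have Tc': "T c' = c'"
      by (rule asymptotic_centre_fixed[where T = T and z = z, OF nb bz T tendsto_mono[OF le app] c'])
    have same: "?q p = ?r p \<and> ((\<lambda>k. dist (z k) p) \<longlongrightarrow> ?q p) Fl" if p: "T p = p" for p
    proof -
      obtain l where l: "(\<lambda>k. dist (z k) p) \<longlonglongrightarrow> l" using conv[OF p] convergent_def by blast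
      show ?thesis
        using asym_radius_eq_lim[OF nb bz tendsto_mono[OF le l]] asym_radius_eq_lim[OF sequentially_bot bz l]
          tendsto_mono[OF le l] by simp
    qed
    have "?r c \<le> ?r c'" using c by (metis linear order_refl)
    then have "c = c'" using same[OF Tc] same[OF Tc'] c' by simp
    \<comment> \<open>This \<open>t\<close> makes the quadratic term of the shift at most half of the linear gain.\<close>
    define t where "t = e / ((norm g)\<^sup>2 + 1)"
    have gp: "(norm g)\<^sup>2 + 1 > 0" by (smt (verit) zero_le_power2)
    have t: "0 < t" unfolding t_def using e gp by simp
    have "t * (norm g)\<^sup>2 \<le> e" unfolding t_def using e gp by (simp add: field_simps)
    then have tg: "t\<^sup>2 * (norm g)\<^sup>2 \<le> t * e"
      using t by (simp add: power2_eq_square mult.assoc)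
    have "((\<lambda>k. (dist (z k) c)\<^sup>2) \<longlongrightarrow> (?q c)\<^sup>2) Fl"
      using same[OF Tc] by (intro tendsto_intros) auto
    then have "eventually (\<lambda>k. (dist (z k) c)\<^sup>2 < (?q c)\<^sup>2 + t * e / 2) Fl"
      using t e by (intro order_tendstoD) auto
    then have "eventually (\<lambda>k. (dist (z k) (c + t *\<^sub>R g))\<^sup>2 \<le> (?q c)\<^sup>2 - t * e / 2) Fl"
      using ev
    proof eventually_elim
      case (elim k)
      have "(dist (z k) (c + t *\<^sub>R g))\<^sup>2
          = (dist (z k) c)\<^sup>2 - 2 * t * ((z k - c) \<bullet> g) + t\<^sup>2 * (norm g)\<^sup>2"
        unfolding dist_norm power2_norm_eq_inner
        by (simp add: inner_simps inner_commute power2_eq_square algebra_simps)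
      moreover have "t * e \<le> t * ((z k - c) \<bullet> g)" using elim t by simp
      ultimately show ?case using elim tg by argo
    qed
    moreover from this have pos: "0 \<le> (?q c)\<^sup>2 - t * e / 2"
      using eventually_happens'[OF nb] by (meson order_trans zero_le_power2)
    ultimately have "eventually (\<lambda>k. dist (z k) (c + t *\<^sub>R g) \<le> sqrt ((?q c)\<^sup>2 - t * e / 2)) Fl"
      by (auto elim!: eventually_mono intro: real_le_rsqrt)
    then have *: "?q (c + t *\<^sub>R g) \<le> sqrt ((?q c)\<^sup>2 - t * e / 2)"
      by (rule asym_radius_le[OF nb bz])
    also have "\<dots> < ?q c"
      using t e asym_radius_nonneg[OF nb bz, of c] by (intro real_less_lsqrt) auto
    finally have lt: "?q (c + t *\<^sub>R g) < ?q c" .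
    then have "?q (c + t *\<^sub>R g) \<le> ?q c'" using \<open>c = c'\<close> by simp
    then have "c + t *\<^sub>R g = c" using c' \<open>c = c'\<close> by blast
    with lt show False by simp
  qed
  have "(\<lambda>k. z k \<bullet> h) \<longlonglongrightarrow> c \<bullet> h" for h
  proof (rule tendstoI)
    fix e :: real assume "0 < e"
    from half[OF this, of h] half[OF this, of "-h"]
    show "eventually (\<lambda>k. dist (z k \<bullet> h) (c \<bullet> h) < e) sequentially"
      by eventually_elim (auto simp: dist_real_def inner_simps)
  qed
  with Tc show thesis by (rule that)
qed

section \<open>Inexact iteration of firmly nonexpansive maps\<close>

lemma convergent_quasi_decreasing:
  fixes s \<epsilon> :: "nat \<Rightarrow> real"
  assumes "\<And>k. 0 \<le> s k" "\<And>k. s (Suc k) \<le> s k + \<epsilon> k" "summable \<epsilon>"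
  shows "convergent s"
proof -
  define q where "q k = s k - (\<Sum>i<k. \<epsilon> i)" for k
  have "decseq q" by (rule decseq_SucI) (use assms(2) in \<open>simp add: q_def algebra_simps\<close>)
  moreover have "(\<lambda>k. \<Sum>i<k. \<epsilon> i) \<longlonglongrightarrow> suminf \<epsilon>" by (rule summable_LIMSEQ[OF assms(3)])
  moreover from this obtain M where M: "\<And>k. \<bar>\<Sum>i<k. \<epsilon> i\<bar> \<le> M"
    by (metis convergentI convergent_imp_Bseq BseqE real_norm_def)
  have "- M \<le> q k" for k using assms(1)[of k] M[of k] unfolding q_def by linarith
  with \<open>decseq q\<close> obtain l where "q \<longlonglongrightarrow> l" using decseq_convergent by blast
  ultimately have "(\<lambda>k. q k + (\<Sum>i<k. \<epsilon> i)) \<longlonglongrightarrow> l + suminf \<epsilon>" by (intro tendsto_add)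
  then show ?thesis unfolding q_def by (auto intro: convergentI)
qed

text \<open>
  Each exact step satisfies
  \<open>dist (T z) p ^ 2 + norm (z - T z) ^ 2 \<le> dist z p ^ 2\<close>, so the squared steps telescope; summable errors
  disturb this only by a summable amount. Hence the distances to fixed points converge, and Opial's
  argument applies.
\<close>

theorem inexact_firmly_nonexpansive_iteration:
  fixes T :: "'h::{real_inner,complete_space} \<Rightarrow> 'h"
  assumes T: "\<And>x y. (norm (T x - T y))\<^sup>2 + (norm ((x - T x) - (y - T y)))\<^sup>2 \<le> (norm (x - y))\<^sup>2"
    and fp: "T p0 = p0"
    and step: "\<And>k. z (Suc k) = T (z k) + e k"
    and e: "summable (\<lambda>k. norm (e k))"
  shows "\<exists>c. T c = c \<and> (\<forall>h. (\<lambda>k. z k \<bullet> h) \<longlonglongrightarrow> c \<bullet> h)"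
    and "summable (\<lambda>k. (norm (z k - T (z k)))\<^sup>2)"
proof -
  have ne: "dist (T x) (T y) \<le> dist x y" for x y
  proof -
    have "(norm (T x - T y))\<^sup>2 \<le> (norm (x - y))\<^sup>2"
      using T[of x y] zero_le_power2[of "norm ((x - T x) - (y - T y))"] by linarith
    then show ?thesis unfolding dist_norm by (rule power2_le_imp_le) simp
  qed
  have quasi: "dist (z (Suc k)) p \<le> dist (z k) p + norm (e k)" if "T p = p" for p k
  proof -
    have "dist (z (Suc k)) p \<le> dist (T (z k)) (T p) + norm (e k)"
      unfolding step dist_norm that using norm_triangle_ineq[of "T (z k) - p" "e k"]
      by (simp add: algebra_simps)
    then show ?thesis using ne[of "z k" p] by linarith
  qed
  have conv: "convergent (\<lambda>k. dist (z k) p)" if "T p = p" for p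
    by (rule convergent_quasi_decreasing[OF _ quasi[OF that] e]) simp
  obtain M where M: "\<And>k. dist (z k) p0 \<le> M"
    using convergent_imp_Bseq[OF conv[OF fp]] by (auto simp: Bseq_def)
  have bz: "bounded (range z)"
    unfolding bounded_def using M by (intro exI[of _ p0] exI[of _ M]) (auto simp: dist_commute)
  obtain N where N: "\<And>k. norm (e k) \<le> N"
    using convergent_imp_Bseq[OF convergentI[OF summable_LIMSEQ_zero[OF e]]] by (auto simp: Bseq_def)
  let ?s = "\<lambda>k. (dist (z k) p0)\<^sup>2"
  have drop: "(norm (z k - T (z k)))\<^sup>2 \<le> (?s k - ?s (Suc k)) + (2 * M + N) * norm (e k)" for k
  proof -
    have 1: "dist (z (Suc k)) p0 \<le> dist (T (z k)) p0 + norm (e k)"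
      unfolding step dist_norm using norm_triangle_ineq[of "T (z k) - p0" "e k"]
      by (simp add: algebra_simps)
    have 2: "dist (T (z k)) p0 \<le> M" using ne[of "z k" p0] M[of k] fp by simp
    have "?s (Suc k) \<le> (dist (T (z k)) p0 + norm (e k))\<^sup>2" using 1 by (intro power_mono) auto
    also have "\<dots> = (dist (T (z k)) p0)\<^sup>2 + (2 * dist (T (z k)) p0 + norm (e k)) * norm (e k)"
      by (simp add: power2_eq_square algebra_simps)
    also have "\<dots> \<le> (dist (T (z k)) p0)\<^sup>2 + (2 * M + N) * norm (e k)"
      using 2 N[of k] by (intro add_left_mono mult_right_mono) auto
    finally show ?thesis using T[of "z k" p0] unfolding fp dist_norm by simp
  qed
  have sm: "summable (\<lambda>k. (norm (z k - T (z k)))\<^sup>2)"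
  proof (rule summable_comparison_test')
    obtain l where l: "(\<lambda>k. dist (z k) p0) \<longlonglongrightarrow> l" using conv[OF fp] convergent_def by blast
    have "?s \<longlonglongrightarrow> l\<^sup>2" by (intro tendsto_intros l)
    then show "summable (\<lambda>k. (?s k - ?s (Suc k)) + (2 * M + N) * norm (e k))"
      by (intro summable_add telescope_summable' summable_mult e)
    show "norm ((norm (z k - T (z k)))\<^sup>2) \<le> (?s k - ?s (Suc k)) + (2 * M + N) * norm (e k)"
      if "0 \<le> k" for k using drop[of k] by simp
  qed
  have "(\<lambda>k. sqrt ((norm (z k - T (z k)))\<^sup>2)) \<longlonglongrightarrow> sqrt 0"
    by (intro tendsto_intros summable_LIMSEQ_zero[OF sm])
  then have "(\<lambda>k. dist (z k) (T (z k))) \<longlonglongrightarrow> 0" by (simp add: dist_norm)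
  from opial_weak_convergence[where T = T, OF bz ne this conv]
  show "\<exists>c. T c = c \<and> (\<forall>h. (\<lambda>k. z k \<bullet> h) \<longlonglongrightarrow> c \<bullet> h)" by metis
  show "summable (\<lambda>k. (norm (z k - T (z k)))\<^sup>2)" by (rule sm)
qed

section \<open>Orthogonal projections\<close>

lemma quadratic_nonneg_imp_linear_coeff_zero:
  fixes s q :: real
  assumes "\<And>t. 0 \<le> 2 * t * s + t\<^sup>2 * q"
  shows "s = 0"
proof -
  define m where "m = \<bar>q\<bar> + 1"
  have m: "0 < m" "q \<le> m" unfolding m_def by auto
  have "0 \<le> 2 * (- s / m) * s + (- s / m)\<^sup>2 * q" by (rule assms)
  also have "\<dots> \<le> 2 * (- s / m) * s + (- s / m)\<^sup>2 * m"
    using m(2) by (intro add_left_mono mult_left_mono) auto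
  also have "\<dots> = - (s\<^sup>2 / m)" using m(1) by (simp add: power2_eq_square field_simps)
  finally have "s\<^sup>2 \<le> 0" using m(1) by (simp add: divide_le_0_iff)
  then show ?thesis by simp
qed

text \<open>
  The nearest point of \<open>V\<close>; orthogonality is the first-order condition of the quadratic
  \<open>t \<mapsto> dist x (v + t w) ^ 2\<close> at \<open>t = 0\<close>.
\<close>

lemma orthogonal_projection_exists:
  fixes V :: "'h::{real_inner,complete_space} set"
  assumes "closed V" "subspace V"
  shows "\<exists>v\<in>V. \<forall>w\<in>V. (x - v) \<bullet> w = 0"
proof -
  have mid: "midpoint v w \<in> V" if "v \<in> V" "w \<in> V" for v w
    unfolding midpoint_def using assms(2) that by (intro subspace_scale subspace_add)
  have 0: "0 \<in> V" by (rule subspace_0[OF assms(2)])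
  obtain v where v: "v \<in> V" "\<And>w. w \<in> V \<Longrightarrow> (dist x v)\<^sup>2 \<le> (dist x w)\<^sup>2"
    by (rule strongly_midpoint_convex_attains_min[OF assms(1) _ mid _ _ _, of "\<lambda>v. (dist x v)\<^sup>2" "1/4" 0])
      (use 0 in \<open>auto simp: midpoint_norm_identity intro!: continuous_intros\<close>)
  have "(x - v) \<bullet> w = 0" if w: "w \<in> V" for w
  proof -
    have "- ((x - v) \<bullet> w) = 0"
    proof (rule quadratic_nonneg_imp_linear_coeff_zero)
      fix t
      have "v + t *\<^sub>R w \<in> V" using assms(2) v(1) w by (intro subspace_add subspace_scale)
      from v(2)[OF this] show "0 \<le> 2 * t * - ((x - v) \<bullet> w) + t\<^sup>2 * (w \<bullet> w)"
        unfolding dist_norm power2_norm_eq_inner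
        by (simp add: inner_simps inner_commute power2_eq_square algebra_simps)
    qed
    then show ?thesis by simp
  qed
  then show ?thesis using v(1) by blast
qed

definition orth_proj :: "'h::real_inner set \<Rightarrow> 'h \<Rightarrow> 'h" where
  "orth_proj V x = (SOME v. v \<in> V \<and> (\<forall>w\<in>V. (x - v) \<bullet> w = 0))"

context
  fixes V :: "'h::{real_inner,complete_space} set"
  assumes V: "closed V" "subspace V"
begin

lemma orth_proj_in: "orth_proj V x \<in> V"
  and orth_proj_orthogonal: "w \<in> V \<Longrightarrow> (x - orth_proj V x) \<bullet> w = 0"
  using someI_ex[OF orthogonal_projection_exists[OF V, of x, unfolded Bex_def]]
  unfolding orth_proj_def by auto

lemma orth_proj_unique:
  assumes "v \<in> V" "\<And>w. w \<in> V \<Longrightarrow> (x - v) \<bullet> w = 0" shows "orth_proj V x = v"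
proof -
  let ?d = "orth_proj V x - v"
  have "?d \<in> V" using assms(1) orth_proj_in V by (simp add: subspace_diff)
  then have "?d \<bullet> ?d = 0"
    using assms(2)[of ?d] orth_proj_orthogonal[of ?d x] by (simp add: inner_simps)
  then show ?thesis by simp
qed

lemma orth_proj_id: "v \<in> V \<Longrightarrow> orth_proj V v = v"
  by (rule orth_proj_unique) auto

lemma orth_proj_add: "orth_proj V (x + y) = orth_proj V x + orth_proj V y"
proof (rule orth_proj_unique)
  show "orth_proj V x + orth_proj V y \<in> V" by (rule subspace_add[OF V(2) orth_proj_in orth_proj_in])
  fix w assume "w \<in> V"
  from orth_proj_orthogonal[OF this, of x] orth_proj_orthogonal[OF this, of y]
  show "(x + y - (orth_proj V x + orth_proj V y)) \<bullet> w = 0" by (simp add: inner_simps)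
qed

lemma orth_proj_diff: "orth_proj V (x - y) = orth_proj V x - orth_proj V y"
  using orth_proj_add[of "x - y" y] by (simp add: eq_diff_eq)

lemma orth_proj_scale: "orth_proj V (t *\<^sub>R x) = t *\<^sub>R orth_proj V x"
proof (rule orth_proj_unique)
  show "t *\<^sub>R orth_proj V x \<in> V" by (rule subspace_scale[OF V(2) orth_proj_in])
  fix w assume "w \<in> V"
  from orth_proj_orthogonal[OF this, of x]
  show "(t *\<^sub>R x - t *\<^sub>R orth_proj V x) \<bullet> w = 0" by (simp add: inner_simps)
qed

lemma orth_proj_selfadjoint: "orth_proj V x \<bullet> y = x \<bullet> orth_proj V y"
  using orth_proj_orthogonal[OF orth_proj_in[of y], of x] orth_proj_orthogonal[OF orth_proj_in[of x], of y]
  by (simp add: inner_simps inner_commute)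

lemma orth_proj_self_inner: "x \<bullet> orth_proj V x = (norm (orth_proj V x))\<^sup>2"
  using orth_proj_orthogonal[OF orth_proj_in[of x], of x]
  by (simp add: inner_simps power2_norm_eq_inner)

lemma norm_orth_proj_le: "norm (orth_proj V x) \<le> norm x"
proof -
  have "(norm (orth_proj V x))\<^sup>2 \<le> norm x * norm (orth_proj V x)"
    unfolding orth_proj_self_inner[symmetric] by (rule norm_cauchy_schwarz)
  then show ?thesis
    by (cases "norm (orth_proj V x) = 0") (auto simp: power2_eq_square)
qed

end

section \<open>Douglas--Rachford splitting over a closed subspace\<close>

text \<open>
  With \<open>R_J = 2 J - 1\<close> and \<open>R_V = 2 P - 1\<close> the reflections belonging to \<open>J\<close> and to the orthogonal
  projection \<open>P\<close> onto \<open>V\<close>, this is the Douglas--Rachford operator \<open>(1 + R_V R_J) / 2\<close>.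
\<close>

definition dr_map :: "('h::real_inner \<Rightarrow> 'h) \<Rightarrow> 'h set \<Rightarrow> 'h \<Rightarrow> 'h" where
  "dr_map J V z = z - J z + orth_proj V (2 *\<^sub>R J z - z)"

text \<open>
  Minimisation of \<open>G\<close> over a closed subspace \<open>V\<close>. The subgradient inequality \<open>resolvent\<close> says that
  \<open>z - J z\<close> is a subgradient of \<open>G\<close> at \<open>J z\<close>; it carries all the convexity that the argument uses.
\<close>

locale douglas_rachford =
  fixes V :: "'h::{real_inner,complete_space} set"
    and J :: "'h \<Rightarrow> 'h" and G :: "'h \<Rightarrow> real" and L :: real and d0 :: 'h
  assumes closed_V: "closed V" and subspace_V: "subspace V"
    and resolvent: "\<And>z y. G (J z) + (z - J z) \<bullet> (y - J z) \<le> G y"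
    and lip: "\<And>x y. G x - G y \<le> L * norm (x - y)"
    and d0_V: "d0 \<in> V"
    and d0_min: "\<And>v. v \<in> V \<Longrightarrow> G d0 \<le> G v"
begin

abbreviation "P \<equiv> orth_proj V"

lemmas P_in = orth_proj_in[OF closed_V subspace_V]
  and P_orth = orth_proj_orthogonal[OF closed_V subspace_V]
  and P_id = orth_proj_id[OF closed_V subspace_V]
  and P_add = orth_proj_add[OF closed_V subspace_V]
  and P_diff = orth_proj_diff[OF closed_V subspace_V]
  and P_scale = orth_proj_scale[OF closed_V subspace_V]
  and P_adj = orth_proj_selfadjoint[OF closed_V subspace_V]
  and P_self = orth_proj_self_inner[OF closed_V subspace_V]
  and P_le = norm_orth_proj_le[OF closed_V subspace_V]
  and P_idem = orth_proj_id[OF closed_V subspace_V orth_proj_in[OF closed_V subspace_V]]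

lemma J_monotone: "0 \<le> (J x - J y) \<bullet> ((x - J x) - (y - J y))"
proof -
  have "(x - J x) \<bullet> (J y - J x) + (y - J y) \<bullet> (J x - J y) \<le> 0"
    using resolvent[of x "J y"] resolvent[of y "J x"] by linarith
  then show ?thesis by (simp add: inner_simps inner_commute)
qed

text \<open>
  With \<open>p\<close> and \<open>q\<close> the increments of \<open>J\<close> and of \<open>1 - J\<close>, the two squares on the left add up to
  \<open>p \<bullet> p + q \<bullet> q\<close>, and monotonicity of the subdifferential gives \<open>p \<bullet> q \<ge> 0\<close>.
\<close>

lemma dr_map_firmly_nonexpansive:
  "(norm (dr_map J V x - dr_map J V y))\<^sup>2
     + (norm ((x - dr_map J V x) - (y - dr_map J V y)))\<^sup>2 \<le> (norm (x - y))\<^sup>2"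
proof -
  define p q where "p = J x - J y" and "q = (x - J x) - (y - J y)"
  have 1: "dr_map J V x - dr_map J V y = q + P (p - q)"
  proof -
    have "P (2 *\<^sub>R J x - x) - P (2 *\<^sub>R J y - y) = P (p - q)"
      unfolding P_diff[symmetric] p_def q_def by (rule arg_cong[of _ _ P]) (simp add: scaleR_2)
    then show ?thesis unfolding dr_map_def q_def by (simp add: algebra_simps)
  qed
  have 2: "(x - dr_map J V x) - (y - dr_map J V y) = p - P (p - q)"
    using 1 unfolding p_def q_def by (simp add: algebra_simps)
  have 3: "x - y = p + q" unfolding p_def q_def by simp
  let ?s = "P (p - q)"
  have "(p - q) \<bullet> ?s = ?s \<bullet> ?s" using P_self[of "p - q"] by (simp add: power2_norm_eq_inner)
  moreover have "0 \<le> p \<bullet> q" using J_monotone[of x y] unfolding p_def q_def .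
  ultimately show ?thesis unfolding 1 2 3 power2_norm_eq_inner
    by (simp add: inner_simps inner_commute)
qed

lemma dr_map_nonexpansive: "norm (dr_map J V x - dr_map J V y) \<le> norm (x - y)"
proof -
  have "(norm (dr_map J V x - dr_map J V y))\<^sup>2 \<le> (norm (x - y))\<^sup>2"
    using dr_map_firmly_nonexpansive[of x y]
      zero_le_power2[of "norm ((x - dr_map J V x) - (y - dr_map J V y))"] by linarith
  then show ?thesis by (rule power2_le_imp_le) simp
qed

text \<open>
  Subgradients of an \<open>L\<close>-Lipschitz function have norm at most \<open>L\<close>. The second alternative covers the
  trivial space, where \<open>L\<close> may be negative.
\<close>

lemma norm_resolvent_residual_le: "norm (z - J z) \<le> L \<or> z = J z"
proof -
  let ?b = "z - J z"
  have "?b \<bullet> ?b \<le> L * norm ?b"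
    using resolvent[of z z] lip[of z "J z"] by linarith
  then have "norm ?b * norm ?b \<le> L * norm ?b" by (simp add: dot_square_norm power2_eq_square)
  then show ?thesis by (cases "norm ?b = 0") auto
qed

text \<open>
  This is where the minimiser \<open>d0\<close> enters. A fixed point \<open>z\<close> consists of a minimiser \<open>J z\<close> and a
  subgradient \<open>z - J z\<close> orthogonal to \<open>V\<close>, so the lemma contains the existence of a dual solution.

  For \<open>0 < t \<le> 1\<close> the contraction \<open>z \<mapsto> T ((1 - t) z + t d0)\<close> has a fixed point \<open>z\<close>. Write
  \<open>d = J y\<close>, \<open>b = y - d\<close> for the resolvent pair at \<open>y = (1 - t) z + t d0\<close> and \<open>Q = 1 - P\<close>. The fixed
  point equation says \<open>P b = t (d0 - P d)\<close> and \<open>Q d = - t Q b\<close>. Inserted into the subgradient inequality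
  at \<open>d0\<close>, together with \<open>G d0 \<le> G (P d) \<le> G d + L norm (Q d)\<close>, these give
  \<open>norm (d0 - P d) ^ 2 + norm (Q b) ^ 2 \<le> L ^ 2\<close>: the points \<open>z\<close> stay bounded as \<open>t \<rightarrow> 0\<close>. They are
  approximate fixed points of \<open>T\<close>, and their asymptotic centre is an exact one.
\<close>

lemma dr_map_fixed_point_exists: obtains z where "dr_map J V z = z"
proof -
  let ?T = "dr_map J V"
  define M where "M = max L 0"
  have M: "0 \<le> M" "L \<le> M" unfolding M_def by auto
  have lipM: "G x - G y \<le> M * norm (x - y)" for x y
    using lip[of x y] mult_right_mono[OF M(2), of "norm (x - y)"] by simp
  have bM: "norm (z - J z) \<le> M" for z
    using norm_resolvent_residual_le[of z] M by auto
  have "\<exists>z. ?T ((1 - t) *\<^sub>R z + t *\<^sub>R d0) = z" if "0 < t" "t \<le> 1" for t :: real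
  proof -
    have "\<exists>!z. ?T ((1 - t) *\<^sub>R z + t *\<^sub>R d0) = z"
    proof (rule banach_fix_type[where c = "1 - t"])
      show "\<forall>x y. dist (?T ((1 - t) *\<^sub>R x + t *\<^sub>R d0)) (?T ((1 - t) *\<^sub>R y + t *\<^sub>R d0))
          \<le> (1 - t) * dist x y"
      proof (intro allI)
        fix x y
        have "norm (?T ((1 - t) *\<^sub>R x + t *\<^sub>R d0) - ?T ((1 - t) *\<^sub>R y + t *\<^sub>R d0))
            \<le> norm ((1 - t) *\<^sub>R (x - y))"
          by (rule order_trans[OF dr_map_nonexpansive]) (simp add: scaleR_diff_right)
        then show "dist (?T ((1 - t) *\<^sub>R x + t *\<^sub>R d0)) (?T ((1 - t) *\<^sub>R y + t *\<^sub>R d0))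
          \<le> (1 - t) * dist x y" using that by (simp add: dist_norm)
      qed
    qed (use that in auto)
    then show ?thesis by blast
  qed
  note ex = this
  define t where "t n = 1 / real (Suc n)" for n
  have t: "0 < t n" "t n \<le> 1" for n unfolding t_def by auto
  have "\<forall>n. \<exists>z. ?T ((1 - t n) *\<^sub>R z + t n *\<^sub>R d0) = z" using ex t by blast
  from choice[OF this] obtain z where z: "\<And>n. ?T ((1 - t n) *\<^sub>R z n + t n *\<^sub>R d0) = z n" by auto
  define y where "y n = (1 - t n) *\<^sub>R z n + t n *\<^sub>R d0" for n
  have Ty: "?T (y n) = z n" for n using z unfolding y_def .
  have zb: "norm (z n) \<le> 2 * M + norm d0" and yz: "norm (y n - z n) \<le> t n * (2 * M + 2 * norm d0)" for n
  proof -
    define d b where "d = J (y n)" and "b = y n - J (y n)"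
    have zdb: "z n = b + P (d - b)"
      unfolding Ty[symmetric] dr_map_def b_def d_def by (simp add: scaleR_2 algebra_simps)
    have yb: "y n - z n = d - P (d - b)" using zdb unfolding b_def d_def by simp
    have y': "y n - z n = t n *\<^sub>R (d0 - z n)" unfolding y_def by (simp add: algebra_simps)
    have eq: "d - P (d - b) = t n *\<^sub>R (d0 - z n)" using yb y' by simp
    have Pz: "P (z n) = P d" unfolding zdb P_add P_idem by (simp add: P_diff)
    have Pb: "P b = t n *\<^sub>R (d0 - P d)"
    proof -
      have "P (d - P (d - b)) = t n *\<^sub>R (P d0 - P (z n))"
        by (subst eq) (simp only: P_scale P_diff)
      then show ?thesis unfolding P_diff P_idem Pz P_id[OF d0_V] by simp
    qed
    have Qd: "d - P d = - t n *\<^sub>R (b - P b)"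
    proof -
      have "d - P d + P b = t n *\<^sub>R (d0 - b - P d + P b)"
        using eq unfolding zdb P_diff by (simp add: algebra_simps)
      then show ?thesis unfolding Pb by (simp add: algebra_simps)
    qed
    have nb: "norm b \<le> M" using bM unfolding b_def .
    have nQb: "norm (b - P b) \<le> M"
    proof -
      have "(b - P b) \<bullet> P b = 0" by (rule P_orth[OF P_in])
      then have "(norm (b - P b))\<^sup>2 = b \<bullet> b - (norm (P b))\<^sup>2"
        using P_self[of b] unfolding power2_norm_eq_inner
        by (simp add: inner_simps inner_commute)
      then have "(norm (b - P b))\<^sup>2 \<le> (norm b)\<^sup>2" by (simp add: power2_norm_eq_inner)
      then show ?thesis using nb by (meson norm_ge_zero order_trans power2_le_imp_le)
    qed
    have "G d + b \<bullet> (d0 - d) \<le> G d0" using resolvent[of "y n" d0] unfolding b_def d_def .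
    moreover have "G d0 \<le> G d + M * norm (d - P d)"
      using d0_min[OF P_in[of d]] lipM[of "P d" d] by (simp add: norm_minus_commute)
    ultimately have 1: "b \<bullet> (d0 - d) \<le> M * norm (d - P d)" by linarith
    have 2: "M * norm (d - P d) \<le> t n * M\<^sup>2"
      unfolding Qd using nQb M t[of n] by (simp add: power2_eq_square mult_left_mono mult.left_commute)
    have 3: "b \<bullet> (d0 - d) = t n * (norm (d0 - P d))\<^sup>2 + t n * (norm (b - P b))\<^sup>2"
    proof -
      have "d0 - d = (d0 - P d) + t n *\<^sub>R (b - P b)" using Qd by (simp add: algebra_simps)
      then have "b \<bullet> (d0 - d) = b \<bullet> (d0 - P d) + t n * (b \<bullet> (b - P b))"
        by (simp only: inner_add_right inner_scaleR_right)
      moreover have "b \<bullet> (d0 - P d) = t n * (norm (d0 - P d))\<^sup>2"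
      proof -
        have "d0 - P d \<in> V" using subspace_diff[OF subspace_V d0_V P_in] .
        from P_orth[OF this, of b] show ?thesis
          unfolding Pb inner_diff_left[of b] inner_scaleR_left power2_norm_eq_inner by simp
      qed
      moreover have "b \<bullet> (b - P b) = (norm (b - P b))\<^sup>2"
        using P_orth[OF P_in[of b], of b] unfolding power2_norm_eq_inner
        by (simp add: inner_simps inner_commute)
      ultimately show ?thesis by simp
    qed
    from 1 2 3 have "t n * ((norm (d0 - P d))\<^sup>2 + (norm (b - P b))\<^sup>2) \<le> t n * M\<^sup>2"
      by (simp add: algebra_simps)
    then have "(norm (d0 - P d))\<^sup>2 + (norm (b - P b))\<^sup>2 \<le> M\<^sup>2" using t[of n] by simp
    then have "(norm (d0 - P d))\<^sup>2 \<le> M\<^sup>2"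
      using zero_le_power2[of "norm (b - P b)"] by linarith
    then have "norm (d0 - P d) \<le> M" using M(1) by (rule power2_le_imp_le)
    moreover have "z n = (b - P b) - (d0 - P d) + d0" unfolding zdb P_diff by simp
    ultimately show zn: "norm (z n) \<le> 2 * M + norm d0"
      using nQb norm_triangle_ineq4[of "b - P b" "d0 - P d"]
        norm_triangle_ineq[of "(b - P b) - (d0 - P d)" d0] by simp
    have "norm (y n - z n) = t n * norm (d0 - z n)" unfolding y' using t[of n] by simp
    also have "\<dots> \<le> t n * (2 * M + 2 * norm d0)"
      using zn norm_triangle_ineq4[of d0 "z n"] t[of n] by (intro mult_left_mono) auto
    finally show "norm (y n - z n) \<le> t n * (2 * M + 2 * norm d0)" .
  qed
  have t0: "t \<longlonglongrightarrow> 0" unfolding t_def using LIMSEQ_inverse_real_of_nat by (simp add: inverse_eq_divide)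
  have app: "(\<lambda>n. dist (y n) (?T (y n))) \<longlonglongrightarrow> 0"
  proof (rule tendsto_sandwich[OF _ _ tendsto_const])
    show "(\<lambda>n. t n * (2 * M + 2 * norm d0)) \<longlonglongrightarrow> 0"
      using tendsto_mult_right[OF t0, of "2 * M + 2 * norm d0"] by simp
  qed (use yz in \<open>auto simp: Ty dist_norm\<close>)
  have "norm (y n) \<le> (2 * M + norm d0) + 1 * (2 * M + 2 * norm d0)" for n
  proof -
    have "t n * (2 * M + 2 * norm d0) \<le> 1 * (2 * M + 2 * norm d0)"
      using t[of n] M by (intro mult_right_mono) auto
    then show ?thesis using norm_triangle_ineq[of "z n" "y n - z n"] zb[of n] yz[of n] by simp
  qed
  then have "bounded (range y)" by (auto simp: bounded_iff)
  moreover have "dist (?T x) (?T y) \<le> dist x y" for x y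
    using dr_map_nonexpansive by (simp add: dist_norm)
  ultimately obtain c where "?T c = c"
    using nonexpansive_fixed_point_if_approximate[where T = ?T and z = y] app by metis
  then show thesis by (rule that)
qed

text \<open>
  The auxiliary points \<open>z k = b k + p k\<close> satisfy \<open>z (k + 1) = T (z k) + e (k + 1)\<close> and converge weakly to a
  fixed point \<open>c\<close>, but \<open>J\<close> need not be weakly continuous, so this does not yet say anything about
  \<open>d (k + 1) = J (z k)\<close>. What separates the two components is that \<open>V\<close> is a subspace:
  \<open>z k - T (z k) = d - P (d - b)\<close> tends to zero strongly, hence so do \<open>P b\<close> and \<open>(1 - P) d\<close>, and up to
  vanishing terms \<open>b\<close> and \<open>d\<close> are the images of \<open>z k\<close> under the weakly continuous maps \<open>1 - P\<close> and
  \<open>P\<close>.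
\<close>

theorem inexact_douglas_rachford:
  assumes p: "\<And>k. norm (p k - P (d k - b k)) \<le> \<epsilon> k" and \<epsilon>: "summable \<epsilon>"
    and d: "\<And>k. d (Suc k) = J (b k + p k)"
    and b: "\<And>k. b (Suc k) = b k + p k - d (Suc k)"
  shows "\<exists>B D. D \<in> V \<and> P B = 0 \<and> J (D + B) = D \<and> (\<forall>h. (\<lambda>k. b k \<bullet> h) \<longlonglongrightarrow> B \<bullet> h) \<and>
      (\<forall>h. (\<lambda>k. d k \<bullet> h) \<longlonglongrightarrow> D \<bullet> h) \<and> (\<forall>h. (\<lambda>k. p k \<bullet> h) \<longlonglongrightarrow> D \<bullet> h)"
    and "summable (\<lambda>k. (norm (p k - d k))\<^sup>2)"
proof -
  let ?T = "dr_map J V"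
  \<comment> \<open>The sequence \<open>z\<close> starts after one step, since \<open>b 0\<close> and \<open>d 0\<close> need not form a resolvent pair.\<close>
  define z where "z k = b k + p k" for k
  define e where "e k = p k - P (d k - b k)" for k
  have dz: "d (Suc k) = J (z k)" and bz: "b (Suc k) = z k - J (z k)" for k
    using b[of k] d[of k] unfolding z_def by auto
  have Tz: "?T (z k) = b (Suc k) + P (d (Suc k) - b (Suc k))" for k
    unfolding dr_map_def dz bz by (simp add: scaleR_2 algebra_simps)
  have step: "z (Suc k) = ?T (z k) + e (Suc k)" for k
    unfolding Tz unfolding z_def e_def by simp
  have se: "summable (\<lambda>k. norm (e k))"
    by (rule summable_comparison_test'[OF \<epsilon>, of 0]) (use p in \<open>auto simp: e_def\<close>)
  obtain p0 where p0: "?T p0 = p0" by (rule dr_map_fixed_point_exists)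
  have se': "summable (\<lambda>k. norm (e (Suc k)))" using se by (subst summable_Suc_iff)
  note iter = inexact_firmly_nonexpansive_iteration[where T = ?T and z = z and e = "\<lambda>k. e (Suc k)",
        OF dr_map_firmly_nonexpansive p0 step se']
  from iter(1) obtain c where Tc: "?T c = c" and zc: "\<And>h. (\<lambda>k. z k \<bullet> h) \<longlonglongrightarrow> c \<bullet> h"
    by blast
  note sm = iter(2)
  define r where "r k = z k - ?T (z k)" for k
  have r: "r k = d (Suc k) - P (d (Suc k) - b (Suc k))" for k
    unfolding r_def Tz using dz bz by (simp add: algebra_simps)
  have r0: "r \<longlonglongrightarrow> 0"
  proof -
    have "(\<lambda>k. sqrt ((norm (r k))\<^sup>2)) \<longlonglongrightarrow> sqrt 0"
      using sm unfolding r_def by (intro tendsto_intros summable_LIMSEQ_zero)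
    then show ?thesis by (simp add: tendsto_norm_zero_iff)
  qed
  have e0: "e \<longlonglongrightarrow> 0"
    using summable_LIMSEQ_zero[OF se] by (simp add: tendsto_norm_zero_iff)
  define D B where "D = J c" and "B = c - J c"
  have fixD: "D = P (D - B)" using Tc unfolding dr_map_def D_def B_def by (simp add: scaleR_2 algebra_simps)
  then have DV: "D \<in> V" using P_in by metis
  have PB: "P B = 0" using arg_cong[OF fixD, of P] unfolding P_idem unfolding P_diff by simp
  have PD: "P D = D" by (rule P_id[OF DV])
  have Pr: "P (r k) = P (b (Suc k))" for k unfolding r P_diff P_idem by simp
  have bQ: "b (Suc k) \<bullet> h = z k \<bullet> (h - P h) + (r k \<bullet> P h - (r k - P (r k)) \<bullet> h)" for k h
  proof -
    have "b (Suc k) = z k - d (Suc k)" using dz bz by simp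
    have Qd: "r k - P (r k) = d (Suc k) - P (d (Suc k))" unfolding Pr unfolding r P_diff by simp
    have "b (Suc k) \<bullet> h = (b (Suc k) - P (b (Suc k))) \<bullet> h + P (b (Suc k)) \<bullet> h" by (simp add: inner_simps)
    also have "P (b (Suc k)) \<bullet> h = r k \<bullet> P h" unfolding Pr[symmetric] P_adj ..
    also have "b (Suc k) - P (b (Suc k)) = (z k - P (z k)) - (d (Suc k) - P (d (Suc k)))"
      unfolding \<open>b (Suc k) = z k - d (Suc k)\<close> P_diff by simp
    finally show ?thesis unfolding Qd by (simp add: inner_simps P_adj)
  qed
  have Bh: "c \<bullet> (h - P h) = B \<bullet> h" for h
  proof -
    have "c = B + D" unfolding B_def D_def by simp
    then have "c \<bullet> (h - P h) = (c - P c) \<bullet> h" by (simp add: inner_simps P_adj)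
    then show ?thesis unfolding \<open>c = B + D\<close> P_add PB PD by simp
  qed
  have "(\<lambda>k. P (r k)) \<longlonglongrightarrow> 0"
    by (rule Lim_null_comparison[OF always_eventually tendsto_norm_zero[OF r0]]) (simp add: P_le)
  then have "(\<lambda>k. z k \<bullet> (h - P h) + (r k \<bullet> P h - (r k - P (r k)) \<bullet> h)) \<longlonglongrightarrow>
      c \<bullet> (h - P h) + (0 \<bullet> P h - (0 - 0) \<bullet> h)" for h
    by (intro tendsto_intros zc r0)
  then have bw: "(\<lambda>k. b (Suc k) \<bullet> h) \<longlonglongrightarrow> B \<bullet> h" for h unfolding bQ Bh by simp
  have dw: "(\<lambda>k. d (Suc k) \<bullet> h) \<longlonglongrightarrow> D \<bullet> h" for h
  proof -
    have "(\<lambda>k. z k \<bullet> h - b (Suc k) \<bullet> h) \<longlonglongrightarrow> c \<bullet> h - B \<bullet> h" by (intro tendsto_intros zc bw)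
    then show ?thesis unfolding dz bz B_def D_def by (simp add: inner_simps)
  qed
  have pd: "p (Suc k) - d (Suc k) = e (Suc k) - r k" for k unfolding e_def r by simp
  have pw: "(\<lambda>k. p (Suc k) \<bullet> h) \<longlonglongrightarrow> D \<bullet> h" for h
  proof -
    have "(\<lambda>k. d (Suc k) \<bullet> h + (e (Suc k) - r k) \<bullet> h) \<longlonglongrightarrow> D \<bullet> h + (0 - 0) \<bullet> h"
      by (intro tendsto_intros dw r0 LIMSEQ_Suc[OF e0])
    then show ?thesis unfolding pd[symmetric] by (simp add: inner_simps)
  qed
  have "summable (\<lambda>k. 2 * (norm (e (Suc k)))\<^sup>2 + 2 * (norm (r k))\<^sup>2)"
  proof (intro summable_add summable_mult)
    show "summable (\<lambda>k. (norm (r k))\<^sup>2)" using sm unfolding r_def .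
    have "summable (\<lambda>k. (norm (e k))\<^sup>2)"
    proof (rule summable_comparison_test_ev[OF _ se])
      have "eventually (\<lambda>k. norm (e k) < 1) sequentially"
        using order_tendstoD(2)[OF tendsto_norm_zero[OF e0], of 1] by simp
      then show "eventually (\<lambda>k. norm ((norm (e k))\<^sup>2) \<le> norm (e k)) sequentially"
        by eventually_elim (simp add: power2_eq_square mult_left_le)
    qed
    then show "summable (\<lambda>k. (norm (e (Suc k)))\<^sup>2)"
      by (rule summable_Suc_iff[where f = "\<lambda>k. (norm (e k))\<^sup>2", THEN iffD2])
  qed
  then have "summable (\<lambda>k. (norm (p (Suc k) - d (Suc k)))\<^sup>2)"
  proof (rule summable_comparison_test'[where N = 0])
    show "norm ((norm (p (Suc k) - d (Suc k)))\<^sup>2) \<le> 2 * (norm (e (Suc k)))\<^sup>2 + 2 * (norm (r k))\<^sup>2" for k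
    proof -
      have "norm (e (Suc k) - r k) \<le> norm (e (Suc k)) + norm (r k)" by (rule norm_triangle_ineq4)
      then have "(norm (e (Suc k) - r k))\<^sup>2 \<le> (norm (e (Suc k)) + norm (r k))\<^sup>2" by (intro power_mono) auto
      also have "\<dots> \<le> 2 * (norm (e (Suc k)))\<^sup>2 + 2 * (norm (r k))\<^sup>2"
        using sum_squares_bound[of "norm (e (Suc k))" "norm (r k)"] by (simp add: power2_sum)
      finally show ?thesis unfolding pd by simp
    qed
  qed
  then show "summable (\<lambda>k. (norm (p k - d k))\<^sup>2)"
    by (rule summable_Suc_iff[where f = "\<lambda>k. (norm (p k - d k))\<^sup>2", THEN iffD1])
  have "J (D + B) = D" unfolding D_def B_def by simp
  moreover have "(\<lambda>k. b k \<bullet> h) \<longlonglongrightarrow> B \<bullet> h" for h by (rule LIMSEQ_imp_Suc[OF bw])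
  moreover have "(\<lambda>k. d k \<bullet> h) \<longlonglongrightarrow> D \<bullet> h" for h by (rule LIMSEQ_imp_Suc[OF dw])
  moreover have "(\<lambda>k. p k \<bullet> h) \<longlonglongrightarrow> D \<bullet> h" for h by (rule LIMSEQ_imp_Suc[OF pw])
  ultimately show "\<exists>B D. D \<in> V \<and> P B = 0 \<and> J (D + B) = D \<and> (\<forall>h. (\<lambda>k. b k \<bullet> h) \<longlonglongrightarrow> B \<bullet> h) \<and>
      (\<forall>h. (\<lambda>k. d k \<bullet> h) \<longlonglongrightarrow> D \<bullet> h) \<and> (\<forall>h. (\<lambda>k. p k \<bullet> h) \<longlonglongrightarrow> D \<bullet> h)"
    using DV PB by blast
qed

end

section \<open>Square integrable functions as a Hilbert space\<close>

lemma L2_spaceI: "g \<in> borel_measurable (lebesgue_on \<Omega>) \<Longrightarrow> integrable (lebesgue_on \<Omega>) (\<lambda>x. (norm (g x))\<^sup>2)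
    \<Longrightarrow> g \<in> L2_space \<Omega>"
  unfolding L2_space_def by simp

lemma L2_space_measurable: "g \<in> L2_space \<Omega> \<Longrightarrow> g \<in> borel_measurable (lebesgue_on \<Omega>)"
  and L2_space_integrable: "g \<in> L2_space \<Omega> \<Longrightarrow> integrable (lebesgue_on \<Omega>) (\<lambda>x. (norm (g x))\<^sup>2)"
  unfolding L2_space_def by auto

lemma norm_mult_le_sum_squares: "norm u * norm v \<le> (norm u)\<^sup>2 + (norm v)\<^sup>2"
  for u :: "'a::real_normed_vector" and v :: "'b::real_normed_vector"
  using sum_squares_bound[of "norm u" "norm v"] mult_nonneg_nonneg[of "norm u" "norm v"]
    norm_ge_zero[of u] norm_ge_zero[of v] by linarith

lemma L2_integrable_norm_mult:
  assumes "g \<in> L2_space \<Omega>" "h \<in> L2_space \<Omega>"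
  shows "integrable (lebesgue_on \<Omega>) (\<lambda>x. norm (g x) * norm (h x))"
proof (rule Bochner_Integration.integrable_bound)
  show "integrable (lebesgue_on \<Omega>) (\<lambda>x. (norm (g x))\<^sup>2 + (norm (h x))\<^sup>2)"
    using assms by (intro Bochner_Integration.integrable_add L2_space_integrable)
  show "(\<lambda>x. norm (g x) * norm (h x)) \<in> borel_measurable (lebesgue_on \<Omega>)"
    using assms[THEN L2_space_measurable] by simp
  show "AE x in lebesgue_on \<Omega>. norm (norm (g x) * norm (h x)) \<le> norm ((norm (g x))\<^sup>2 + (norm (h x))\<^sup>2)"
    by (intro AE_I2) (simp add: norm_mult_le_sum_squares)
qed

lemma L2_integrable_inner:
  assumes "g \<in> L2_space \<Omega>" "h \<in> L2_space \<Omega>"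
  shows "integrable (lebesgue_on \<Omega>) (\<lambda>x. g x \<bullet> h x)"
  by (rule Bochner_Integration.integrable_bound[OF L2_integrable_norm_mult[OF assms]])
     (use assms[THEN L2_space_measurable] in \<open>auto simp: Cauchy_Schwarz_ineq2\<close>)

lemma L2_space_bound:
  assumes "g \<in> L2_space \<Omega>" "h \<in> borel_measurable (lebesgue_on \<Omega>)"
    "AE x in lebesgue_on \<Omega>. norm (h x) \<le> norm (g x)"
  shows "h \<in> L2_space \<Omega>"
proof (rule L2_spaceI[OF assms(2)], rule Bochner_Integration.integrable_bound[OF L2_space_integrable[OF assms(1)]])
  show "(\<lambda>x. (norm (h x))\<^sup>2) \<in> borel_measurable (lebesgue_on \<Omega>)" using assms(2) by simp
  show "AE x in lebesgue_on \<Omega>. norm ((norm (h x))\<^sup>2) \<le> norm ((norm (g x))\<^sup>2)"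
    using assms(3) by eventually_elim (simp add: power_mono)
qed

lemma L2_space_scale:
  assumes "g \<in> L2_space \<Omega>" shows "(\<lambda>x. r *\<^sub>R g x) \<in> L2_space \<Omega>"
proof (rule L2_spaceI)
  show "(\<lambda>x. r *\<^sub>R g x) \<in> borel_measurable (lebesgue_on \<Omega>)"
    using L2_space_measurable[OF assms] by simp
  show "integrable (lebesgue_on \<Omega>) (\<lambda>x. (norm (r *\<^sub>R g x))\<^sup>2)"
    using L2_space_integrable[OF assms] by (simp add: power_mult_distrib)
qed

lemma L2_space_add:
  assumes "g \<in> L2_space \<Omega>" "h \<in> L2_space \<Omega>" shows "(\<lambda>x. g x + h x) \<in> L2_space \<Omega>"
proof (rule L2_spaceI)
  show m: "(\<lambda>x. g x + h x) \<in> borel_measurable (lebesgue_on \<Omega>)"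
    using assms[THEN L2_space_measurable] by simp
  have "(norm (g x + h x))\<^sup>2 = (norm (g x))\<^sup>2 + 2 * (g x \<bullet> h x) + (norm (h x))\<^sup>2" for x
    by (simp add: power2_norm_eq_inner inner_simps inner_commute)
  then show "integrable (lebesgue_on \<Omega>) (\<lambda>x. (norm (g x + h x))\<^sup>2)"
    using assms by (simp add: L2_space_integrable L2_integrable_inner)
qed

lemma L2_space_diff:
  assumes "g \<in> L2_space \<Omega>" "h \<in> L2_space \<Omega>" shows "(\<lambda>x. g x - h x) \<in> L2_space \<Omega>"
  using L2_space_add[OF assms(1) L2_space_scale[OF assms(2), of "-1"]] by simp

lemma L2_space_zero: "(\<lambda>x. 0) \<in> L2_space \<Omega>"
  by (rule L2_spaceI) auto

text \<open>
  Functions on \<open>\<Omega>\<close> are extended by zero, so one quotient over the whole space serves every \<open>\<Omega>\<close>.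
\<close>

definition L2_eq :: "(real^'n \<Rightarrow> 'b::euclidean_space) \<Rightarrow> (real^'n \<Rightarrow> 'b) \<Rightarrow> bool" where
  "L2_eq f g \<longleftrightarrow> f \<in> L2_space UNIV \<and> g \<in> L2_space UNIV \<and> (AE x in lebesgue_on UNIV. f x = g x)"

quotient_type (overloaded) ('n, 'b) L2 = "real^'n::finite \<Rightarrow> 'b::euclidean_space" / partial: L2_eq
proof (rule part_equivpI)
  show "\<exists>f::real^'n \<Rightarrow> 'b. L2_eq f f" by (rule exI[of _ "\<lambda>x. 0"]) (simp add: L2_eq_def L2_space_zero)
  show "symp (L2_eq :: (real^'n \<Rightarrow> 'b) \<Rightarrow> _)"
    by (rule sympI) (auto simp: L2_eq_def elim!: eventually_mono)
  show "transp (L2_eq :: (real^'n \<Rightarrow> 'b) \<Rightarrow> _)"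
  proof (rule transpI)
    fix f g h :: "real^'n \<Rightarrow> 'b" assume *: "L2_eq f g" "L2_eq g h"
    then have "AE x in lebesgue_on UNIV. f x = g x" "AE x in lebesgue_on UNIV. g x = h x"
      by (auto simp: L2_eq_def)
    then have "AE x in lebesgue_on UNIV. f x = h x" by eventually_elim simp
    then show "L2_eq f h" using * by (simp add: L2_eq_def)
  qed
qed

lemma L2_inner_cong_AE:
  assumes "g \<in> L2_space \<Omega>" "g' \<in> L2_space \<Omega>" "h \<in> L2_space \<Omega>" "h' \<in> L2_space \<Omega>"
    and "AE x in lebesgue_on \<Omega>. g x = g' x" "AE x in lebesgue_on \<Omega>. h x = h' x"
  shows "L2_inner \<Omega> g h = L2_inner \<Omega> g' h'"
  unfolding L2_inner_def
proof (rule integral_cong_AE)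
  show "AE x in lebesgue_on \<Omega>. g x \<bullet> h x = g' x \<bullet> h' x"
    using assms(5,6) by eventually_elim simp
qed (use assms(1-4)[THEN L2_space_measurable] in auto)

instantiation L2 :: (finite, euclidean_space) real_vector
begin

lift_definition zero_L2 :: "('a, 'b) L2" is "\<lambda>x. 0"
  by (simp add: L2_eq_def L2_space_zero)

lift_definition plus_L2 :: "('a, 'b) L2 \<Rightarrow> ('a, 'b) L2 \<Rightarrow> ('a, 'b) L2" is "\<lambda>f g x. f x + g x"
  unfolding L2_eq_def by (auto simp: L2_space_add elim: eventually_elim2)

lift_definition minus_L2 :: "('a, 'b) L2 \<Rightarrow> ('a, 'b) L2 \<Rightarrow> ('a, 'b) L2" is "\<lambda>f g x. f x - g x"
  unfolding L2_eq_def by (auto simp: L2_space_diff elim: eventually_elim2)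

lift_definition uminus_L2 :: "('a, 'b) L2 \<Rightarrow> ('a, 'b) L2" is "\<lambda>f x. - f x"
  unfolding L2_eq_def using L2_space_diff[OF L2_space_zero] by (auto elim: eventually_mono)

lift_definition scaleR_L2 :: "real \<Rightarrow> ('a, 'b) L2 \<Rightarrow> ('a, 'b) L2" is "\<lambda>r f x. r *\<^sub>R f x"
  unfolding L2_eq_def by (auto simp: L2_space_scale elim: eventually_mono)

instance
proof
  fix f g h :: "('a, 'b) L2" and r s :: real
  show "f + g + h = f + (g + h)"
    by transfer (auto simp: L2_eq_def L2_space_add add.assoc)
  show "f + g = g + f"
    by transfer (auto simp: L2_eq_def L2_space_add add.commute)
  show "0 + f = f"
    by transfer (auto simp: L2_eq_def)
  show "- f + f = 0"
    by transfer (auto simp: L2_eq_def L2_space_zero)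
  show "f - g = f + - g"
    by transfer (auto simp: L2_eq_def L2_space_diff)
  show "r *\<^sub>R (f + g) = r *\<^sub>R f + r *\<^sub>R g"
    by transfer (auto simp: L2_eq_def L2_space_add L2_space_scale scaleR_add_right)
  show "(r + s) *\<^sub>R f = r *\<^sub>R f + s *\<^sub>R f"
    by transfer (auto simp: L2_eq_def L2_space_add L2_space_scale scaleR_add_left)
  show "r *\<^sub>R s *\<^sub>R f = (r * s) *\<^sub>R f"
    by transfer (auto simp: L2_eq_def L2_space_scale)
  show "1 *\<^sub>R f = f"
    by transfer (auto simp: L2_eq_def)
qed

end

instantiation L2 :: (finite, euclidean_space) real_inner
begin

lift_definition inner_L2 :: "('a, 'b) L2 \<Rightarrow> ('a, 'b) L2 \<Rightarrow> real" is "L2_inner UNIV"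
  unfolding L2_eq_def by (auto intro: L2_inner_cong_AE)

definition "norm (f :: ('a, 'b) L2) = sqrt (f \<bullet> f)"

definition "dist (f :: ('a, 'b) L2) g = norm (f - g)"

definition "sgn (f :: ('a, 'b) L2) = f /\<^sub>R norm f"

definition "(uniformity :: (('a, 'b) L2 \<times> ('a, 'b) L2) filter) =
  (INF e\<in>{0<..}. principal {(x, y). dist x y < e})"

definition "open (U :: ('a, 'b) L2 set) \<longleftrightarrow>
  (\<forall>x\<in>U. eventually (\<lambda>(x', y). x' = x \<longrightarrow> y \<in> U) uniformity)"

instance
proof
  fix f g h :: "('a, 'b) L2" and r :: real and U :: "('a, 'b) L2 set"
  show "dist f g = norm (f - g)" by (rule dist_L2_def)
  show "sgn f = f /\<^sub>R norm f" by (rule sgn_L2_def)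
  show "(uniformity :: (('a, 'b) L2 \<times> ('a, 'b) L2) filter) = (INF e\<in>{0<..}. principal {(x, y). dist x y < e})"
    by (rule uniformity_L2_def)
  show "open U \<longleftrightarrow> (\<forall>x\<in>U. eventually (\<lambda>(x', y). x' = x \<longrightarrow> y \<in> U) uniformity)"
    by (rule open_L2_def)
  show "f \<bullet> g = g \<bullet> f"
    by transfer (simp add: L2_inner_def inner_commute)
  show "(f + g) \<bullet> h = f \<bullet> h + g \<bullet> h"
    by transfer (simp add: L2_eq_def L2_inner_def inner_add_left L2_integrable_inner)
  show "r *\<^sub>R f \<bullet> g = r * (f \<bullet> g)"
    by transfer (simp add: L2_inner_def)
  show "0 \<le> f \<bullet> f"
    by transfer (simp add: L2_inner_def)
  show "f \<bullet> f = 0 \<longleftrightarrow> f = 0"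
  proof transfer
    fix f :: "real^'a \<Rightarrow> 'b" assume "L2_eq f f"
    then have f: "f \<in> L2_space UNIV" by (simp add: L2_eq_def)
    have "L2_inner UNIV f f = 0 \<longleftrightarrow> (AE x in lebesgue_on UNIV. f x \<bullet> f x = 0)"
      unfolding L2_inner_def by (rule integral_nonneg_eq_0_iff_AE[OF L2_integrable_inner[OF f f]]) simp
    then show "(L2_inner UNIV f f = 0) = L2_eq f (\<lambda>x. 0)"
      by (simp add: L2_eq_def f L2_space_zero)
  qed
  show "norm f = sqrt (f \<bullet> f)" by (rule norm_L2_def)
qed

end

lemma rep_L2_in: "rep_L2 Z \<in> L2_space UNIV"
  using Quotient3_rep_reflp[OF Quotient3_L2, of Z] by (simp add: L2_eq_def)

lemma abs_rep_L2: "abs_L2 (rep_L2 Z) = Z"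
  by (rule Quotient3_abs_rep[OF Quotient3_L2])

lemma abs_L2_eq_iff:
  assumes "f \<in> L2_space UNIV" "g \<in> L2_space UNIV"
  shows "abs_L2 f = abs_L2 g \<longleftrightarrow> (AE x in lebesgue_on UNIV. f x = g x)"
  using Quotient3_rel[OF Quotient3_L2, of f g] assms by (auto simp: L2_eq_def)

lemma rep_abs_L2: "f \<in> L2_space UNIV \<Longrightarrow> AE x in lebesgue_on UNIV. rep_L2 (abs_L2 f) x = f x"
  using abs_L2_eq_iff[OF rep_L2_in, of f] abs_rep_L2 by metis

lemma inner_abs_L2: "f \<in> L2_space UNIV \<Longrightarrow> g \<in> L2_space UNIV \<Longrightarrow> abs_L2 f \<bullet> abs_L2 g = L2_inner UNIV f g"
  by (rule inner_L2.abs_eq) (auto simp: L2_eq_def)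

lemma abs_L2_plus: "f \<in> L2_space UNIV \<Longrightarrow> g \<in> L2_space UNIV \<Longrightarrow> abs_L2 f + abs_L2 g = abs_L2 (\<lambda>x. f x + g x)"
  by (rule plus_L2.abs_eq) (auto simp: L2_eq_def)

lemma abs_L2_minus: "f \<in> L2_space UNIV \<Longrightarrow> g \<in> L2_space UNIV \<Longrightarrow> abs_L2 f - abs_L2 g = abs_L2 (\<lambda>x. f x - g x)"
  by (rule minus_L2.abs_eq) (auto simp: L2_eq_def)

lemma abs_L2_scale: "f \<in> L2_space UNIV \<Longrightarrow> r *\<^sub>R abs_L2 f = abs_L2 (\<lambda>x. r *\<^sub>R f x)"
  by (rule scaleR_L2.abs_eq) (auto simp: L2_eq_def)

lemma rep_L2_plus: "AE x in lebesgue_on UNIV. rep_L2 (Z + W) x = rep_L2 Z x + rep_L2 W x"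
  using rep_abs_L2[OF L2_space_add[OF rep_L2_in rep_L2_in], of Z W]
  by (simp add: abs_L2_plus[OF rep_L2_in rep_L2_in, symmetric] abs_rep_L2)

lemma nn_integral_rep_L2_diff:
  "(\<integral>\<^sup>+x. ennreal ((norm (rep_L2 Z x - rep_L2 W x))\<^sup>2) \<partial>lebesgue_on UNIV) = ennreal ((dist Z W)\<^sup>2)"
proof -
  have d: "(\<lambda>x. rep_L2 Z x - rep_L2 W x) \<in> L2_space UNIV" (is "?d \<in> _")
    by (rule L2_space_diff[OF rep_L2_in rep_L2_in])
  have "(dist Z W)\<^sup>2 = (Z - W) \<bullet> (Z - W)" by (simp add: dist_norm power2_norm_eq_inner)
  also have "Z - W = abs_L2 ?d"
    using abs_L2_minus[OF rep_L2_in rep_L2_in, of Z W] by (simp add: abs_rep_L2)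
  also have "abs_L2 ?d \<bullet> abs_L2 ?d = L2_inner UNIV ?d ?d" by (rule inner_abs_L2[OF d d])
  finally have "(dist Z W)\<^sup>2 = (LINT x|lebesgue_on UNIV. (norm (?d x))\<^sup>2)"
    by (simp add: L2_inner_def power2_norm_eq_inner)
  then show ?thesis
    using nn_integral_eq_integral[OF L2_space_integrable[OF d]] by simp
qed

text \<open>
  By the arithmetic--geometric mean inequality
  \<open>norm (g n) \<le> 2 ^ n * norm (g n) ^ 2 + 2 ^ (- n)\<close>. It replaces a sum of norms by a sum of squares, whose
  integral is computed term by term.
\<close>

lemma summable_norm_if_weighted_squares:
  fixes g :: "nat \<Rightarrow> 'b::real_normed_vector"
  assumes "summable (\<lambda>n. 2 ^ n * (norm (g n))\<^sup>2)"
  shows "summable (\<lambda>n. norm (g n))"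
proof (rule summable_comparison_test')
  show "summable (\<lambda>n. 2 ^ n * (norm (g n))\<^sup>2 + (1/2) ^ n)"
    using assms by (intro summable_add summable_geometric) auto
  show "norm (norm (g n)) \<le> 2 ^ n * (norm (g n))\<^sup>2 + (1/2) ^ n" if "0 \<le> n" for n
  proof -
    have "2 * norm (g n) = 2 * (sqrt (2^n) * norm (g n)) * (1 / sqrt (2^n))" by simp
    also have "\<dots> \<le> (sqrt (2^n) * norm (g n))\<^sup>2 + (1 / sqrt (2^n))\<^sup>2"
      by (rule sum_squares_bound)
    also have "\<dots> = 2 ^ n * (norm (g n))\<^sup>2 + (1/2) ^ n"
      by (simp add: power_mult_distrib power_divide power_one_over)
    finally show ?thesis using norm_ge_zero[of "g n"]
      unfolding real_norm_def abs_norm_cancel by linarith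
  qed
qed

text \<open>
  Riesz--Fischer. A subsequence whose increments have norm below \<open>2 ^ (- n)\<close> satisfies
  \<open>\<integral> (\<Sum>n. 2 ^ n * norm (f (n + 1) - f n) ^ 2) < \<infinity>\<close>, so it converges almost everywhere, and Fatou's lemma
  identifies the pointwise limit as the limit in the mean.
\<close>

instance L2 :: (finite, euclidean_space) complete_space
proof
  fix Z :: "nat \<Rightarrow> ('a, 'b) L2" assume C: "Cauchy Z"
  let ?M = "lebesgue_on UNIV :: (real^'a) measure"
  define N where "N n = (SOME N. \<forall>i\<ge>N. \<forall>j\<ge>N. dist (Z i) (Z j) < (1/2)^n)" for n
  have N: "dist (Z i) (Z j) < (1/2)^n" if "N n \<le> i" "N n \<le> j" for n i j
  proof -
    have "\<exists>N. \<forall>i\<ge>N. \<forall>j\<ge>N. dist (Z i) (Z j) < (1/2)^n" using metric_CauchyD[OF C, of "(1/2)^n"] by simp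
    from someI_ex[OF this] show ?thesis using that unfolding N_def by blast
  qed
  \<comment> \<open>The partial sums dominate every \<open>N i\<close> with \<open>i \<le> n\<close>; the summand \<open>n\<close> makes \<open>r\<close> strictly increasing.\<close>
  define r where "r n = n + (\<Sum>i\<le>n. N i)" for n
  have r: "strict_mono r" unfolding r_def by (intro strict_mono_Suc_iff[THEN iffD2]) simp
  have Nr: "N n \<le> r k" if "n \<le> k" for n k
    unfolding r_def using member_le_sum[of n "{..k}" N] that by simp
  define f where "f n = rep_L2 (Z (r n))" for n
  have fm: "f n \<in> borel_measurable ?M" for n unfolding f_def by (rule L2_space_measurable[OF rep_L2_in])
  have fd: "(\<integral>\<^sup>+x. ennreal ((norm (f m x - f n x))\<^sup>2) \<partial>?M) = ennreal ((dist (Z (r m)) (Z (r n)))\<^sup>2)" for m n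
    unfolding f_def by (rule nn_integral_rep_L2_diff)
  have "(\<integral>\<^sup>+x. (\<Sum>n. ennreal (2 ^ n * (norm (f (Suc n) x - f n x))\<^sup>2)) \<partial>?M)
      = (\<Sum>n. (\<integral>\<^sup>+x. ennreal (2 ^ n * (norm (f (Suc n) x - f n x))\<^sup>2) \<partial>?M))"
    by (rule nn_integral_suminf) (use fm in measurable)
  also have "\<dots> \<le> (\<Sum>n. ennreal ((1/2)^n))"
  proof (intro suminf_le allI summableI)
    fix n
    have "(\<integral>\<^sup>+x. ennreal (2 ^ n * (norm (f (Suc n) x - f n x))\<^sup>2) \<partial>?M)
        = ennreal (2^n) * (\<integral>\<^sup>+x. ennreal ((norm (f (Suc n) x - f n x))\<^sup>2) \<partial>?M)"
      by (subst nn_integral_cmult[symmetric]) (use fm in \<open>auto simp: ennreal_mult\<close>)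
    also have "\<dots> = ennreal (2^n * (dist (Z (r (Suc n))) (Z (r n)))\<^sup>2)"
      unfolding fd by (simp add: ennreal_mult)
    also have "\<dots> \<le> ennreal (2^n * ((1/2)^n)\<^sup>2)"
    proof (intro ennreal_leI mult_left_mono power_mono)
      show "dist (Z (r (Suc n))) (Z (r n)) \<le> (1/2)^n"
        using N[OF Nr[of n "Suc n"] Nr[of n n]] by simp
    qed auto
    also have "2^n * ((1/2)^n)\<^sup>2 = ((1/2)^n :: real)"
      by (simp add: power2_eq_square power_one_over)
    finally show "(\<integral>\<^sup>+x. ennreal (2 ^ n * (norm (f (Suc n) x - f n x))\<^sup>2) \<partial>?M) \<le> ennreal ((1/2)^n)" .
  qed
  also have "\<dots> < \<infinity>"
    by (subst suminf_ennreal2) (auto intro: summable_geometric)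
  finally have "AE x in ?M. (\<Sum>n. ennreal (2 ^ n * (norm (f (Suc n) x - f n x))\<^sup>2)) \<noteq> \<infinity>"
    by (intro nn_integral_PInf_AE) (use fm in \<open>auto simp: less_top\<close>)
  then have lim: "AE x in ?M. (\<lambda>n. f n x) \<longlonglongrightarrow> lim (\<lambda>n. f n x)"
  proof eventually_elim
    case (elim x)
    then have "summable (\<lambda>n. 2 ^ n * (norm (f (Suc n) x - f n x))\<^sup>2)"
      by (intro summable_suminf_not_top) auto
    from summable_norm_cancel[OF summable_norm_if_weighted_squares[OF this]]
    have "convergent (\<lambda>n. \<Sum>i<n. f (Suc i) x - f i x)" by (simp add: summable_iff_convergent)
    then have "convergent (\<lambda>n. (\<Sum>i<n. f (Suc i) x - f i x) + f 0 x)"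
      by (intro convergent_add convergent_const)
    then have "convergent (\<lambda>n. f n x)"
      by (subst (asm) sum_lessThan_telescope) simp
    then show ?case by (simp add: convergent_LIMSEQ_iff)
  qed
  define F where "F x = lim (\<lambda>n. f n x)" for x
  have Fm: "F \<in> borel_measurable ?M" unfolding F_def by (rule borel_measurable_lim_metric) (rule fm)
  have est: "(\<integral>\<^sup>+x. ennreal ((norm (F x - f m x))\<^sup>2) \<partial>?M) \<le> ennreal (((1/2)^n)\<^sup>2)" if "n \<le> m" for m n
  proof -
    have "(\<integral>\<^sup>+x. ennreal ((norm (F x - f m x))\<^sup>2) \<partial>?M)
        = (\<integral>\<^sup>+x. liminf (\<lambda>k. ennreal ((norm (f k x - f m x))\<^sup>2)) \<partial>?M)"
    proof (rule nn_integral_cong_AE)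
      show "AE x in ?M. ennreal ((norm (F x - f m x))\<^sup>2) = liminf (\<lambda>k. ennreal ((norm (f k x - f m x))\<^sup>2))"
        using lim
      proof eventually_elim
        case (elim x)
        have "(\<lambda>k. ennreal ((norm (f k x - f m x))\<^sup>2)) \<longlonglongrightarrow> ennreal ((norm (F x - f m x))\<^sup>2)"
          unfolding F_def by (intro tendsto_intros elim)
        then show ?case by (metis lim_imp_Liminf sequentially_bot)
      qed
    qed
    also have "\<dots> \<le> liminf (\<lambda>k. (\<integral>\<^sup>+x. ennreal ((norm (f k x - f m x))\<^sup>2) \<partial>?M))"
      by (rule nn_integral_liminf) (use fm in measurable)
    also have "\<dots> \<le> ennreal (((1/2)^n)\<^sup>2)"
      unfolding fd
    proof (rule Liminf_le)
      show "eventually (\<lambda>k. ennreal ((dist (Z (r k)) (Z (r m)))\<^sup>2) \<le> ennreal (((1/2)^n)\<^sup>2)) sequentially"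
        using eventually_ge_at_top[of n]
      proof eventually_elim
        case (elim k)
        show ?case using N[OF Nr[OF elim] Nr[OF that]] by (intro ennreal_leI power_mono) auto
      qed
    qed simp
    finally show ?thesis .
  qed
  have Fd: "(\<lambda>x. F x - f m x) \<in> L2_space UNIV" for m
  proof (rule L2_spaceI)
    show "(\<lambda>x. F x - f m x) \<in> borel_measurable ?M" using Fm fm[of m] by simp
    show "integrable ?M (\<lambda>x. (norm (F x - f m x))\<^sup>2)"
    proof (rule integrableI_bounded)
      show "(\<lambda>x. (norm (F x - f m x))\<^sup>2) \<in> borel_measurable ?M" using Fm fm[of m] by simp
      show "(\<integral>\<^sup>+x. ennreal (norm ((norm (F x - f m x))\<^sup>2)) \<partial>?M) < \<infinity>"
        using est[of 0 m] by (auto simp: less_top[symmetric] top_unique intro: le_less_trans)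
    qed
  qed
  have F: "F \<in> L2_space UNIV" using L2_space_add[OF Fd[of 0] rep_L2_in[of "Z (r 0)"]] by (simp add: f_def)
  have "(\<lambda>m. Z (r m)) \<longlonglongrightarrow> abs_L2 F"
  proof (rule metric_LIMSEQ_I)
    fix e :: real assume e: "0 < e"
    then obtain n where n: "(1/2)^n < e" using real_arch_pow_inv[of e "1/2"] by auto
    have "dist (Z (r m)) (abs_L2 F) < e" if "n \<le> m" for m
    proof -
      have "ennreal ((dist (abs_L2 F) (Z (r m)))\<^sup>2)
          = (\<integral>\<^sup>+x. ennreal ((norm (rep_L2 (abs_L2 F) x - rep_L2 (Z (r m)) x))\<^sup>2) \<partial>?M)"
        by (rule nn_integral_rep_L2_diff[symmetric])
      also have "\<dots> = (\<integral>\<^sup>+x. ennreal ((norm (F x - f m x))\<^sup>2) \<partial>?M)"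
        by (rule nn_integral_cong_AE) (use rep_abs_L2[OF F] in \<open>eventually_elim, simp add: f_def\<close>)
      finally have "ennreal ((dist (abs_L2 F) (Z (r m)))\<^sup>2) \<le> ennreal (((1/2)^n)\<^sup>2)"
        using est[OF that] by simp
      then have "(dist (abs_L2 F) (Z (r m)))\<^sup>2 \<le> ((1/2)^n)\<^sup>2" by (simp del: power_one_over)
      then have "dist (abs_L2 F) (Z (r m)) \<le> (1/2)^n" by (rule power2_le_imp_le) simp
      then show ?thesis using n by (simp add: dist_commute)
    qed
    then show "\<exists>no. \<forall>n\<ge>no. dist (Z (r n)) (abs_L2 F) < e" by blast
  qed
  then show "convergent Z"
    using Cauchy_converges_subseq[OF C r] convergentI unfolding comp_def by blast
qed

section \<open>Smooth bump functions and the fundamental lemma of the calculus of variations\<close>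

text \<open>
  Boxes generate the Borel sets and are stable under intersection, so by Dynkin's theorem the integral of
  \<open>h\<close> over every Borel set vanishes. The lemma on densities lives on \<open>lborel\<close>, whence the Borel
  representative \<open>k\<close>.
\<close>

lemma integrable_zero_if_box_integrals_zero:
  fixes h :: "real^'n \<Rightarrow> real"
  assumes h: "integrable lebesgue h" and off: "\<And>x. x \<notin> box p q \<Longrightarrow> h x = 0"
    and box: "\<And>a b. box a b \<subseteq> box p q \<Longrightarrow> (LINT x|lebesgue. indicator (box a b) x *\<^sub>R h x) = 0"
  shows "AE x in lebesgue. h x = 0"
proof -
  have "h \<in> borel_measurable (completion lborel)" using h by auto
  from completion_ex_borel_measurable_real[OF this]
  obtain k where km: "k \<in> borel_measurable lborel" and kh': "AE x in lborel. h x = k x" by blast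
  then have kh: "AE x in lebesgue. h x = k x" by (intro AE_completion)
  have kml: "k \<in> borel_measurable lebesgue" using km by (rule measurable_completion)
  have "integrable lebesgue k" using integrable_cong_AE_imp[OF h kml kh] .
  then have k: "integrable lborel k" using integrable_completion[OF km] by simp
  have eq: "(LINT x|lborel. indicator A x *\<^sub>R k x) = (LINT x|lebesgue. indicator A x *\<^sub>R h x)"
    if A: "A \<in> sets borel" for A
  proof -
    have "(LINT x|lborel. indicator A x *\<^sub>R k x) = (LINT x|lebesgue. indicator A x *\<^sub>R k x)"
      by (rule integral_completion[symmetric]) (use A km in simp)
    also have "\<dots> = (LINT x|lebesgue. indicator A x *\<^sub>R h x)"
    proof (rule integral_cong_AE)
      show "AE x in lebesgue. indicator A x *\<^sub>R k x = indicator A x *\<^sub>R h x"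
        using kh by eventually_elim simp
      have Al: "A \<in> sets lebesgue" using A by simp
      show "(\<lambda>x. indicator A x *\<^sub>R k x) \<in> borel_measurable lebesgue"
        by (rule borel_measurable_scaleR[OF borel_measurable_indicator[OF Al] kml])
      show "(\<lambda>x. indicator A x *\<^sub>R h x) \<in> borel_measurable lebesgue"
        by (rule borel_measurable_scaleR[OF borel_measurable_indicator[OF Al]]) (use h in auto)
    qed
    finally show ?thesis .
  qed
  let ?I = "\<lambda>A. LINT x|lborel. indicator A x *\<^sub>R k x"
  have box0: "?I (box a b) = 0" for a b
  proof -
    have "?I (box a b) = (LINT x|lebesgue. indicator (box a b) x *\<^sub>R h x)" by (rule eq) simp
    also have "\<dots> = (LINT x|lebesgue. indicator (box a b \<inter> box p q) x *\<^sub>R h x)"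
      by (rule Bochner_Integration.integral_cong) (auto simp: indicator_def off)
    also have "\<dots> = 0" unfolding box_Int_box by (rule box) (simp add: box_Int_box[symmetric])
    finally show ?thesis .
  qed
  have tot: "(LINT x|lborel. k x) = 0"
  proof -
    have "(LINT x|lborel. k x) = (LINT x|lborel. indicator UNIV x *\<^sub>R k x)" by simp
    also have "\<dots> = (LINT x|lebesgue. indicator UNIV x *\<^sub>R h x)" by (rule eq) simp
    also have "\<dots> = (LINT x|lebesgue. indicator (box p q) x *\<^sub>R h x)"
      by (rule Bochner_Integration.integral_cong) (auto simp: indicator_def off)
    also have "\<dots> = 0" by (rule box) simp
    finally show ?thesis .
  qed
  have si: "integrable lborel (\<lambda>x. indicator A x *\<^sub>R k x)" if "A \<in> sets borel" for A
    using integrable_mult_indicator[OF _ k, of A] that by simp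
  have all: "?I A = 0" if A: "A \<in> sets borel" for A
  proof -
    let ?G = "range (\<lambda>(a, b). box a b :: (real^'n) set)"
    have sb: "sigma_sets UNIV ?G = sets borel" by (subst borel_eq_box) simp
    have "Int_stable ?G" by (auto simp: Int_stable_def box_Int_box)
    moreover have "?G \<subseteq> Pow UNIV" by simp
    moreover have "A \<in> sigma_sets UNIV ?G" using A sb by simp
    ultimately show ?thesis
    proof (induction rule: sigma_sets_induct_disjoint)
      case (basic A) then show ?case using box0 by auto
    next
      case empty then show ?case by simp
    next
      case (compl A)
      then have A: "A \<in> sets borel" using sb by simp
      have "?I (UNIV - A) = (LINT x|lborel. k x - indicator A x *\<^sub>R k x)"
        by (rule Bochner_Integration.integral_cong) (auto simp: indicator_def)
      also have "\<dots> = 0"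
        by (subst Bochner_Integration.integral_diff[OF k si[OF A]]) (use compl tot in simp)
      finally show ?case .
    next
      case (union A)
      then have A: "A i \<in> sets lborel" for i using sb by auto
      have "(LINT x:(\<Union>i. A i)|lborel. k x) = (\<Sum>i. (LINT x:(A i)|lborel. k x))"
      proof (rule lebesgue_integral_countable_add[OF A])
        show "A i \<inter> A j = {}" if "i \<noteq> j" for i j
          using union(1) that by (auto simp: disjoint_family_on_def)
        have "(\<Union>i. A i) \<in> sets borel" using A by auto
        from si[OF this] show "set_integrable lborel (\<Union>i. A i) k"
          unfolding set_integrable_def .
      qed
      then show ?case using union(3) by (simp add: set_lebesgue_integral_def)
    qed
  qed
  have "AE x in lborel. k x = 0"
    by (rule sigma_finite_measure.density_zero[OF lborel.sigma_finite_measure_axioms k]) (use all in \<open>simp add: set_lebesgue_integral_def\<close>)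
  with kh' have "AE x in lborel. h x = 0" by eventually_elim simp
  then show ?thesis by (rule AE_completion)
qed

text \<open>
  The classical functions that are flat at the origin. The powers of \<open>1 / t\<close> make the family closed under
  differentiation up to linear combinations.
\<close>

definition flat :: "nat \<Rightarrow> real \<Rightarrow> real" where
  "flat n t = (if t > 0 then inverse t ^ n * exp (- inverse t) else 0)"

lemma flat_tendsto_0: "(flat n \<longlongrightarrow> 0) (at 0)"
proof -
  have "((\<lambda>t. inverse t ^ n / exp (inverse t)) \<longlongrightarrow> (0::real)) (at_right 0)"
    by (rule filterlim_compose[OF tendsto_power_div_exp_0 filterlim_inverse_at_top_right])
  then have "(flat n \<longlongrightarrow> 0) (at_right 0)"
    by (rule Lim_transform_eventually)
       (auto simp: eventually_at_filter flat_def exp_minus divide_inverse intro!: always_eventually)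
  moreover have "(flat n \<longlongrightarrow> 0) (at_left 0)"
    by (rule Lim_transform_eventually[OF tendsto_const])
       (auto simp: eventually_at_filter flat_def intro!: always_eventually)
  ultimately show ?thesis by (simp add: filterlim_split_at)
qed

text \<open>
  At the origin the difference quotient of \<open>flat n\<close> is \<open>flat (n + 1)\<close>, which tends to zero.
\<close>

lemma flat_has_derivative:
  "(flat n has_real_derivative (flat (n + 2) t - real n * flat (n + 1) t)) (at t)"
proof (cases t "0::real" rule: linorder_cases)
  case less
  have "((\<lambda>t. 0) has_real_derivative 0) (at t)" by simp
  then have "(flat n has_real_derivative 0) (at t)"
    by (rule DERIV_cong_ev[OF refl _ refl, THEN iffD1, rotated])
       (use eventually_nhds_in_open[of "{..<0}" t] less in \<open>auto simp: flat_def elim!: eventually_mono\<close>)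
  then show ?thesis using less by (simp add: flat_def)
next
  case equal
  have "((\<lambda>h. (flat n (0 + h) - flat n 0) / h) \<longlongrightarrow> 0) (at 0)"
    by (rule Lim_transform_eventually[OF flat_tendsto_0[of "Suc n"]])
       (auto simp: eventually_at_filter flat_def divide_inverse intro!: always_eventually)
  then show ?thesis using equal by (simp add: DERIV_def flat_def)
next
  case greater
  let ?u = "inverse t"
  have "((\<lambda>t. inverse t ^ n * exp (- inverse t)) has_real_derivative
      (real n * ?u ^ (n - 1) * (- (?u * ?u)) * exp (- ?u) + ?u ^ n * (exp (- ?u) * (?u * ?u)))) (at t)"
    using greater by (auto intro!: derivative_eq_intros simp: algebra_simps)
  also have "real n * ?u ^ (n - 1) * (- (?u * ?u)) * exp (- ?u) + ?u ^ n * (exp (- ?u) * (?u * ?u)) =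
      flat (n + 2) t - real n * flat (n + 1) t"
    using greater by (cases n) (auto simp: flat_def algebra_simps)
  finally have "((\<lambda>t. inverse t ^ n * exp (- inverse t)) has_real_derivative
      (flat (n + 2) t - real n * flat (n + 1) t)) (at t)" .
  then show ?thesis
    by (rule DERIV_cong_ev[OF refl _ refl, THEN iffD1, rotated])
       (use eventually_nhds_in_open[of "{0<..}" t] greater in \<open>auto simp: flat_def elim!: eventually_mono\<close>)
qed

text \<open>
  An algebra that contains the bump functions and is mapped into itself by partial derivatives, so that all
  its members are smooth.
\<close>

inductive_set smooth_algebra :: "(real^'n \<Rightarrow> real) set" where
  const: "(\<lambda>x. c) \<in> smooth_algebra"
| flat: "(\<lambda>x. flat n (c * x $ i + d)) \<in> smooth_algebra"
| add: "f \<in> smooth_algebra \<Longrightarrow> g \<in> smooth_algebra \<Longrightarrow> (\<lambda>x. f x + g x) \<in> smooth_algebra"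
| mult: "f \<in> smooth_algebra \<Longrightarrow> g \<in> smooth_algebra \<Longrightarrow> (\<lambda>x. f x * g x) \<in> smooth_algebra"

lemma partial_deriv_eq: "(f has_derivative D) (at x) \<Longrightarrow> partial_deriv i f x = D (axis i 1)"
  unfolding partial_deriv_def by (simp add: frechet_derivative_at[symmetric])

lemma partial_deriv_add:
  assumes "f differentiable (at x)" "g differentiable (at x)"
  shows "partial_deriv i (\<lambda>x. f x + g x) x = partial_deriv i f x + partial_deriv i g x"
  using partial_deriv_eq[OF has_derivative_add[OF assms[unfolded frechet_derivative_works]]]
  unfolding partial_deriv_def by simp

lemma partial_deriv_mult:
  assumes "f differentiable (at x)" "g differentiable (at x)"
  shows "partial_deriv i (\<lambda>x. f x * g x) x = f x * partial_deriv i g x + partial_deriv i f x * g x"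
  using partial_deriv_eq[OF has_derivative_mult[OF assms[unfolded frechet_derivative_works]]]
  unfolding partial_deriv_def by simp

lemma flat_coord_has_derivative:
  "((\<lambda>x::real^'n. flat n (c * x $ i + d)) has_derivative
    (\<lambda>h. (flat (n + 2) (c * x $ i + d) - real n * flat (n + 1) (c * x $ i + d)) * (c * h $ i))) (at x)"
proof -
  have "((\<lambda>x::real^'n. c * x $ i + d) has_derivative (\<lambda>h. c * h $ i)) (at x)"
    by (auto intro!: derivative_eq_intros bounded_linear.has_derivative[OF bounded_linear_vec_nth])
  from has_derivative_compose[OF this flat_has_derivative[unfolded has_field_derivative_def]]
  show ?thesis by (simp add: mult_ac)
qed

lemma smooth_algebra_closed:
  fixes f :: "real^'n \<Rightarrow> real"
  assumes "f \<in> smooth_algebra"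
  shows "(\<forall>x. f differentiable (at x)) \<and> (\<forall>j. partial_deriv j f \<in> smooth_algebra)"
  using assms
proof induction
  case (const c)
  have "partial_deriv j (\<lambda>x::real^'n. c) = (\<lambda>x. 0)" for j
    by (rule ext) (rule partial_deriv_eq[OF has_derivative_const])
  then show ?case by (auto intro: smooth_algebra.const)
next
  case (flat n c i d)
  have "partial_deriv j (\<lambda>x::real^'n. flat n (c * x $ i + d)) =
     (\<lambda>x. (flat (n + 2) (c * x $ i + d) + (- real n) * flat (n + 1) (c * x $ i + d)) * (c * axis j 1 $ i))" for j
    by (rule ext) (subst partial_deriv_eq[OF flat_coord_has_derivative], simp)
  moreover have "\<dots> j \<in> smooth_algebra" for j
    by (intro smooth_algebra.intros)
  moreover have "(\<lambda>x::real^'n. flat n (c * x $ i + d)) differentiable (at x)" for x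
    unfolding differentiable_def using flat_coord_has_derivative by blast
  ultimately show ?case by simp
next
  case (add f g)
  then have "partial_deriv j (\<lambda>x. f x + g x) = (\<lambda>x. partial_deriv j f x + partial_deriv j g x)" for j
    by (intro ext partial_deriv_add) auto
  with add show ?case by (auto intro: smooth_algebra.add)
next
  case (mult f g)
  then have "partial_deriv j (\<lambda>x. f x * g x) = (\<lambda>x. f x * partial_deriv j g x + partial_deriv j f x * g x)" for j
    by (intro ext partial_deriv_mult) auto
  with mult show ?case by (simp add: smooth_algebra.add smooth_algebra.mult)
qed

lemma smooth_algebra_C_k: "f \<in> smooth_algebra \<Longrightarrow> C_k k f"
proof (induction k arbitrary: f)
  case 0
  then show ?case using smooth_algebra_closed[OF 0]
    by (auto intro!: continuous_at_imp_continuous_on differentiable_imp_continuous_within)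
next
  case (Suc k)
  then show ?case using smooth_algebra_closed[OF Suc.prems] by auto
qed

lemma smooth_algebra_prod:
  "finite I \<Longrightarrow> (\<And>i. i \<in> I \<Longrightarrow> f i \<in> smooth_algebra) \<Longrightarrow> (\<lambda>x. \<Prod>i\<in>I. f i x) \<in> smooth_algebra"
  by (induction rule: finite_induct) (auto intro: smooth_algebra.intros)

text \<open>
  Positive exactly on the open box. The factor \<open>j + 1\<close> steepens the flanks, so that the functions
  increase to the indicator of the box as \<open>j\<close> grows.
\<close>

definition box_bump :: "real^'n \<Rightarrow> real^'n \<Rightarrow> nat \<Rightarrow> real^'n \<Rightarrow> real" where
  "box_bump a b j x = (\<Prod>i\<in>UNIV. flat 0 (real (Suc j) * (x $ i - a $ i)) * flat 0 (real (Suc j) * (b $ i - x $ i)))"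

lemma flat_0_bounds: "0 \<le> flat 0 t" "flat 0 t \<le> 1"
  by (auto simp: flat_def)

lemma flat_0_pos_iff: "flat 0 t = 0 \<longleftrightarrow> t \<le> 0"
  by (auto simp: flat_def)

lemma box_bump_nonzero_iff: "box_bump a b j x \<noteq> 0 \<longleftrightarrow> x \<in> box a b"
  unfolding box_bump_def mem_box_cart
  by (auto simp: flat_0_pos_iff not_le zero_less_mult_iff)

lemma box_bump_bounds: "0 \<le> box_bump a b j x" "box_bump a b j x \<le> 1"
  unfolding box_bump_def
  by (auto intro!: prod_nonneg prod_le_1 mult_nonneg_nonneg mult_le_one flat_0_bounds)

lemma box_bump_test_function:
  assumes "cbox a b \<subseteq> \<Omega>" shows "box_bump a b j \<in> test_functions \<Omega>"
proof -
  have "(\<lambda>x. \<Prod>i\<in>UNIV. flat 0 (real (Suc j) * x $ i + (- real (Suc j) * a $ i)) *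
        flat 0 ((- real (Suc j)) * x $ i + real (Suc j) * b $ i)) \<in> smooth_algebra"
    by (intro smooth_algebra_prod smooth_algebra.intros) auto
  also have "(\<lambda>x. \<Prod>i\<in>UNIV. flat 0 (real (Suc j) * x $ i + (- real (Suc j) * a $ i)) *
        flat 0 ((- real (Suc j)) * x $ i + real (Suc j) * b $ i)) = box_bump a b j"
    by (rule ext, unfold box_bump_def, rule prod.cong) (auto simp: algebra_simps simp del: of_nat_Suc)
  finally have "\<forall>k. C_k k (box_bump a b j)" using smooth_algebra_C_k by blast
  moreover have "closure {x. box_bump a b j x \<noteq> 0} \<subseteq> cbox a b"
    by (rule closure_minimal) (auto simp: box_bump_nonzero_iff intro: box_subset_cbox[THEN subsetD])
  moreover have "compact (closure {x. box_bump a b j x \<noteq> 0})"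
    unfolding compact_closure by (rule bounded_subset[OF bounded_box[of a b]]) (auto simp: box_bump_nonzero_iff)
  ultimately show ?thesis using assms unfolding test_functions_def by blast
qed

lemma flat_0_scaled_tendsto: "t > 0 \<Longrightarrow> (\<lambda>j. flat 0 (real (Suc j) * t)) \<longlonglongrightarrow> 1"
proof -
  assume t: "t > 0"
  have "(\<lambda>j. exp (- (inverse t * inverse (real (Suc j))))) \<longlonglongrightarrow> exp (- (inverse t * 0))"
    by (intro tendsto_intros LIMSEQ_inverse_real_of_nat)
  moreover have "exp (- (inverse t * inverse (real (Suc j)))) = flat 0 (real (Suc j) * t)" for j
    using t by (simp add: flat_def zero_less_mult_iff mult.commute)
  ultimately show ?thesis by simp
qed

lemma box_bump_tendsto: "(\<lambda>j. box_bump a b j x) \<longlonglongrightarrow> indicator (box a b) x"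
proof (cases "x \<in> box a b")
  case True
  then have "(\<lambda>j. box_bump a b j x) \<longlonglongrightarrow> (\<Prod>i\<in>(UNIV::'a set). 1 * 1)"
    unfolding box_bump_def mem_box_cart
    by (intro tendsto_prod tendsto_mult flat_0_scaled_tendsto) auto
  then show ?thesis using True by simp
next
  case False
  then have "box_bump a b j x = 0" for j using box_bump_nonzero_iff by blast
  then show ?thesis using False by simp
qed

lemma box_bump_measurable: "box_bump a b j \<in> borel_measurable (lebesgue_on \<Omega>)"
proof -
  have "box_bump a b j \<in> test_functions UNIV" by (rule box_bump_test_function) simp
  then have "C_k 0 (box_bump a b j)" unfolding test_functions_def by blast
  then have "box_bump a b j \<in> borel_measurable borel" by (simp add: borel_measurable_continuous_onI)
  then have "box_bump a b j \<in> borel_measurable lebesgue" by (simp add: measurable_completion)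
  then show ?thesis by (rule measurable_restrict_space1)
qed

lemma indicator_box_L2: 
  assumes "\<Omega> \<in> sets lebesgue"
  shows "(indicator (box a b) :: real^'n \<Rightarrow> real) \<in> L2_space \<Omega>"
proof (rule L2_spaceI)
  show "(indicator (box a b) :: real^'n \<Rightarrow> real) \<in> borel_measurable (lebesgue_on \<Omega>)"
    by (intro measurable_restrict_space1 borel_measurable_indicator) simp
  have "integrable lebesgue (indicator (box a b) :: real^'n \<Rightarrow> real)"
    by (rule integrable_real_indicator) (auto simp: emeasure_lborel_box_eq)
  from integrable_mult_indicator[OF assms this]
  have "integrable (lebesgue_on \<Omega>) (indicator (box a b) :: real^'n \<Rightarrow> real)"
    using assms by (simp add: integrable_restrict_space)
  moreover have "(norm (indicator (box a b) x :: real))\<^sup>2 = indicator (box a b) x" for x :: "real^'n"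
    by (simp add: indicator_def)
  ultimately show "integrable (lebesgue_on \<Omega>) (\<lambda>x. (norm (indicator (box a b) x :: real))\<^sup>2)" by simp
qed

text \<open>
  The fundamental lemma of the calculus of variations. Test functions approximate the indicator of a box
  whose closure lies in \<open>\<Omega>\<close>, so \<open>g\<close> integrates to zero over such boxes, and \<open>\<Omega>\<close> is a countable union of
  them up to the null sets formed by their faces.
\<close>

lemma AE_zero_if_orthogonal_to_test_functions:
  fixes g :: "real^'n \<Rightarrow> real"
  assumes "open \<Omega>" and g: "g \<in> L2_space \<Omega>"
    and orth: "\<And>\<phi>. \<phi> \<in> test_functions \<Omega> \<Longrightarrow> (LINT x|lebesgue_on \<Omega>. g x * \<phi> x) = 0"
  shows "AE x in lebesgue_on \<Omega>. g x = 0"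
proof -
  have \<Omega>: "\<Omega> \<in> sets lebesgue" using assms(1) by simp
  have \<Omega>': "\<Omega> \<inter> space lebesgue \<in> sets lebesgue" using \<Omega> by simp
  have gi: "integrable (lebesgue_on \<Omega>) (\<lambda>x. indicator (box a b) x * g x)" for a b
    using L2_integrable_inner[OF indicator_box_L2[OF \<Omega>] g] by simp
  have box0: "(LINT x|lebesgue_on \<Omega>. indicator (box a b) x * g x) = 0" if ab: "cbox a b \<subseteq> \<Omega>" for a b
  proof -
    have "(\<lambda>j. LINT x|lebesgue_on \<Omega>. g x * box_bump a b j x) \<longlonglongrightarrow>
        (LINT x|lebesgue_on \<Omega>. indicator (box a b) x * g x)"
    proof (rule integral_dominated_convergence)
      show "integrable (lebesgue_on \<Omega>) (\<lambda>x. \<bar>indicator (box a b) x * g x\<bar>)"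
        using gi by (rule integrable_abs)
      show "(\<lambda>x. indicator (box a b) x * g x) \<in> borel_measurable (lebesgue_on \<Omega>)" using gi by auto
      show "(\<lambda>x. g x * box_bump a b j x) \<in> borel_measurable (lebesgue_on \<Omega>)" for j
        by (rule borel_measurable_times[OF L2_space_measurable[OF g] box_bump_measurable])
      show "AE x in lebesgue_on \<Omega>. (\<lambda>j. g x * box_bump a b j x) \<longlonglongrightarrow> indicator (box a b) x * g x"
        by (rule AE_I2, subst mult.commute, rule tendsto_mult_left, rule box_bump_tendsto)
      show "AE x in lebesgue_on \<Omega>. norm (g x * box_bump a b j x) \<le> \<bar>indicator (box a b) x * g x\<bar>" for j
      proof (rule AE_I2)
        fix x
        show "norm (g x * box_bump a b j x) \<le> \<bar>indicator (box a b) x * g x\<bar>"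
        proof (cases "x \<in> box a b")
          case True
          then show ?thesis using box_bump_bounds[of a b j x] by (simp add: abs_mult mult_left_le)
        next
          case False
          then show ?thesis using box_bump_nonzero_iff[of a b j x] by simp
        qed
      qed
    qed
    moreover have "(LINT x|lebesgue_on \<Omega>. g x * box_bump a b j x) = 0" for j
      by (rule orth[OF box_bump_test_function[OF ab]])
    ultimately show ?thesis by (simp add: LIMSEQ_const_iff)
  qed
  have inbox: "AE x in lebesgue. x \<in> box p q \<longrightarrow> g x = 0" if pq: "cbox p q \<subseteq> \<Omega>" for p q
  proof -
    let ?h = "\<lambda>x. indicator (box p q) x * g x"
    have sub: "box p q \<subseteq> \<Omega>" using pq box_subset_cbox by blast
    have "AE x in lebesgue. ?h x = 0"
    proof (rule integrable_zero_if_box_integrals_zero)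
      have "integrable lebesgue (\<lambda>x. indicator \<Omega> x *\<^sub>R ?h x)"
        using gi[of p q] integrable_restrict_space[OF \<Omega>', of ?h] by simp
      moreover have "(\<lambda>x. indicator \<Omega> x *\<^sub>R ?h x) = ?h" using sub by (auto simp: indicator_def fun_eq_iff)
      ultimately show "integrable lebesgue ?h" by simp
      fix a b assume s: "box a b \<subseteq> box p q"
      have "(LINT x|lebesgue. indicator (box a b) x *\<^sub>R ?h x)
          = (LINT x|lebesgue. indicator \<Omega> x *\<^sub>R (indicator (box a b) x * g x))"
        by (rule Bochner_Integration.integral_cong) (use s sub in \<open>auto simp: indicator_def\<close>)
      also have "\<dots> = (LINT x|lebesgue_on \<Omega>. indicator (box a b) x * g x)"
        by (rule integral_restrict_space[OF \<Omega>', symmetric])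
      also have "\<dots> = 0"
      proof (cases "box a b = {}")
        case True then show ?thesis by simp
      next
        case False
        then have "cbox a b \<subseteq> cbox p q"
          using closure_mono[OF s] s by (metis closure_box closure_empty subset_empty)
        then show ?thesis using pq by (intro box0) blast
      qed
      finally show "(LINT x|lebesgue. indicator (box a b) x *\<^sub>R ?h x) = 0" .
    qed simp
    then show ?thesis by eventually_elim (simp add: indicator_def)
  qed
  obtain D where D: "countable D" "D \<subseteq> Pow \<Omega>" "\<And>X. X \<in> D \<Longrightarrow> \<exists>p q. X = cbox p q" "\<Union>D = \<Omega>"
    using open_countable_Union_open_cbox[OF assms(1)] by metis
  have "AE x in lebesgue. \<forall>X\<in>D. x \<in> X \<longrightarrow> g x = 0"
  proof (rule AE_ball_countable'[OF _ D(1)])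
    fix X assume X: "X \<in> D"
    then obtain p q where pq: "X = cbox p q" "cbox p q \<subseteq> \<Omega>" using D by blast
    have "AE x in lebesgue. x \<notin> cbox p q - box p q"
      using negligible_frontier_interval[of p q] by (intro AE_not_in) (simp add: negligible_iff_null_sets)
    with inbox[OF pq(2)] show "AE x in lebesgue. x \<in> X \<longrightarrow> g x = 0"
      unfolding pq by eventually_elim blast
  qed
  then have "AE x in lebesgue. x \<in> \<Union>D \<longrightarrow> g x = 0" by eventually_elim blast
  then have "AE x in lebesgue. x \<in> \<Omega> \<longrightarrow> g x = 0" unfolding D(4) .
  then show ?thesis by (simp add: AE_restrict_space_iff[OF \<Omega>'])
qed

section \<open>Integrals of partial derivatives\<close>

lemma lborel_integral_translate:
  fixes f :: "real^'n \<Rightarrow> real"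
  assumes "f \<in> borel_measurable borel"
  shows "(LINT x|lborel. f (c + x)) = (LINT x|lborel. f x)"
proof -
  have "(LINT x|lborel. f x) = (LINT x|distr lborel borel ((+) c). f x)" by (simp add: lborel_distr_plus)
  also have "\<dots> = (LINT x|lborel. f (c + x))" by (rule integral_distr) (use assms in auto)
  finally show ?thesis by simp
qed

lemma integrable_lborel_bounded_support:
  fixes f :: "real^'n \<Rightarrow> real"
  assumes "f \<in> borel_measurable borel" "\<And>x. \<bar>f x\<bar> \<le> M * indicator (cball 0 R) x"
  shows "integrable lborel f"
proof (rule Bochner_Integration.integrable_bound)
  show "integrable lborel (\<lambda>x::real^'n. M * indicator (cball 0 R) x)"
    by (intro integrable_mult_right integrable_real_indicator) (use emeasure_bounded_finite[OF bounded_cball] in auto)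
  show "f \<in> borel_measurable lborel" using assms(1) by simp
  show "AE x in lborel. norm (f x) \<le> norm (M * indicator (cball 0 R) x)"
    using assms(2) by (intro AE_I2) (metis abs_ge_self order_trans real_norm_def)
qed

lemma continuous_bounded_support_bound:
  fixes f :: "real^'n \<Rightarrow> 'b::real_normed_vector"
  assumes "continuous_on UNIV f" "\<And>x. norm x > R \<Longrightarrow> f x = 0"
  obtains M where "0 \<le> M" "\<And>x. norm (f x) \<le> M * indicator (cball 0 R) x"
proof -
  have "bounded (f ` cball 0 R)"
    by (intro compact_imp_bounded compact_continuous_image continuous_on_subset[OF assms(1)]) auto
  then obtain M where M: "\<And>x. x \<in> cball 0 R \<Longrightarrow> norm (f x) \<le> M" unfolding bounded_iff by blast
  have "norm (f x) \<le> max M 0 * indicator (cball 0 R) x" for x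
    using M[of x] assms(2)[of x] by (cases "x \<in> cball 0 R") (auto simp: le_max_iff_disj)
  then show thesis by (intro that[of "max M 0"]) auto
qed

text \<open>
  By translation invariance the difference quotients in direction \<open>i\<close> have integral zero; by the mean
  value theorem they are dominated by a multiple of the indicator of a ball, so the limit may be taken
  under the integral.
\<close>

lemma integral_partial_deriv_eq_0:
  fixes \<psi> :: "real^'n \<Rightarrow> real"
  assumes diff: "\<And>x. \<psi> differentiable (at x)"
    and cont: "continuous_on UNIV (partial_deriv i \<psi>)"
    and supp: "\<And>x. norm x > R \<Longrightarrow> \<psi> x = 0"
  shows "(LINT x|lborel. partial_deriv i \<psi> x) = 0"
proof -
  let ?e = "axis i 1 :: real^'n" and ?p = "partial_deriv i \<psi>"
  have cpsi: "continuous_on UNIV \<psi>"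
    using diff by (auto intro!: continuous_at_imp_continuous_on differentiable_imp_continuous_within)
  have p0: "?p x = 0" if "norm x > R" for x
  proof -
    have o: "open {x::real^'n. norm x > R}" by (intro open_Collect_less continuous_intros)
    have "((\<lambda>x. 0) has_derivative (\<lambda>h. 0)) (at x)" by (rule has_derivative_const)
    then have "(\<psi> has_derivative (\<lambda>h. 0)) (at x)"
      by (rule has_derivative_transform_within_open[OF _ o]) (use that supp in auto)
    then show ?thesis using partial_deriv_eq by metis
  qed
  have line: "((\<lambda>s. \<psi> (x + s *\<^sub>R ?e)) has_real_derivative ?p (x + s *\<^sub>R ?e)) (at s)" for x s
  proof -
    have 1: "((\<lambda>s. x + s *\<^sub>R ?e) has_derivative (\<lambda>h. h *\<^sub>R ?e)) (at s)"
      by (auto intro!: derivative_eq_intros)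
    have 2: "(\<psi> has_derivative (frechet_derivative \<psi> (at (x + s *\<^sub>R ?e)))) (at (x + s *\<^sub>R ?e))"
      using diff by (simp add: frechet_derivative_works)
    interpret bounded_linear "frechet_derivative \<psi> (at (x + s *\<^sub>R ?e))"
      by (rule has_derivative_bounded_linear[OF 2])
    show ?thesis using has_derivative_compose[OF 1 2]
      unfolding has_field_derivative_def partial_deriv_def by (simp add: scale mult_commute_abs)
  qed
  obtain M where M: "0 \<le> M" "\<And>x. norm (?p x) \<le> M * indicator (cball 0 R) x"
    using continuous_bounded_support_bound[OF cont p0] by metis
  have M': "\<bar>?p x\<bar> \<le> M" for x
    using M(2)[of x] M(1) by (cases "x \<in> cball 0 R") auto
  define t where "t n = inverse (real (Suc n))" for n
  have t: "0 < t n" "t n \<le> 1" for n unfolding t_def by (auto simp: inverse_le_1_iff)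
  have t0: "t \<longlonglongrightarrow> 0" unfolding t_def by (rule LIMSEQ_inverse_real_of_nat)
  define q where "q n x = (\<psi> (t n *\<^sub>R ?e + x) - \<psi> x) / t n" for n x
  have psib: "\<psi> \<in> borel_measurable borel" using cpsi by (rule borel_measurable_continuous_onI)
  have pb: "?p \<in> borel_measurable borel" using cont by (rule borel_measurable_continuous_onI)
  have shiftb: "(\<lambda>x. \<psi> (c + x)) \<in> borel_measurable borel" for c
    by (rule borel_measurable_continuous_onI[OF continuous_on_compose2[OF cpsi]])
      (auto intro!: continuous_intros)
  have bound: "\<bar>q n x\<bar> \<le> M * indicator (cball 0 (R + 1)) x" for n x
  proof (cases "norm x \<le> R + 1")
    case True
    obtain s where s: "\<psi> (x + t n *\<^sub>R ?e) - \<psi> (x + 0 *\<^sub>R ?e) = (t n - 0) * ?p (x + s *\<^sub>R ?e)"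
      using MVT2[OF t(1)[of n] line[of x]] by metis
    then have "q n x = ?p (x + s *\<^sub>R ?e)" using t(1)[of n] by (simp add: q_def add.commute)
    then show ?thesis using True M' by simp
  next
    case False
    have "norm x \<le> norm (t n *\<^sub>R ?e + x) + norm (t n *\<^sub>R ?e)"
      using norm_triangle_ineq4[of "t n *\<^sub>R ?e + x" "t n *\<^sub>R ?e"] by simp
    also have "norm (t n *\<^sub>R ?e) \<le> 1" using t[of n] by (simp add: norm_axis_1)
    finally have "norm (t n *\<^sub>R ?e + x) > R" using False by simp
    then show ?thesis using False supp by (simp add: q_def)
  qed
  have psii: "integrable lborel \<psi>"
  proof -
    obtain K where "\<And>x. norm (\<psi> x) \<le> K * indicator (cball 0 R) x"
      using continuous_bounded_support_bound[OF cpsi supp] by metis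
    then show ?thesis by (intro integrable_lborel_bounded_support[OF psib]) simp
  qed
  have shifti: "integrable lborel (\<lambda>x. \<psi> (c + x))" for c
    using integrable_distr_eq[of "(+) c" lborel borel \<psi>] psii psib by (simp add: lborel_distr_plus)
  have "(\<lambda>n. LINT x|lborel. q n x) \<longlonglongrightarrow> (LINT x|lborel. ?p x)"
  proof (rule integral_dominated_convergence)
    show "integrable lborel (\<lambda>x::real^'n. M * indicator (cball 0 (R + 1)) x)"
      by (intro integrable_mult_right integrable_real_indicator) (use emeasure_bounded_finite[OF bounded_cball] in auto)
    show "?p \<in> borel_measurable lborel" using pb by simp
    show "q n \<in> borel_measurable lborel" for n unfolding q_def using psib shiftb by simp
    show "AE x in lborel. norm (q n x) \<le> M * indicator (cball 0 (R + 1)) x" for n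
      using bound by (intro AE_I2) simp
    show "AE x in lborel. (\<lambda>n. q n x) \<longlonglongrightarrow> ?p x"
    proof (rule AE_I2)
      fix x
      have "((\<lambda>h. (\<psi> (x + (0 + h) *\<^sub>R ?e) - \<psi> (x + 0 *\<^sub>R ?e)) / h) \<longlongrightarrow> ?p (x + 0 *\<^sub>R ?e)) (at 0)"
        using line[of x 0] unfolding DERIV_def .
      then have lim: "((\<lambda>h. (\<psi> (x + h *\<^sub>R ?e) - \<psi> x) / h) \<longlongrightarrow> ?p x) (at 0)" by simp
      have "filterlim t (at 0) sequentially"
        unfolding filterlim_at
      proof (intro conjI always_eventually allI)
        show "t n \<noteq> 0" for n using t(1)[of n] by simp
      qed (simp_all add: t0)
      from filterlim_compose[OF lim this]
      show "(\<lambda>n. q n x) \<longlonglongrightarrow> ?p x" by (simp add: q_def add.commute)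
    qed
  qed
  moreover have "(LINT x|lborel. q n x) = 0" for n
    unfolding q_def by (simp add: Bochner_Integration.integral_diff[OF shifti psii] lborel_integral_translate[OF psib])
  ultimately show ?thesis by (simp add: LIMSEQ_const_iff)
qed

section \<open>Functions on a domain as elements of the Hilbert space\<close>

definition to_L2 :: "(real^'n) set \<Rightarrow> (real^'n \<Rightarrow> 'b::euclidean_space) \<Rightarrow> ('n, 'b) L2" where
  "to_L2 \<Omega> g = abs_L2 (\<lambda>x. indicator \<Omega> x *\<^sub>R g x)"

definition grad :: "(real^'n \<Rightarrow> real) \<Rightarrow> real^'n \<Rightarrow> real^'n" where
  "grad \<phi> x = (\<chi> i. partial_deriv i \<phi> x)"

lemma L2_inner_restrict:
  assumes "\<Omega> \<in> sets lebesgue"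
  shows "L2_inner UNIV (\<lambda>x. indicator \<Omega> x *\<^sub>R g x) h = L2_inner \<Omega> g h"
proof -
  have "\<Omega> \<inter> space lebesgue \<in> sets lebesgue" using assms by simp
  from integral_restrict_space[OF this, of "\<lambda>x. g x \<bullet> h x"] show ?thesis
    unfolding L2_inner_def lebesgue_on_UNIV_eq by simp
qed

lemma L2_space_subset:
  assumes "\<Omega> \<in> sets lebesgue" "g \<in> L2_space UNIV" shows "g \<in> L2_space \<Omega>"
proof (rule L2_spaceI)
  have \<Omega>: "\<Omega> \<inter> space lebesgue \<in> sets lebesgue" using assms by simp
  show "g \<in> borel_measurable (lebesgue_on \<Omega>)"
    using L2_space_measurable[OF assms(2)] unfolding lebesgue_on_UNIV_eq by (rule measurable_restrict_space1)
  have "integrable lebesgue (\<lambda>x. (norm (g x))\<^sup>2)"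
    using L2_space_integrable[OF assms(2)] unfolding lebesgue_on_UNIV_eq .
  from integrable_mult_indicator[OF assms(1) this]
  show "integrable (lebesgue_on \<Omega>) (\<lambda>x. (norm (g x))\<^sup>2)"
    using integrable_restrict_space[OF \<Omega>, of "\<lambda>x. (norm (g x))\<^sup>2"] by simp
qed

lemma L2_space_extend:
  fixes g :: "real^'n \<Rightarrow> 'b::euclidean_space"
  assumes "\<Omega> \<in> sets lebesgue" "g \<in> L2_space \<Omega>"
  shows "(\<lambda>x. indicator \<Omega> x *\<^sub>R g x) \<in> L2_space UNIV"
proof (rule L2_spaceI)
  have \<Omega>: "\<Omega> \<inter> space lebesgue \<in> sets lebesgue" using assms by simp
  have "(\<lambda>x. if x \<in> \<Omega> then g x else 0) \<in> borel_measurable lebesgue"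
    by (rule borel_measurable_if_I[OF L2_space_measurable[OF assms(2)] assms(1)])
  moreover have "(\<lambda>x. if x \<in> \<Omega> then g x else 0) = (\<lambda>x. indicator \<Omega> x *\<^sub>R g x)"
    by (auto simp: fun_eq_iff indicator_def)
  ultimately show "(\<lambda>x. indicator \<Omega> x *\<^sub>R g x) \<in> borel_measurable (lebesgue_on UNIV)"
    unfolding lebesgue_on_UNIV_eq by simp
  have "integrable lebesgue (\<lambda>x. indicator \<Omega> x *\<^sub>R (norm (g x))\<^sup>2)"
    using L2_space_integrable[OF assms(2)] integrable_restrict_space[OF \<Omega>, of "\<lambda>x. (norm (g x))\<^sup>2"] by simp
  moreover have "indicator \<Omega> x *\<^sub>R (norm (g x))\<^sup>2 = (norm (indicator \<Omega> x *\<^sub>R g x))\<^sup>2" for x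
    by (simp add: indicator_def)
  ultimately show "integrable (lebesgue_on UNIV) (\<lambda>x. (norm (indicator \<Omega> x *\<^sub>R g x))\<^sup>2)"
    unfolding lebesgue_on_UNIV_eq by simp
qed

lemma AE_lebesgue_on_iff:
  assumes "\<Omega> \<in> sets lebesgue"
  shows "(AE x in lebesgue_on \<Omega>. P x) \<longleftrightarrow> (AE x in lebesgue_on UNIV. x \<in> \<Omega> \<longrightarrow> P x)"
  unfolding lebesgue_on_UNIV_eq by (rule AE_restrict_space_iff) (use assms in simp)

context
  fixes \<Omega> :: "(real^'n) set"
  assumes meas: "\<Omega> \<in> sets lebesgue"
begin

lemma inner_to_L2:
  assumes "g \<in> L2_space \<Omega>" "h \<in> L2_space \<Omega>"
  shows "to_L2 \<Omega> g \<bullet> to_L2 \<Omega> h = L2_inner \<Omega> g h"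
proof -
  have "to_L2 \<Omega> g \<bullet> to_L2 \<Omega> h = L2_inner UNIV (\<lambda>x. indicator \<Omega> x *\<^sub>R g x) (\<lambda>x. indicator \<Omega> x *\<^sub>R h x)"
    unfolding to_L2_def by (intro inner_abs_L2 L2_space_extend[OF meas] assms)
  also have "\<dots> = L2_inner \<Omega> g h"
    unfolding L2_inner_restrict[OF meas] unfolding L2_inner_def
    by (rule Bochner_Integration.integral_cong) (auto simp: space_restrict_space)
  finally show ?thesis .
qed

lemma inner_rep_to_L2:
  assumes "h \<in> L2_space \<Omega>"
  shows "Z \<bullet> to_L2 \<Omega> h = L2_inner \<Omega> (rep_L2 Z) h"
proof -
  have "Z \<bullet> to_L2 \<Omega> h = to_L2 \<Omega> h \<bullet> abs_L2 (rep_L2 Z)" by (simp add: abs_rep_L2 inner_commute)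
  also have "\<dots> = L2_inner UNIV (\<lambda>x. indicator \<Omega> x *\<^sub>R h x) (rep_L2 Z)"
    unfolding to_L2_def by (intro inner_abs_L2 L2_space_extend[OF meas] assms rep_L2_in)
  also have "\<dots> = L2_inner \<Omega> (rep_L2 Z) h"
    unfolding L2_inner_restrict[OF meas] by (simp add: L2_inner_def inner_commute)
  finally show ?thesis .
qed

lemma norm_to_L2: "g \<in> L2_space \<Omega> \<Longrightarrow> norm (to_L2 \<Omega> g) = L2_norm \<Omega> g"
  by (simp add: norm_eq_sqrt_inner L2_norm_def inner_to_L2)

lemma to_L2_eq_iff:
  assumes "g \<in> L2_space \<Omega>" "h \<in> L2_space \<Omega>"
  shows "to_L2 \<Omega> g = to_L2 \<Omega> h \<longleftrightarrow> (AE x in lebesgue_on \<Omega>. g x = h x)"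
  unfolding to_L2_def abs_L2_eq_iff[OF L2_space_extend[OF meas assms(1)] L2_space_extend[OF meas assms(2)]]
    AE_lebesgue_on_iff[OF meas]
  by (intro AE_cong_simp refl) (auto simp: indicator_def simp_implies_def)

lemma rep_to_L2:
  assumes "g \<in> L2_space \<Omega>" shows "AE x in lebesgue_on UNIV. rep_L2 (to_L2 \<Omega> g) x = indicator \<Omega> x *\<^sub>R g x"
  unfolding to_L2_def by (rule rep_abs_L2[OF L2_space_extend[OF meas assms]])

lemma to_L2_add: "g \<in> L2_space \<Omega> \<Longrightarrow> h \<in> L2_space \<Omega> \<Longrightarrow> to_L2 \<Omega> (\<lambda>x. g x + h x) = to_L2 \<Omega> g + to_L2 \<Omega> h"
  unfolding to_L2_def by (subst abs_L2_plus) (auto intro: L2_space_extend[OF meas] simp: scaleR_add_right)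

lemma to_L2_diff: "g \<in> L2_space \<Omega> \<Longrightarrow> h \<in> L2_space \<Omega> \<Longrightarrow> to_L2 \<Omega> (\<lambda>x. g x - h x) = to_L2 \<Omega> g - to_L2 \<Omega> h"
  unfolding to_L2_def by (subst abs_L2_minus) (auto intro: L2_space_extend[OF meas] simp: scaleR_diff_right)

lemma to_L2_scale: "g \<in> L2_space \<Omega> \<Longrightarrow> to_L2 \<Omega> (\<lambda>x. r *\<^sub>R g x) = r *\<^sub>R to_L2 \<Omega> g"
  unfolding to_L2_def by (subst abs_L2_scale) (auto intro: L2_space_extend[OF meas] simp: mult.commute)

lemma rep_L2_in_Omega: "rep_L2 Z \<in> L2_space \<Omega>"
  by (rule L2_space_subset[OF meas rep_L2_in])

text \<open>
  Testing against the restriction of \<open>Z\<close> itself to the complement of \<open>\<Omega>\<close> shows that \<open>Z\<close> vanishes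
  there. The condition is an orthogonality relation, so it survives limits in the mean.
\<close>

lemma to_L2_rep_if_supported:
  assumes "Z \<bullet> to_L2 (- \<Omega>) (rep_L2 Z) = 0"
  shows "to_L2 \<Omega> (rep_L2 Z) = Z"
proof -
  have mc: "- \<Omega> \<in> sets lebesgue" using meas by (metis Compl_in_sets_lebesgue)
  let ?r = "rep_L2 Z"
  have r: "?r \<in> L2_space (- \<Omega>)" by (rule L2_space_subset[OF mc rep_L2_in])
  have "Z \<bullet> to_L2 (- \<Omega>) ?r = L2_inner (- \<Omega>) ?r ?r"
  proof -
    have "Z \<bullet> to_L2 (- \<Omega>) ?r = to_L2 (- \<Omega>) ?r \<bullet> abs_L2 ?r" by (simp add: abs_rep_L2 inner_commute)
    also have "\<dots> = L2_inner UNIV (\<lambda>x. indicator (- \<Omega>) x *\<^sub>R ?r x) ?r"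
      unfolding to_L2_def by (intro inner_abs_L2 L2_space_extend[OF mc] r rep_L2_in)
    also have "\<dots> = L2_inner (- \<Omega>) ?r ?r" by (rule L2_inner_restrict[OF mc])
    finally show ?thesis .
  qed
  then have "(LINT x|lebesgue_on (- \<Omega>). ?r x \<bullet> ?r x) = 0" using assms by (simp add: L2_inner_def)
  then have "AE x in lebesgue_on (- \<Omega>). ?r x \<bullet> ?r x = 0"
    by (subst (asm) integral_nonneg_eq_0_iff_AE[OF L2_integrable_inner[OF r r]]) auto
  then have "AE x in lebesgue_on UNIV. indicator \<Omega> x *\<^sub>R ?r x = ?r x"
    unfolding AE_lebesgue_on_iff[OF mc] by eventually_elim (auto simp: indicator_def)
  then have "abs_L2 (\<lambda>x. indicator \<Omega> x *\<^sub>R ?r x) = abs_L2 ?r"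
    by (simp add: abs_L2_eq_iff L2_space_extend[OF meas] rep_L2_in_Omega rep_L2_in)
  then show ?thesis unfolding to_L2_def abs_rep_L2 .
qed

end

section \<open>Test functions, integration by parts and the Poincare inequality\<close>

lemma LINT_lebesgue_on_eq_lborel:
  fixes f :: "real^'n \<Rightarrow> real"
  assumes "\<Omega> \<in> sets lebesgue" "f \<in> borel_measurable borel" "\<And>x. x \<notin> \<Omega> \<Longrightarrow> f x = 0"
  shows "(LINT x|lebesgue_on \<Omega>. f x) = (LINT x|lborel. f x)"
proof -
  have \<Omega>: "\<Omega> \<inter> space lebesgue \<in> sets lebesgue" using assms by simp
  have "(LINT x|lebesgue_on \<Omega>. f x) = (LINT x|lebesgue. indicator \<Omega> x *\<^sub>R f x)"
    by (rule integral_restrict_space[OF \<Omega>])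
  also have "\<dots> = (LINT x|lebesgue. f x)"
    by (rule Bochner_Integration.integral_cong) (auto simp: indicator_def assms(3))
  also have "\<dots> = (LINT x|lborel. f x)" by (rule integral_completion) (use assms(2) in simp)
  finally show ?thesis .
qed

lemma C_k_continuous: "C_k k f \<Longrightarrow> continuous_on UNIV f"
  by (cases k) (auto intro!: continuous_at_imp_continuous_on differentiable_imp_continuous_within)

lemma C_k_add: "C_k k f \<Longrightarrow> C_k k g \<Longrightarrow> C_k k (\<lambda>x. f x + g x)"
proof (induction k arbitrary: f g)
  case (Suc k)
  then have "partial_deriv i (\<lambda>x. f x + g x) = (\<lambda>x. partial_deriv i f x + partial_deriv i g x)" for i
    by (intro ext partial_deriv_add) auto
  moreover have "C_k k (\<lambda>x. partial_deriv i f x + partial_deriv i g x)" for i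
    by (rule Suc.IH) (use Suc.prems in auto)
  ultimately show ?case using Suc.prems by (simp only: C_k.simps) (auto intro: differentiable_add)
qed (simp add: continuous_on_add)

lemma partial_deriv_scale:
  assumes "f differentiable (at x)"
  shows "partial_deriv i (\<lambda>x. r * f x) x = r * partial_deriv i f x"
  using partial_deriv_eq[OF has_derivative_mult_right[OF assms[unfolded frechet_derivative_works]]]
  unfolding partial_deriv_def by simp

lemma C_k_scale: "C_k k f \<Longrightarrow> C_k k (\<lambda>x. r * f x)"
proof (induction k arbitrary: f)
  case (Suc k)
  then have "partial_deriv i (\<lambda>x. r * f x) = (\<lambda>x. r * partial_deriv i f x)" for i
    by (intro ext partial_deriv_scale) auto
  moreover have "C_k k (\<lambda>x. r * partial_deriv i f x)" for i
    by (rule Suc.IH) (use Suc.prems in auto)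
  ultimately show ?case using Suc.prems by (simp only: C_k.simps) (auto intro: differentiable_mult)
qed (simp add: continuous_on_mult_left)

lemma test_functions_combination:
  assumes "\<phi> \<in> test_functions \<Omega>" "\<psi> \<in> test_functions \<Omega>"
  shows "(\<lambda>x. r * \<phi> x + s * \<psi> x) \<in> test_functions \<Omega>"
proof -
  have sub: "closure {x. r * \<phi> x + s * \<psi> x \<noteq> 0} \<subseteq> closure {x. \<phi> x \<noteq> 0} \<union> closure {x. \<psi> x \<noteq> 0}"
    unfolding closure_Un[symmetric] by (rule closure_mono) auto
  have "compact (closure {x. \<phi> x \<noteq> 0} \<union> closure {x. \<psi> x \<noteq> 0})"
    using assms by (auto simp: test_functions_def)
  then have "compact (closure {x. r * \<phi> x + s * \<psi> x \<noteq> 0})"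
    using bounded_subset[OF compact_imp_bounded sub] by (simp add: compact_eq_bounded_closed)
  moreover have "C_k k (\<lambda>x. r * \<phi> x + s * \<psi> x)" for k
    by (rule C_k_add[OF C_k_scale C_k_scale]) (use assms in \<open>simp_all add: test_functions_def\<close>)
  ultimately show ?thesis using assms sub unfolding test_functions_def by blast
qed

lemma test_functions_zero: "(\<lambda>x::real^'n. 0) \<in> test_functions \<Omega>"
proof -
  have "C_k k (\<lambda>x::real^'n. 0)" for k
    by (rule smooth_algebra_C_k[OF smooth_algebra.const])
  then show ?thesis by (simp add: test_functions_def)
qed

context
  fixes \<Omega> :: "(real^'n) set" and \<phi> :: "real^'n \<Rightarrow> real"
  assumes test: "\<phi> \<in> test_functions \<Omega>"
begin

lemma test_function_differentiable: "\<phi> differentiable (at x)"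
proof -
  have "C_k (Suc 0) \<phi>" using test unfolding test_functions_def by blast
  then show ?thesis by simp
qed

lemma test_function_continuous: "continuous_on UNIV \<phi>"
  and test_function_continuous_partial: "continuous_on UNIV (partial_deriv i \<phi>)"
proof -
  have "C_k (Suc 0) \<phi>" using test unfolding test_functions_def by blast
  then show "continuous_on UNIV \<phi>" "continuous_on UNIV (partial_deriv i \<phi>)"
    using C_k_continuous by (blast, simp)
qed

lemma test_function_continuous_grad: "continuous_on UNIV (grad \<phi>)"
  unfolding grad_def by (intro continuous_on_vec_lambda test_function_continuous_partial)

lemma test_function_outside: "x \<notin> \<Omega> \<Longrightarrow> \<phi> x = 0"
  using test closure_subset[of "{x. \<phi> x \<noteq> 0}"] unfolding test_functions_def by blast

lemma partial_deriv_test_function_outside: 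
  assumes "x \<notin> closure {x. \<phi> x \<noteq> 0}" shows "partial_deriv i \<phi> x = 0"
proof -
  have "((\<lambda>x. 0) has_derivative (\<lambda>h. 0)) (at x)" by (rule has_derivative_const)
  then have "(\<phi> has_derivative (\<lambda>h. 0)) (at x)"
  proof (rule has_derivative_transform_within_open)
    show "open (- closure {x. \<phi> x \<noteq> 0})" by auto
    show "x \<in> - closure {x. \<phi> x \<noteq> 0}" using assms by simp
    show "0 = \<phi> y" if "y \<in> - closure {x. \<phi> x \<noteq> 0}" for y
      using that closure_subset[of "{x. \<phi> x \<noteq> 0}"] by auto
  qed
  then show ?thesis using partial_deriv_eq by metis
qed

lemma test_function_support_radius:
  obtains R where "\<And>x. norm x > R \<Longrightarrow> \<phi> x = 0" "\<And>x i. norm x > R \<Longrightarrow> partial_deriv i \<phi> x = 0"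
proof -
  have "bounded (closure {x. \<phi> x \<noteq> 0})"
    using test compact_imp_bounded unfolding test_functions_def by blast
  then obtain R where R: "\<And>x. x \<in> closure {x. \<phi> x \<noteq> 0} \<Longrightarrow> norm x \<le> R" unfolding bounded_iff by blast
  show thesis
  proof (rule that[of R])
    fix x :: "real^'n" assume x: "norm x > R"
    then have "x \<notin> closure {x. \<phi> x \<noteq> 0}" using R by force
    then show "\<phi> x = 0" "partial_deriv i \<phi> x = 0" for i
      using partial_deriv_test_function_outside closure_subset[of "{x. \<phi> x \<noteq> 0}"] by auto
  qed
qed

end

lemma L2_space_continuous_bounded_support:
  fixes f :: "real^'n \<Rightarrow> 'b::euclidean_space"
  assumes "\<Omega> \<in> sets lebesgue" "continuous_on UNIV f" "\<And>x. norm x > R \<Longrightarrow> f x = 0"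
  shows "f \<in> L2_space \<Omega>"
proof (rule L2_space_subset[OF assms(1)], rule L2_spaceI)
  have b: "f \<in> borel_measurable borel" using assms(2) by (rule borel_measurable_continuous_onI)
  then show "f \<in> borel_measurable (lebesgue_on UNIV)"
    unfolding lebesgue_on_UNIV_eq by (intro measurable_completion) simp
  have c: "continuous_on UNIV (\<lambda>x. (norm (f x))\<^sup>2)" using assms(2) by (intro continuous_intros)
  have s: "(norm (f x))\<^sup>2 = 0" if "norm x > R" for x using assms(3)[OF that] by simp
  obtain M where "\<And>x. norm ((norm (f x))\<^sup>2) \<le> M * indicator (cball 0 R) x"
    using continuous_bounded_support_bound[OF c s] by metis
  then have "integrable lborel (\<lambda>x. (norm (f x))\<^sup>2)"
    by (intro integrable_lborel_bounded_support[OF borel_measurable_continuous_onI[OF c]]) simp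
  then show "integrable (lebesgue_on UNIV) (\<lambda>x. (norm (f x))\<^sup>2)"
    unfolding lebesgue_on_UNIV_eq using borel_measurable_continuous_onI[OF c] by (subst integrable_completion) simp_all
qed

lemma test_function_L2:
  assumes "\<Omega> \<in> sets lebesgue" "\<phi> \<in> test_functions \<Omega>'"
  shows "\<phi> \<in> L2_space \<Omega>" "partial_deriv i \<phi> \<in> L2_space \<Omega>" "grad \<phi> \<in> L2_space \<Omega>"
proof -
  obtain R where R: "\<And>x. norm x > R \<Longrightarrow> \<phi> x = 0" "\<And>x i. norm x > R \<Longrightarrow> partial_deriv i \<phi> x = 0"
    using test_function_support_radius[OF assms(2)] by metis
  show "\<phi> \<in> L2_space \<Omega>"
    by (rule L2_space_continuous_bounded_support[OF assms(1) test_function_continuous[OF assms(2)] R(1)])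
  show "partial_deriv i \<phi> \<in> L2_space \<Omega>"
    by (rule L2_space_continuous_bounded_support[OF assms(1) test_function_continuous_partial[OF assms(2)] R(2)])
  show "grad \<phi> \<in> L2_space \<Omega>"
    by (rule L2_space_continuous_bounded_support[OF assms(1) test_function_continuous_grad[OF assms(2)], of R])
       (simp add: grad_def R(2) vec_eq_iff)
qed

lemma integration_by_parts_test_function:
  fixes \<psi> :: "real^'n \<Rightarrow> real"
  assumes \<Omega>: "\<Omega> \<in> sets lebesgue" and \<phi>: "\<phi> \<in> test_functions \<Omega>"
    and diff: "\<And>x. \<psi> differentiable (at x)" and cont: "continuous_on UNIV (partial_deriv i \<psi>)"
  shows "(LINT x|lebesgue_on \<Omega>. \<psi> x * partial_deriv i \<phi> x) = - (LINT x|lebesgue_on \<Omega>. partial_deriv i \<psi> x * \<phi> x)"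
proof -
  obtain R where R: "\<And>x. norm x > R \<Longrightarrow> \<phi> x = 0" "\<And>x. norm x > R \<Longrightarrow> partial_deriv i \<phi> x = 0"
    using test_function_support_radius[OF \<phi>] by metis
  have c\<psi>: "continuous_on UNIV \<psi>"
    using diff by (auto intro!: continuous_at_imp_continuous_on differentiable_imp_continuous_within)
  note c\<phi> = test_function_continuous[OF \<phi>] test_function_continuous_partial[OF \<phi>]
  have c1: "continuous_on UNIV (\<lambda>x. \<psi> x * partial_deriv i \<phi> x)" by (intro continuous_on_mult c\<psi> c\<phi>)
  have c2: "continuous_on UNIV (\<lambda>x. partial_deriv i \<psi> x * \<phi> x)" by (intro continuous_on_mult cont c\<phi>)
  have int: "integrable lborel f" if c: "continuous_on UNIV f" and s: "\<And>x. norm x > R \<Longrightarrow> f x = 0" for f :: "real^'n \<Rightarrow> real"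
  proof -
    obtain M where "\<And>x. norm (f x) \<le> M * indicator (cball 0 R) x"
      using continuous_bounded_support_bound[OF c s] by metis
    then show ?thesis
      by (intro integrable_lborel_bounded_support[OF borel_measurable_continuous_onI[OF c]]) simp
  qed
  have pd: "partial_deriv i (\<lambda>x. \<psi> x * \<phi> x) = (\<lambda>x. \<psi> x * partial_deriv i \<phi> x + partial_deriv i \<psi> x * \<phi> x)"
    by (intro ext partial_deriv_mult diff test_function_differentiable[OF \<phi>])
  have "(LINT x|lborel. partial_deriv i (\<lambda>x. \<psi> x * \<phi> x) x) = 0"
  proof (rule integral_partial_deriv_eq_0)
    show "(\<lambda>x. \<psi> x * \<phi> x) differentiable (at x)" for x
      using diff test_function_differentiable[OF \<phi>] by simp
    show "continuous_on UNIV (partial_deriv i (\<lambda>x. \<psi> x * \<phi> x))"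
      unfolding pd by (intro continuous_on_add c1 c2)
    show "\<psi> x * \<phi> x = 0" if "norm x > R" for x using R that by simp
  qed
  then have "(LINT x|lborel. \<psi> x * partial_deriv i \<phi> x) + (LINT x|lborel. partial_deriv i \<psi> x * \<phi> x) = 0"
    unfolding pd by (subst (asm) Bochner_Integration.integral_add) (auto intro!: int c1 c2 simp: R)
  moreover have "(LINT x|lebesgue_on \<Omega>. \<psi> x * partial_deriv i \<phi> x) = (LINT x|lborel. \<psi> x * partial_deriv i \<phi> x)"
  proof (rule LINT_lebesgue_on_eq_lborel[OF \<Omega> borel_measurable_continuous_onI[OF c1]])
    fix x assume "x \<notin> \<Omega>"
    then have "x \<notin> closure {x. \<phi> x \<noteq> 0}" using \<phi> unfolding test_functions_def by blast
    then show "\<psi> x * partial_deriv i \<phi> x = 0" using partial_deriv_test_function_outside[OF \<phi>] by simp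
  qed
  moreover have "(LINT x|lebesgue_on \<Omega>. partial_deriv i \<psi> x * \<phi> x) = (LINT x|lborel. partial_deriv i \<psi> x * \<phi> x)"
    by (rule LINT_lebesgue_on_eq_lborel[OF \<Omega> borel_measurable_continuous_onI[OF c2]])
       (simp add: test_function_outside[OF \<phi>])
  ultimately show ?thesis by simp
qed

lemma has_weak_grad_test_function:
  assumes "\<Omega> \<in> sets lebesgue" "\<phi> \<in> test_functions \<Omega>'"
  shows "has_weak_grad \<Omega> \<phi> (grad \<phi>)"
  unfolding has_weak_grad_def grad_def
  using integration_by_parts_test_function[OF assms(1) _ test_function_differentiable[OF assms(2)]
      test_function_continuous_partial[OF assms(2)]] by simp

text \<open>
  Integration by parts against the coordinate \<open>x $ i\<close> gives
  \<open>\<integral> \<phi> ^ 2 = - 2 \<integral> x_i \<phi> \<partial>_i \<phi>\<close>, and Young's inequality absorbs half of \<open>\<integral> \<phi> ^ 2\<close> on the left.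
\<close>

lemma Poincare_test_function:
  fixes \<phi> :: "real^'n \<Rightarrow> real"
  assumes \<Omega>: "\<Omega> \<in> sets lebesgue" and \<phi>: "\<phi> \<in> test_functions \<Omega>" and R: "\<And>x. x \<in> \<Omega> \<Longrightarrow> norm x \<le> R"
  shows "L2_inner \<Omega> \<phi> \<phi> \<le> 4 * R\<^sup>2 * L2_inner \<Omega> (grad \<phi>) (grad \<phi>)"
proof -
  obtain i :: 'n where True by blast
  let ?p = "partial_deriv i \<phi>"
  define \<psi> where "\<psi> x = x $ i * \<phi> x" for x
  have dcoord: "((\<lambda>x::real^'n. x $ i) has_derivative (\<lambda>h. h $ i)) (at x)" for x
    by (rule bounded_linear.has_derivative[OF bounded_linear_vec_nth has_derivative_ident])
  have diffc: "(\<lambda>x::real^'n. x $ i) differentiable (at x)" for x using dcoord unfolding differentiable_def by blast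
  have pd: "partial_deriv i \<psi> = (\<lambda>x. x $ i * ?p x + \<phi> x)"
  proof
    fix x
    have "partial_deriv i (\<lambda>x. x $ i) x = axis i 1 $ i" by (rule partial_deriv_eq[OF dcoord])
    then show "partial_deriv i \<psi> x = x $ i * ?p x + \<phi> x"
      using partial_deriv_mult[OF diffc test_function_differentiable[OF \<phi>], of i x] unfolding \<psi>_def by simp
  qed
  have d\<psi>: "\<psi> differentiable (at x)" for x
    unfolding \<psi>_def using diffc test_function_differentiable[OF \<phi>] by simp
  have ccoord: "continuous_on UNIV (\<lambda>x::real^'n. x $ i)" by (intro continuous_intros)
  have c\<psi>: "continuous_on UNIV (partial_deriv i \<psi>)"
    unfolding pd by (intro continuous_on_add continuous_on_mult ccoord test_function_continuous[OF \<phi>] test_function_continuous_partial[OF \<phi>])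
  have ibp: "(LINT x|lebesgue_on \<Omega>. \<psi> x * ?p x) = - (LINT x|lebesgue_on \<Omega>. partial_deriv i \<psi> x * \<phi> x)"
    by (rule integration_by_parts_test_function[OF \<Omega> \<phi> d\<psi> c\<psi>])
  obtain S where S: "\<And>x. norm x > S \<Longrightarrow> \<phi> x = 0" using test_function_support_radius[OF \<phi>] by metis
  have \<psi>L: "\<psi> \<in> L2_space \<Omega>"
    by (rule L2_space_continuous_bounded_support[OF \<Omega>, of _ S])
       (auto simp: \<psi>_def S intro!: continuous_on_mult ccoord test_function_continuous[OF \<phi>])
  note L = test_function_L2[OF \<Omega> \<phi>]
  have i1: "integrable (lebesgue_on \<Omega>) (\<lambda>x. \<psi> x * ?p x)" using L2_integrable_inner[OF \<psi>L L(2)] by simp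
  have i2: "integrable (lebesgue_on \<Omega>) (\<lambda>x. \<phi> x * \<phi> x)" using L2_integrable_inner[OF L(1) L(1)] by simp
  have i3: "integrable (lebesgue_on \<Omega>) (\<lambda>x. grad \<phi> x \<bullet> grad \<phi> x)" using L2_integrable_inner[OF L(3) L(3)] by simp
  have "(LINT x|lebesgue_on \<Omega>. partial_deriv i \<psi> x * \<phi> x) = (LINT x|lebesgue_on \<Omega>. \<psi> x * ?p x + \<phi> x * \<phi> x)"
    unfolding pd \<psi>_def by (rule Bochner_Integration.integral_cong) (auto simp: algebra_simps)
  also have "\<dots> = (LINT x|lebesgue_on \<Omega>. \<psi> x * ?p x) + (LINT x|lebesgue_on \<Omega>. \<phi> x * \<phi> x)"
    by (rule Bochner_Integration.integral_add[OF i1 i2])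
  finally have "(LINT x|lebesgue_on \<Omega>. \<phi> x * \<phi> x) = (LINT x|lebesgue_on \<Omega>. (-2) * (\<psi> x * ?p x))"
    using ibp by simp
  also have "\<dots> \<le> (LINT x|lebesgue_on \<Omega>. (1/2) * (\<phi> x * \<phi> x) + 2 * R\<^sup>2 * (grad \<phi> x \<bullet> grad \<phi> x))"
  proof (rule integral_mono)
    fix x assume "x \<in> space (lebesgue_on \<Omega>)"
    then have "x \<in> \<Omega>" by (simp add: space_restrict_space)
    then have xR: "\<bar>x $ i\<bar> \<le> R" using R component_le_norm_cart[of x i] order_trans by blast
    have "?p x = grad \<phi> x $ i" by (simp add: grad_def)
    then have "(?p x)\<^sup>2 \<le> (norm (grad \<phi> x))\<^sup>2"
      using component_le_norm_cart[of "grad \<phi> x" i] by (metis abs_le_square_iff abs_norm_cancel)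
    moreover have "(x $ i)\<^sup>2 \<le> R\<^sup>2" using xR by (simp add: abs_le_square_iff[symmetric])
    ultimately have "(x $ i)\<^sup>2 * (?p x)\<^sup>2 \<le> R\<^sup>2 * (norm (grad \<phi> x))\<^sup>2" by (intro mult_mono) auto
    moreover have "(-2) * (\<psi> x * ?p x) \<le> (1/2) * (\<phi> x * \<phi> x) + 2 * ((x $ i)\<^sup>2 * (?p x)\<^sup>2)"
      using zero_le_power2[of "\<phi> x + 2 * (x $ i * ?p x)"] unfolding \<psi>_def
      by (simp add: power2_eq_square algebra_simps)
    ultimately show "(-2) * (\<psi> x * ?p x) \<le> (1/2) * (\<phi> x * \<phi> x) + 2 * R\<^sup>2 * (grad \<phi> x \<bullet> grad \<phi> x)"
      by (simp add: power2_norm_eq_inner)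
  qed (intro Bochner_Integration.integrable_add integrable_mult_right i1 i2 i3)+
  also have "\<dots> = (1/2) * (LINT x|lebesgue_on \<Omega>. \<phi> x * \<phi> x) + 2 * R\<^sup>2 * (LINT x|lebesgue_on \<Omega>. grad \<phi> x \<bullet> grad \<phi> x)"
    using i2 i3 by (subst Bochner_Integration.integral_add) auto
  finally show ?thesis unfolding L2_inner_def by simp
qed

section \<open>The space $H^1_0$ and its gradients\<close>

text \<open>
  The defining identity of weak gradients, written with inner products. In this form it is visibly
  linear and closed in the pair \<open>(U, G)\<close>.
\<close>

definition weak_grad_relation ::
  "(real^'n) set \<Rightarrow> ('n, real) L2 \<Rightarrow> ('n, real^'n) L2 \<Rightarrow> bool" where
  "weak_grad_relation \<Omega> U G \<longleftrightarrow> (\<forall>\<phi>\<in>test_functions \<Omega>. \<forall>i.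
     U \<bullet> to_L2 \<Omega> (partial_deriv i \<phi>) + G \<bullet> to_L2 \<Omega> (\<lambda>x. \<phi> x *\<^sub>R axis i 1) = 0)"

text \<open>
  The isometric embedding \<open>u \<mapsto> (u, \<nabla>u)\<close> of $H^1(\Omega)$ into \<open>L^2 \<times> L^2\<close>. Under it $H^1_0(\Omega)$ becomes a closed
  subspace, the closure of the image of the test functions.
\<close>

definition sobolev_pair ::
  "(real^'n) set \<Rightarrow> (real^'n \<Rightarrow> real) \<Rightarrow> ('n, real) L2 \<times> ('n, real^'n) L2" where
  "sobolev_pair \<Omega> u = (to_L2 \<Omega> u, to_L2 \<Omega> (weak_grad \<Omega> u))"

definition H10_pairs :: "(real^'n) set \<Rightarrow> (('n, real) L2 \<times> ('n, real^'n) L2) set" where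
  "H10_pairs \<Omega> = closure (sobolev_pair \<Omega> ` test_functions \<Omega>)"

definition H10_grads :: "(real^'n) set \<Rightarrow> ('n, real^'n) L2 set" where
  "H10_grads \<Omega> = snd ` H10_pairs \<Omega>"

context
  fixes \<Omega> :: "(real^'n) set"
  assumes op: "open \<Omega>"
begin

private lemma meas: "\<Omega> \<in> sets lebesgue"
  using op by simp

lemma axis_test_function_L2:
  assumes "\<phi> \<in> test_functions \<Omega>" shows "(\<lambda>x. \<phi> x *\<^sub>R (axis i 1 :: real^'n)) \<in> L2_space \<Omega>"
proof -
  note L = test_function_L2(1)[OF meas assms]
  show ?thesis
  proof (rule L2_spaceI)
    show "(\<lambda>x. \<phi> x *\<^sub>R (axis i 1 :: real^'n)) \<in> borel_measurable (lebesgue_on \<Omega>)"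
      using L2_space_measurable[OF L] by simp
    show "integrable (lebesgue_on \<Omega>) (\<lambda>x. (norm (\<phi> x *\<^sub>R (axis i 1 :: real^'n)))\<^sup>2)"
      using L2_space_integrable[OF L] by (simp add: norm_axis_1)
  qed
qed

lemma has_weak_grad_iff:
  assumes "u \<in> L2_space \<Omega>" "G \<in> L2_space \<Omega>"
  shows "has_weak_grad \<Omega> u G \<longleftrightarrow> weak_grad_relation \<Omega> (to_L2 \<Omega> u) (to_L2 \<Omega> G)"
  unfolding has_weak_grad_def weak_grad_relation_def
proof (intro ball_cong refl all_cong1)
  fix \<phi> i assume \<phi>: "\<phi> \<in> test_functions \<Omega>"
  have "to_L2 \<Omega> u \<bullet> to_L2 \<Omega> (partial_deriv i \<phi>) = (LINT x|lebesgue_on \<Omega>. u x * partial_deriv i \<phi> x)"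
    by (simp add: inner_to_L2[OF meas assms(1) test_function_L2(2)[OF meas \<phi>]] L2_inner_def)
  moreover have "to_L2 \<Omega> G \<bullet> to_L2 \<Omega> (\<lambda>x. \<phi> x *\<^sub>R axis i 1) = (LINT x|lebesgue_on \<Omega>. G x $ i * \<phi> x)"
    by (simp add: inner_to_L2[OF meas assms(2) axis_test_function_L2[OF \<phi>]] L2_inner_def inner_axis mult.commute)
  ultimately show "((LINT x|lebesgue_on \<Omega>. u x * partial_deriv i \<phi> x) = - (LINT x|lebesgue_on \<Omega>. G x $ i * \<phi> x)) =
      (to_L2 \<Omega> u \<bullet> to_L2 \<Omega> (partial_deriv i \<phi>) + to_L2 \<Omega> G \<bullet> to_L2 \<Omega> (\<lambda>x. \<phi> x *\<^sub>R axis i 1) = 0)"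
    by (simp add: eq_neg_iff_add_eq_0)
qed

text \<open>
  Two weak gradients of one function differ by a field whose components are orthogonal to all test
  functions. This frees all later statements from the choice made in \<^const>\<open>weak_grad\<close>.
\<close>

lemma weak_grad_relation_unique:
  assumes g: "g \<in> L2_space \<Omega>" and h: "h \<in> L2_space \<Omega>"
    and "weak_grad_relation \<Omega> U (to_L2 \<Omega> g)" "weak_grad_relation \<Omega> U (to_L2 \<Omega> h)"
  shows "to_L2 \<Omega> g = to_L2 \<Omega> h"
proof -
  have d: "(\<lambda>x. g x - h x) \<in> L2_space \<Omega>" by (rule L2_space_diff[OF g h])
  have "AE x in lebesgue_on \<Omega>. (g x - h x) $ i = 0" for i
  proof (rule AE_zero_if_orthogonal_to_test_functions[OF op])
    show "(\<lambda>x. (g x - h x) $ i) \<in> L2_space \<Omega>"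
    proof (rule L2_space_bound[OF d])
      show "(\<lambda>x. (g x - h x) $ i) \<in> borel_measurable (lebesgue_on \<Omega>)"
        by (rule measurable_compose[OF L2_space_measurable[OF d], of "\<lambda>x. x $ i" borel])
          (intro borel_measurable_continuous_onI continuous_intros)
      show "AE x in lebesgue_on \<Omega>. norm ((g x - h x) $ i) \<le> norm (g x - h x)"
        by (intro AE_I2, unfold real_norm_def) (rule component_le_norm_cart)
    qed
    fix \<phi> assume \<phi>: "\<phi> \<in> test_functions \<Omega>"
    let ?a = "\<lambda>x. \<phi> x *\<^sub>R (axis i 1 :: real^'n)"
    have "(LINT x|lebesgue_on \<Omega>. (g x - h x) $ i * \<phi> x) = to_L2 \<Omega> (\<lambda>x. g x - h x) \<bullet> to_L2 \<Omega> ?a"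
      by (simp add: inner_to_L2[OF meas d axis_test_function_L2[OF \<phi>]] L2_inner_def inner_axis mult.commute)
    also have "\<dots> = to_L2 \<Omega> g \<bullet> to_L2 \<Omega> ?a - to_L2 \<Omega> h \<bullet> to_L2 \<Omega> ?a"
      by (simp only: to_L2_diff[OF meas g h] inner_diff_left)
    also have "\<dots> = 0"
      using assms(3,4)[unfolded weak_grad_relation_def, rule_format, OF \<phi>, of i] by linarith
    finally show "(LINT x|lebesgue_on \<Omega>. (g x - h x) $ i * \<phi> x) = 0" .
  qed
  then have "AE x in lebesgue_on \<Omega>. \<forall>i. (g x - h x) $ i = 0"
    by (intro AE_all_countable[THEN iffD2] allI)
  then have "AE x in lebesgue_on \<Omega>. g x = h x"
    by eventually_elim (simp add: vec_eq_iff)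
  then show ?thesis using to_L2_eq_iff[OF meas g h] by simp
qed

lemma H1_L2: "u \<in> H1 \<Omega> \<Longrightarrow> u \<in> L2_space \<Omega>"
  by (simp add: H1_def)

lemma weak_grad_L2: "u \<in> H1 \<Omega> \<Longrightarrow> weak_grad \<Omega> u \<in> L2_space \<Omega>"
  and weak_grad_weak_grad: "u \<in> H1 \<Omega> \<Longrightarrow> has_weak_grad \<Omega> u (weak_grad \<Omega> u)"
  using someI_ex[of "\<lambda>G. G \<in> L2_space \<Omega> \<and> has_weak_grad \<Omega> u G"]
  unfolding weak_grad_def H1_def by blast+

lemma H1_if_relation:
  assumes u: "u \<in> L2_space \<Omega>" and G: "G \<in> L2_space \<Omega>"
    and rel: "weak_grad_relation \<Omega> (to_L2 \<Omega> u) (to_L2 \<Omega> G)"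
  shows "u \<in> H1 \<Omega>" "to_L2 \<Omega> (weak_grad \<Omega> u) = to_L2 \<Omega> G"
proof -
  show *: "u \<in> H1 \<Omega>" using has_weak_grad_iff[OF u G] u G rel unfolding H1_def by blast
  have "weak_grad_relation \<Omega> (to_L2 \<Omega> u) (to_L2 \<Omega> (weak_grad \<Omega> u))"
    using has_weak_grad_iff[OF u weak_grad_L2[OF *]] weak_grad_weak_grad[OF *] by blast
  then show "to_L2 \<Omega> (weak_grad \<Omega> u) = to_L2 \<Omega> G"
    by (rule weak_grad_relation_unique[OF weak_grad_L2[OF *] G _ rel])
qed

lemma H1_relation:
  "u \<in> H1 \<Omega> \<Longrightarrow> weak_grad_relation \<Omega> (to_L2 \<Omega> u) (to_L2 \<Omega> (weak_grad \<Omega> u))"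
  using has_weak_grad_iff[OF H1_L2 weak_grad_L2] weak_grad_weak_grad by blast

lemma H1_combination:
  assumes u: "u \<in> H1 \<Omega>" and v: "v \<in> H1 \<Omega>"
  shows "(\<lambda>x. r * u x + s * v x) \<in> H1 \<Omega>"
    and "sobolev_pair \<Omega> (\<lambda>x. r * u x + s * v x) = r *\<^sub>R sobolev_pair \<Omega> u + s *\<^sub>R sobolev_pair \<Omega> v"
proof -
  let ?w = "\<lambda>x. r * u x + s * v x" and ?G = "\<lambda>x. r *\<^sub>R weak_grad \<Omega> u x + s *\<^sub>R weak_grad \<Omega> v x"
  have ru: "(\<lambda>x. r * u x) \<in> L2_space \<Omega>" and sv: "(\<lambda>x. s * v x) \<in> L2_space \<Omega>"
    using L2_space_scale[OF H1_L2[OF u], of r] L2_space_scale[OF H1_L2[OF v], of s] by simp_all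
  note rG = L2_space_scale[OF weak_grad_L2[OF u], of r] and sG = L2_space_scale[OF weak_grad_L2[OF v], of s]
  have w: "?w \<in> L2_space \<Omega>" by (rule L2_space_add[OF ru sv])
  have G: "?G \<in> L2_space \<Omega>" by (rule L2_space_add[OF rG sG])
  have tw: "to_L2 \<Omega> ?w = r *\<^sub>R to_L2 \<Omega> u + s *\<^sub>R to_L2 \<Omega> v"
    using to_L2_add[OF meas ru sv] to_L2_scale[OF meas H1_L2[OF u], of r] to_L2_scale[OF meas H1_L2[OF v], of s]
    by simp
  have tG: "to_L2 \<Omega> ?G = r *\<^sub>R to_L2 \<Omega> (weak_grad \<Omega> u) + s *\<^sub>R to_L2 \<Omega> (weak_grad \<Omega> v)"
    using to_L2_add[OF meas rG sG] to_L2_scale[OF meas weak_grad_L2[OF u], of r]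
      to_L2_scale[OF meas weak_grad_L2[OF v], of s] by simp
  have rel: "weak_grad_relation \<Omega> (to_L2 \<Omega> ?w) (to_L2 \<Omega> ?G)"
    unfolding weak_grad_relation_def
  proof (intro ballI allI)
    fix \<phi> i assume \<phi>: "\<phi> \<in> test_functions \<Omega>"
    let ?p = "to_L2 \<Omega> (partial_deriv i \<phi>)" and ?a = "to_L2 \<Omega> (\<lambda>x. \<phi> x *\<^sub>R axis i 1) :: ('n, real^'n) L2"
    have "to_L2 \<Omega> ?w \<bullet> ?p + to_L2 \<Omega> ?G \<bullet> ?a =
        r * (to_L2 \<Omega> u \<bullet> ?p + to_L2 \<Omega> (weak_grad \<Omega> u) \<bullet> ?a) + s * (to_L2 \<Omega> v \<bullet> ?p + to_L2 \<Omega> (weak_grad \<Omega> v) \<bullet> ?a)"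
      unfolding tw tG by (simp only: inner_add_left inner_scaleR_left) (simp add: algebra_simps)
    also have "\<dots> = 0" using H1_relation[OF u] H1_relation[OF v] \<phi> unfolding weak_grad_relation_def by simp
    finally show "to_L2 \<Omega> ?w \<bullet> ?p + to_L2 \<Omega> ?G \<bullet> ?a = 0" .
  qed
  show "?w \<in> H1 \<Omega>" by (rule H1_if_relation(1)[OF w G rel])
  show "sobolev_pair \<Omega> ?w = r *\<^sub>R sobolev_pair \<Omega> u + s *\<^sub>R sobolev_pair \<Omega> v"
    unfolding sobolev_pair_def H1_if_relation(2)[OF w G rel] tG tw by simp
qed

lemma H1_diff:
  assumes "u \<in> H1 \<Omega>" "v \<in> H1 \<Omega>"
  shows "(\<lambda>x. u x - v x) \<in> H1 \<Omega>" "sobolev_pair \<Omega> (\<lambda>x. u x - v x) = sobolev_pair \<Omega> u - sobolev_pair \<Omega> v"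
  using H1_combination[OF assms, of 1 "-1"] by simp_all

lemma H1_add:
  assumes "u \<in> H1 \<Omega>" "v \<in> H1 \<Omega>"
  shows "(\<lambda>x. u x + v x) \<in> H1 \<Omega>" "sobolev_pair \<Omega> (\<lambda>x. u x + v x) = sobolev_pair \<Omega> u + sobolev_pair \<Omega> v"
  using H1_combination[OF assms, of 1 1] by simp_all

lemma test_function_H1:
  assumes \<phi>: "\<phi> \<in> test_functions \<Omega>"
  shows "\<phi> \<in> H1 \<Omega>" "sobolev_pair \<Omega> \<phi> = (to_L2 \<Omega> \<phi>, to_L2 \<Omega> (grad \<phi>))"
proof -
  note L = test_function_L2[OF meas \<phi>]
  have rel: "weak_grad_relation \<Omega> (to_L2 \<Omega> \<phi>) (to_L2 \<Omega> (grad \<phi>))"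
    using has_weak_grad_iff[OF L(1,3)] has_weak_grad_test_function[OF meas \<phi>] by blast
  show "\<phi> \<in> H1 \<Omega>" by (rule H1_if_relation(1)[OF L(1,3) rel])
  show "sobolev_pair \<Omega> \<phi> = (to_L2 \<Omega> \<phi>, to_L2 \<Omega> (grad \<phi>))"
    unfolding sobolev_pair_def H1_if_relation(2)[OF L(1,3) rel] ..
qed

lemma H1_inner_eq: "u \<in> H1 \<Omega> \<Longrightarrow> v \<in> H1 \<Omega> \<Longrightarrow> H1_inner \<Omega> u v = sobolev_pair \<Omega> u \<bullet> sobolev_pair \<Omega> v"
  by (simp add: H1_inner_def sobolev_pair_def inner_to_L2[OF meas] H1_L2 weak_grad_L2)

lemma H1_norm_eq: "u \<in> H1 \<Omega> \<Longrightarrow> H1_norm \<Omega> u = norm (sobolev_pair \<Omega> u)"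
  by (simp add: H1_norm_def H1_inner_eq norm_eq_sqrt_inner)

lemma H10_iff: "u \<in> H10 \<Omega> \<longleftrightarrow> u \<in> H1 \<Omega> \<and> sobolev_pair \<Omega> u \<in> H10_pairs \<Omega>"
proof (cases "u \<in> H1 \<Omega>")
  case True
  have *: "H1_norm \<Omega> (\<lambda>x. \<phi> x - u x) = dist (sobolev_pair \<Omega> \<phi>) (sobolev_pair \<Omega> u)"
    if "\<phi> \<in> test_functions \<Omega>" for \<phi>
    using H1_diff[OF test_function_H1(1)[OF that] True] by (simp add: H1_norm_eq dist_norm)
  have "(\<exists>\<phi>. (\<forall>j. \<phi> j \<in> test_functions \<Omega>) \<and> (\<lambda>j. H1_norm \<Omega> (\<lambda>x. \<phi> j x - u x)) \<longlonglongrightarrow> 0) \<longleftrightarrow>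
      (\<exists>\<phi>. (\<forall>j. \<phi> j \<in> test_functions \<Omega>) \<and> (\<lambda>j. sobolev_pair \<Omega> (\<phi> j)) \<longlonglongrightarrow> sobolev_pair \<Omega> u)"
    unfolding tendsto_dist_iff[of "\<lambda>j. sobolev_pair \<Omega> (_ j)"] by (intro ex_cong1 conj_cong refl) (simp add: *)
  also have "\<dots> \<longleftrightarrow> sobolev_pair \<Omega> u \<in> H10_pairs \<Omega>"
  proof
    assume "\<exists>\<phi>. (\<forall>j. \<phi> j \<in> test_functions \<Omega>) \<and> (\<lambda>j. sobolev_pair \<Omega> (\<phi> j)) \<longlonglongrightarrow> sobolev_pair \<Omega> u"
    then obtain \<phi> where "\<And>j. \<phi> j \<in> test_functions \<Omega>" "(\<lambda>j. sobolev_pair \<Omega> (\<phi> j)) \<longlonglongrightarrow> sobolev_pair \<Omega> u"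
      by blast
    then show "sobolev_pair \<Omega> u \<in> H10_pairs \<Omega>"
      unfolding H10_pairs_def closure_sequential by (intro exI[of _ "\<lambda>j. sobolev_pair \<Omega> (\<phi> j)"]) simp
  next
    assume "sobolev_pair \<Omega> u \<in> H10_pairs \<Omega>"
    then obtain s where s: "\<And>j. s j \<in> sobolev_pair \<Omega> ` test_functions \<Omega>" "s \<longlonglongrightarrow> sobolev_pair \<Omega> u"
      unfolding H10_pairs_def closure_sequential by blast
    have "\<forall>j. \<exists>\<phi>. \<phi> \<in> test_functions \<Omega> \<and> s j = sobolev_pair \<Omega> \<phi>" using s(1) by blast
    from choice[OF this] obtain \<phi> where \<phi>: "\<And>j. \<phi> j \<in> test_functions \<Omega>" "\<And>j. s j = sobolev_pair \<Omega> (\<phi> j)" by blast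
    have "s = (\<lambda>j. sobolev_pair \<Omega> (\<phi> j))" using \<phi>(2) by blast
    with s(2) \<phi>(1) show "\<exists>\<phi>. (\<forall>j. \<phi> j \<in> test_functions \<Omega>) \<and> (\<lambda>j. sobolev_pair \<Omega> (\<phi> j)) \<longlonglongrightarrow> sobolev_pair \<Omega> u"
      by blast
  qed
  finally show ?thesis using True unfolding H10_def by blast
next
  case False
  then show ?thesis unfolding H10_def by simp
qed

lemma H10_H1: "u \<in> H10 \<Omega> \<Longrightarrow> u \<in> H1 \<Omega>"
  by (simp add: H10_def)

lemma H10_pair: "u \<in> H10 \<Omega> \<Longrightarrow> sobolev_pair \<Omega> u \<in> H10_pairs \<Omega>"
  using H10_iff by blast

lemma closed_H10_pairs: "closed (H10_pairs \<Omega>)"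
  by (simp add: H10_pairs_def)

lemma subspace_H10_pairs: "subspace (H10_pairs \<Omega>)"
proof -
  let ?T = "sobolev_pair \<Omega> ` test_functions \<Omega>"
  have comb: "r *\<^sub>R w + s *\<^sub>R w' \<in> ?T" if w: "w \<in> ?T" "w' \<in> ?T" for r s w w'
  proof -
    obtain \<phi> \<psi> where 1: "\<phi> \<in> test_functions \<Omega>" "\<psi> \<in> test_functions \<Omega>" "w = sobolev_pair \<Omega> \<phi>" "w' = sobolev_pair \<Omega> \<psi>"
      using w by blast
    have "r *\<^sub>R w + s *\<^sub>R w' = sobolev_pair \<Omega> (\<lambda>x. r * \<phi> x + s * \<psi> x)"
      unfolding 1 using H1_combination(2)[OF test_function_H1(1)[OF 1(1)] test_function_H1(1)[OF 1(2)]] by simp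
    then show ?thesis using test_functions_combination[OF 1(1,2)] by blast
  qed
  have comb': "r *\<^sub>R w + s *\<^sub>R w' \<in> closure ?T" if w: "w \<in> closure ?T" "w' \<in> closure ?T" for r s w w'
  proof -
    obtain f g where "\<And>j. f j \<in> ?T" "f \<longlonglongrightarrow> w" "\<And>j. g j \<in> ?T" "g \<longlonglongrightarrow> w'"
      using w unfolding closure_sequential by blast
    then show ?thesis unfolding closure_sequential
      by (intro exI[of _ "\<lambda>j. r *\<^sub>R f j + s *\<^sub>R g j"] conjI allI comb tendsto_intros)
  qed
  have ne: "sobolev_pair \<Omega> (\<lambda>x. 0) \<in> closure ?T"
    by (rule subsetD[OF closure_subset imageI[OF test_functions_zero]])
  show ?thesis unfolding H10_pairs_def subspace_def
  proof (intro conjI ballI allI)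
    show "0 \<in> closure ?T" using comb'[OF ne ne, of 0 0] by simp
    show "x + y \<in> closure ?T" if "x \<in> closure ?T" "y \<in> closure ?T" for x y
      using comb'[OF that, of 1 1] by simp
    show "c *\<^sub>R x \<in> closure ?T" if "x \<in> closure ?T" for c x
      using comb'[OF that that, of c 0] by simp
  qed
qed

lemma H10_pairs_closed_condition:
  assumes w: "w \<in> H10_pairs \<Omega>" and cont: "continuous_on UNIV F"
    and test: "\<And>\<phi>. \<phi> \<in> test_functions \<Omega> \<Longrightarrow> F (sobolev_pair \<Omega> \<phi>) \<le> (0::real)"
  shows "F w \<le> 0"
proof -
  have "closed {w. F w \<le> 0}" using cont by (intro closed_Collect_le) auto
  moreover have "sobolev_pair \<Omega> ` test_functions \<Omega> \<subseteq> {w. F w \<le> 0}" using test by auto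
  ultimately have "H10_pairs \<Omega> \<subseteq> {w. F w \<le> 0}" unfolding H10_pairs_def by (rule closure_minimal[rotated])
  then show ?thesis using w by blast
qed

text \<open>
  Linear identities pass from test functions to their closure; support in \<open>\<Omega>\<close>, the weak gradient relation
  and orthogonality to gradients are all of this kind.
\<close>

lemma H10_pairs_linear_condition:
  assumes w: "w \<in> H10_pairs \<Omega>"
    and test: "\<And>\<phi>. \<phi> \<in> test_functions \<Omega> \<Longrightarrow> sobolev_pair \<Omega> \<phi> \<bullet> k = 0"
  shows "w \<bullet> k = 0"
  using H10_pairs_closed_condition[OF w, of "\<lambda>w. w \<bullet> k"] H10_pairs_closed_condition[OF w, of "\<lambda>w. - (w \<bullet> k)"] test
  by (force intro: continuous_intros)

text \<open>
  Every point of the closure comes from a function in $H^1_0$: vanishing outside \<open>\<Omega>\<close> and the weak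
  gradient relation are both orthogonality conditions, and they hold for test functions.
\<close>

lemma H10_pair_exists:
  assumes w: "(U, G) \<in> H10_pairs \<Omega>"
  shows "rep_L2 U \<in> H10 \<Omega>" "sobolev_pair \<Omega> (rep_L2 U) = (U, G)"
proof -
  have mc: "- \<Omega> \<in> sets lebesgue" using meas by (metis Compl_in_sets_lebesgue)
  have off: "to_L2 \<Omega> f \<bullet> to_L2 (- \<Omega>) h = 0"
    if f: "f \<in> L2_space \<Omega>" and h: "h \<in> L2_space (- \<Omega>)" for f h :: "real^'n \<Rightarrow> 'b::euclidean_space"
  proof -
    have "to_L2 \<Omega> f \<bullet> to_L2 (- \<Omega>) h = L2_inner UNIV (\<lambda>x. indicator \<Omega> x *\<^sub>R f x) (\<lambda>x. indicator (- \<Omega>) x *\<^sub>R h x)"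
      unfolding to_L2_def by (intro inner_abs_L2 L2_space_extend[OF meas f] L2_space_extend[OF mc h])
    also have "\<dots> = 0" unfolding L2_inner_def
      by (rule integral_eq_zero_AE) (auto simp: indicator_def)
    finally show ?thesis .
  qed
  have rU: "rep_L2 U \<in> L2_space (- \<Omega>)" and rG: "rep_L2 G \<in> L2_space (- \<Omega>)"
    by (rule L2_space_subset[OF mc rep_L2_in])+
  have "(U, G) \<bullet> (to_L2 (- \<Omega>) (rep_L2 U), 0) = 0"
  proof (rule H10_pairs_linear_condition[OF w])
    fix \<phi> assume \<phi>: "\<phi> \<in> test_functions \<Omega>"
    show "sobolev_pair \<Omega> \<phi> \<bullet> (to_L2 (- \<Omega>) (rep_L2 U), 0) = 0"
      unfolding test_function_H1(2)[OF \<phi>] using off[OF test_function_L2(1)[OF meas \<phi>] rU] by simp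
  qed
  then have U: "to_L2 \<Omega> (rep_L2 U) = U" by (intro to_L2_rep_if_supported[OF meas]) simp
  have "(U, G) \<bullet> (0, to_L2 (- \<Omega>) (rep_L2 G)) = 0"
  proof (rule H10_pairs_linear_condition[OF w])
    fix \<phi> assume \<phi>: "\<phi> \<in> test_functions \<Omega>"
    show "sobolev_pair \<Omega> \<phi> \<bullet> (0, to_L2 (- \<Omega>) (rep_L2 G)) = 0"
      unfolding test_function_H1(2)[OF \<phi>] using off[OF test_function_L2(3)[OF meas \<phi>] rG] by simp
  qed
  then have G: "to_L2 \<Omega> (rep_L2 G) = G" by (intro to_L2_rep_if_supported[OF meas]) simp
  have rel: "weak_grad_relation \<Omega> (to_L2 \<Omega> (rep_L2 U)) (to_L2 \<Omega> (rep_L2 G))"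
    unfolding U G weak_grad_relation_def
  proof (intro ballI allI)
    fix \<phi> i assume \<phi>: "\<phi> \<in> test_functions \<Omega>"
    have "(U, G) \<bullet> (to_L2 \<Omega> (partial_deriv i \<phi>), to_L2 \<Omega> (\<lambda>x. \<phi> x *\<^sub>R axis i 1)) = 0"
    proof (rule H10_pairs_linear_condition[OF w])
      fix \<psi> assume "\<psi> \<in> test_functions \<Omega>"
      from H1_relation[OF test_function_H1(1)[OF this]] \<phi>
      show "sobolev_pair \<Omega> \<psi> \<bullet> (to_L2 \<Omega> (partial_deriv i \<phi>), to_L2 \<Omega> (\<lambda>x. \<phi> x *\<^sub>R axis i 1)) = 0"
        unfolding weak_grad_relation_def sobolev_pair_def by simp
    qed
    then show "U \<bullet> to_L2 \<Omega> (partial_deriv i \<phi>) + G \<bullet> to_L2 \<Omega> (\<lambda>x. \<phi> x *\<^sub>R axis i 1) = 0" by simp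
  qed
  note L = rep_L2_in_Omega[OF meas, of U] rep_L2_in_Omega[OF meas, of G]
  show *: "sobolev_pair \<Omega> (rep_L2 U) = (U, G)"
    unfolding sobolev_pair_def H1_if_relation(2)[OF L rel] U G ..
  show "rep_L2 U \<in> H10 \<Omega>"
    unfolding H10_iff * using w H1_if_relation(1)[OF L rel] by blast
qed

lemma H10_combination:
  assumes "u \<in> H10 \<Omega>" "v \<in> H10 \<Omega>" shows "(\<lambda>x. r * u x + s * v x) \<in> H10 \<Omega>"
  unfolding H10_iff
proof
  note H = H1_combination[OF assms[THEN H10_H1], of r s]
  show "(\<lambda>x. r * u x + s * v x) \<in> H1 \<Omega>" by (rule H(1))
  show "sobolev_pair \<Omega> (\<lambda>x. r * u x + s * v x) \<in> H10_pairs \<Omega>" unfolding H(2)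
    by (intro subspace_add[OF subspace_H10_pairs] subspace_scale[OF subspace_H10_pairs] H10_pair assms)
qed

lemma subspace_H10_grads: "subspace (H10_grads \<Omega>)"
  unfolding H10_grads_def by (intro linear_subspace_image subspace_H10_pairs linear_snd)

text \<open>
  In other words, the orthogonal complement of the gradients of $H^1_0$ consists of the fields that are
  divergence-free in \<open>\<Omega>\<close>.
\<close>

lemma orthogonal_H10_grads_iff:
  "(\<forall>G\<in>H10_grads \<Omega>. K \<bullet> G = 0) \<longleftrightarrow> (\<forall>\<phi>\<in>test_functions \<Omega>. K \<bullet> to_L2 \<Omega> (grad \<phi>) = 0)"
proof
  assume *: "\<forall>G\<in>H10_grads \<Omega>. K \<bullet> G = 0"
  show "\<forall>\<phi>\<in>test_functions \<Omega>. K \<bullet> to_L2 \<Omega> (grad \<phi>) = 0"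
  proof
    fix \<phi> assume \<phi>: "\<phi> \<in> test_functions \<Omega>"
    have "sobolev_pair \<Omega> \<phi> \<in> H10_pairs \<Omega>"
      unfolding H10_pairs_def by (rule subsetD[OF closure_subset imageI[OF \<phi>]])
    then have "to_L2 \<Omega> (grad \<phi>) \<in> H10_grads \<Omega>"
      unfolding H10_grads_def test_function_H1(2)[OF \<phi>] by force
    then show "K \<bullet> to_L2 \<Omega> (grad \<phi>) = 0" using * by blast
  qed
next
  assume *: "\<forall>\<phi>\<in>test_functions \<Omega>. K \<bullet> to_L2 \<Omega> (grad \<phi>) = 0"
  show "\<forall>G\<in>H10_grads \<Omega>. K \<bullet> G = 0"
  proof
    fix G assume "G \<in> H10_grads \<Omega>"
    then obtain U where w: "(U, G) \<in> H10_pairs \<Omega>" unfolding H10_grads_def by force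
    have "(U, G) \<bullet> (0, K) = 0"
      by (rule H10_pairs_linear_condition[OF w]) (use * in \<open>simp add: test_function_H1(2) inner_commute\<close>)
    then show "K \<bullet> G = 0" by (simp add: inner_commute)
  qed
qed

lemma Poincare_H10_pairs:
  assumes "bounded \<Omega>"
  obtains C where "0 \<le> C" "\<And>U G. (U, G) \<in> H10_pairs \<Omega> \<Longrightarrow> norm U \<le> C * norm G"
proof -
  obtain R where R: "0 < R" "\<And>x. x \<in> \<Omega> \<Longrightarrow> norm x \<le> R" using assms unfolding bounded_pos by blast
  have "norm U \<le> (2 * R) * norm G" if w: "(U, G) \<in> H10_pairs \<Omega>" for U G
  proof -
    have "(\<lambda>w. norm (fst w) - (2 * R) * norm (snd w)) (U, G) \<le> 0"
    proof (rule H10_pairs_closed_condition[OF w])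
      show "continuous_on UNIV (\<lambda>w::('n, real) L2 \<times> ('n, real^'n) L2. norm (fst w) - (2 * R) * norm (snd w))"
        by (intro continuous_intros)
      fix \<phi> assume \<phi>: "\<phi> \<in> test_functions \<Omega>"
      note L = test_function_L2[OF meas \<phi>]
      have "(norm (to_L2 \<Omega> \<phi>))\<^sup>2 \<le> (2 * R * norm (to_L2 \<Omega> (grad \<phi>)))\<^sup>2"
        using Poincare_test_function[OF meas \<phi> R(2)]
        by (simp add: power_mult_distrib power2_norm_eq_inner inner_to_L2[OF meas] L)
      then have "norm (to_L2 \<Omega> \<phi>) \<le> 2 * R * norm (to_L2 \<Omega> (grad \<phi>))"
        by (rule power2_le_imp_le) (use R in simp)
      then show "norm (fst (sobolev_pair \<Omega> \<phi>)) - (2 * R) * norm (snd (sobolev_pair \<Omega> \<phi>)) \<le> 0"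
        by (simp add: test_function_H1(2)[OF \<phi>])
    qed
    then show ?thesis by simp
  qed
  with R(1) show thesis by (intro that[of "2 * R"]) simp_all
qed

text \<open>
  By the Poincare inequality convergence of the gradients forces convergence of the functions.
\<close>

lemma closed_H10_grads:
  assumes "bounded \<Omega>" shows "closed (H10_grads \<Omega>)"
  unfolding closed_sequential_limits
proof (intro allI impI, elim conjE)
  fix G l assume G: "\<forall>n. G n \<in> H10_grads \<Omega>" and l: "G \<longlonglongrightarrow> l"
  obtain C where C: "0 \<le> C" "\<And>U G. (U, G) \<in> H10_pairs \<Omega> \<Longrightarrow> norm U \<le> C * norm G"
    using Poincare_H10_pairs[OF assms] by metis
  have "\<forall>n. \<exists>U. (U, G n) \<in> H10_pairs \<Omega>" using G unfolding H10_grads_def by force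
  from choice[OF this] obtain U where U: "\<And>n. (U n, G n) \<in> H10_pairs \<Omega>" by blast
  have d: "dist (U m) (U n) \<le> C * dist (G m) (G n)" for m n
    using C(2)[of "U m - U n" "G m - G n"] subspace_diff[OF subspace_H10_pairs U[of m] U[of n]]
    by (simp add: dist_norm)
  have "Cauchy U"
  proof (rule metric_CauchyI)
    fix e :: real assume e: "0 < e"
    have "Cauchy G" using l by (rule LIMSEQ_imp_Cauchy)
    then obtain M where M: "\<And>m n. M \<le> m \<Longrightarrow> M \<le> n \<Longrightarrow> dist (G m) (G n) < e / (C + 1)"
      using metric_CauchyD[of G "e / (C + 1)"] e C(1) by auto
    have "dist (U m) (U n) < e" if "M \<le> m" "M \<le> n" for m n
    proof -
      have "C * dist (G m) (G n) \<le> (C + 1) * dist (G m) (G n)" by (simp add: mult_right_mono)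
      also have "\<dots> < e" using M[OF that] C(1) by (simp add: field_simps)
      finally show ?thesis using d[of m n] by linarith
    qed
    then show "\<exists>M. \<forall>m\<ge>M. \<forall>n\<ge>M. dist (U m) (U n) < e" by blast
  qed
  then obtain L where "U \<longlonglongrightarrow> L" using Cauchy_convergent convergent_def by blast
  then have "(\<lambda>n. (U n, G n)) \<longlonglongrightarrow> (L, l)" using l by (intro tendsto_Pair)
  then have "(L, l) \<in> H10_pairs \<Omega>" 
    using closed_sequentially[OF closed_H10_pairs, of "\<lambda>n. (U n, G n)"] U by blast
  then show "l \<in> H10_grads \<Omega>" unfolding H10_grads_def by force
qed

text \<open>
  The Riesz representation of \<open>u \<mapsto> \<langle>u, h\<rangle>\<close> with respect to the inner product of gradients, which by the
  Poincare inequality is equivalent to that of $H^1$. The representing function is the weak solution of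
  \<open>- \<Delta>w = h\<close>, the minimiser of \<open>F\<close>, which is twice the Dirichlet energy.
\<close>

lemma H10_function_inner_as_grad_inner:
  assumes "bounded \<Omega>"
  obtains K where "\<And>U G. (U, G) \<in> H10_pairs \<Omega> \<Longrightarrow> U \<bullet> h = G \<bullet> K"
proof -
  obtain C where C: "0 \<le> C" "\<And>U G. (U, G) \<in> H10_pairs \<Omega> \<Longrightarrow> norm U \<le> C * norm G"
    using Poincare_H10_pairs[OF assms] by metis
  define F where "F w = (norm (snd w))\<^sup>2 - 2 * (fst w \<bullet> h)" for w :: "('n, real) L2 \<times> ('n, real^'n) L2"
  let ?W = "H10_pairs \<Omega>"
  \<comment> \<open>The convexity of \<open>F\<close> sees only the gradient; Poincare turns \<open>1 / 4\<close> of its square into this multiple of the full distance.\<close>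
  define c where "c = 1 / (4 * (C\<^sup>2 + 1))"
  have cp: "C\<^sup>2 + 1 > 0" using zero_le_power2[of C] by linarith
  note sub = subspace_H10_pairs
  obtain w where w: "w \<in> ?W" "\<And>v. v \<in> ?W \<Longrightarrow> F w \<le> F v"
  proof (rule strongly_midpoint_convex_attains_min[of ?W F c "- (C * norm h)\<^sup>2"])
    show "closed ?W" by (rule closed_H10_pairs)
    show "?W \<noteq> {}" using subspace_0[OF sub] by blast
    show "midpoint x y \<in> ?W" if "x \<in> ?W" "y \<in> ?W" for x y
      unfolding midpoint_def using that by (intro subspace_scale[OF sub] subspace_add[OF sub])
    show "0 < c" unfolding c_def using cp by simp
    show "continuous_on ?W F" unfolding F_def by (intro continuous_intros)
    show "F (midpoint x y) \<le> (F x + F y) / 2 - c * (dist x y)\<^sup>2" if "x \<in> ?W" "y \<in> ?W" for x y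
    proof -
      let ?g = "norm (snd x - snd y)"
      have "x - y \<in> ?W" using that by (intro subspace_diff[OF sub])
      then have "norm (fst (x - y)) \<le> C * norm (snd (x - y))" by (intro C(2)) (simp only: prod.collapse)
      then have "norm (fst x - fst y) \<le> C * ?g" by simp
      then have "(norm (fst x - fst y))\<^sup>2 \<le> (C * ?g)\<^sup>2" by (intro power_mono) auto
      then have "(dist x y)\<^sup>2 \<le> (C\<^sup>2 + 1) * ?g\<^sup>2"
        by (simp add: dist_prod_def dist_norm power_mult_distrib algebra_simps)
      then have "c * (dist x y)\<^sup>2 \<le> ?g\<^sup>2 / 4" unfolding c_def using cp by (simp add: field_simps)
      moreover have "(norm (snd (midpoint x y)))\<^sup>2 = ((norm (snd x))\<^sup>2 + (norm (snd y))\<^sup>2) / 2 - ?g\<^sup>2 / 4"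
        using midpoint_norm_identity[of 0 "snd x" "snd y"] by (simp add: dist_norm midpoint_def)
      moreover have "fst (midpoint x y) \<bullet> h = (fst x \<bullet> h + fst y \<bullet> h) / 2"
        by (simp add: midpoint_def inner_add_left)
      ultimately show ?thesis unfolding F_def by argo
    qed
    show "- (C * norm h)\<^sup>2 \<le> F x" if "x \<in> ?W" for x
    proof -
      have "fst x \<bullet> h \<le> norm (fst x) * norm h" by (rule norm_cauchy_schwarz)
      also have "\<dots> \<le> (C * norm (snd x)) * norm h"
        using C(2)[of "fst x" "snd x"] that by (intro mult_right_mono) auto
      finally have "2 * (fst x \<bullet> h) \<le> 2 * (norm (snd x)) * (C * norm h)" by (simp add: algebra_simps)
      also have "\<dots> \<le> (norm (snd x))\<^sup>2 + (C * norm h)\<^sup>2" by (rule sum_squares_bound)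
      finally show ?thesis unfolding F_def by simp
    qed
  qed blast
  have "U \<bullet> h = G \<bullet> snd w" if v: "(U, G) \<in> ?W" for U G
  proof -
    have "G \<bullet> snd w - U \<bullet> h = 0"
    proof (rule quadratic_nonneg_imp_linear_coeff_zero)
      fix t
      have "w + t *\<^sub>R (U, G) \<in> ?W" by (intro subspace_add[OF sub] subspace_scale[OF sub] w(1) v)
      from w(2)[OF this] show "0 \<le> 2 * t * (G \<bullet> snd w - U \<bullet> h) + t\<^sup>2 * (norm G)\<^sup>2"
        unfolding F_def power2_norm_eq_inner
        by (simp add: inner_simps inner_commute power2_eq_square algebra_simps)
    qed
    then show ?thesis by simp
  qed
  then show thesis by (rule that)
qed

text \<open>
  Weak convergence of the gradients is enough: the part \<open>\<langle>u, h\<rangle>\<close> of the inner product is itself an inner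
  product of gradients.
\<close>

lemma weakly_converges_H10:
  assumes "bounded \<Omega>" and v: "\<And>k. v k \<in> H10 \<Omega>" and l: "l \<in> H10 \<Omega>"
    and lim: "\<And>K. (\<lambda>k. to_L2 \<Omega> (weak_grad \<Omega> (v k)) \<bullet> K) \<longlonglongrightarrow> to_L2 \<Omega> (weak_grad \<Omega> l) \<bullet> K"
  shows "weakly_converges (H10 \<Omega>) (H1_inner \<Omega>) v l"
  unfolding weakly_converges_def
proof (intro conjI allI ballI v l)
  fix h assume h: "h \<in> H10 \<Omega>"
  obtain K where K: "\<And>U G. (U, G) \<in> H10_pairs \<Omega> \<Longrightarrow> U \<bullet> to_L2 \<Omega> h = G \<bullet> K"
    using H10_function_inner_as_grad_inner[OF assms(1), of "to_L2 \<Omega> h"] by metis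
  have eq: "H1_inner \<Omega> w h = to_L2 \<Omega> (weak_grad \<Omega> w) \<bullet> K + to_L2 \<Omega> (weak_grad \<Omega> w) \<bullet> to_L2 \<Omega> (weak_grad \<Omega> h)"
    if w: "w \<in> H10 \<Omega>" for w
    using H1_inner_eq[OF H10_H1[OF w] H10_H1[OF h]] K[OF H10_pair[OF w, unfolded sobolev_pair_def]]
    by (simp add: sobolev_pair_def)
  show "(\<lambda>k. H1_inner \<Omega> (v k) h) \<longlonglongrightarrow> H1_inner \<Omega> l h"
    unfolding eq[OF v] eq[OF l] by (intro tendsto_add lim)
qed

end

section \<open>Shrinkage as the resolvent of the weighted total variation\<close>

text \<open>
  Soft thresholding, for \<open>c \<ge> 0\<close> the resolvent of \<open>c * norm\<close>. The residual \<open>w - shrink c w\<close> is the projection of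
  \<open>w\<close> onto the ball of radius \<open>c\<close>.
\<close>

definition shrink :: "real \<Rightarrow> 'a::real_normed_vector \<Rightarrow> 'a" where
  "shrink c w = (if norm w \<noteq> 0 then max (norm w - c) 0 *\<^sub>R (w /\<^sub>R norm w) else 0)"

lemma shrink_eq:
  assumes "0 \<le> c" shows "shrink c w = (if norm w \<le> c then 0 else (1 - c / norm w) *\<^sub>R w)"
proof (cases "norm w \<le> c")
  case False
  then have "norm w > 0" "norm w > c" using assms by auto
  then show ?thesis by (simp add: shrink_def max_def field_simps)
qed (simp add: shrink_def max_def)

lemma shrink_residual:
  fixes w :: "'a::real_inner"
  assumes "0 \<le> c"
  shows "norm (w - shrink c w) \<le> c" "(w - shrink c w) \<bullet> shrink c w = c * norm (shrink c w)"
proof -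
  have "norm (w - shrink c w) \<le> c \<and> (w - shrink c w) \<bullet> shrink c w = c * norm (shrink c w)"
  proof (cases "norm w \<le> c")
    case True
    then show ?thesis by (simp add: shrink_eq[OF assms])
  next
    case False
    let ?t = "c / norm w"
    have p: "norm w > 0" using False assms by linarith
    have t: "0 \<le> ?t" "?t < 1" using False assms p by (auto simp: field_simps)
    have s: "shrink c w = (1 - ?t) *\<^sub>R w" using False by (simp add: shrink_eq[OF assms])
    have r: "w - shrink c w = ?t *\<^sub>R w" unfolding s by (simp add: scaleR_diff_left)
    have "norm (w - shrink c w) = c" unfolding r using t p by (simp add: assms)
    moreover have "norm (shrink c w) = (1 - ?t) * norm w" unfolding s using t by simp
    then have "(w - shrink c w) \<bullet> shrink c w = c * norm (shrink c w)"
      unfolding r unfolding s using p by (simp add: dot_square_norm power2_eq_square)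
    ultimately show ?thesis by simp
  qed
  then show "norm (w - shrink c w) \<le> c" "(w - shrink c w) \<bullet> shrink c w = c * norm (shrink c w)" by auto
qed

text \<open>
  The residual has norm at most \<open>c\<close> and pairs with \<open>shrink c w\<close> to \<open>c * norm (shrink c w)\<close>, that is, it is a
  subgradient of \<open>c * norm\<close> there.
\<close>

lemma shrink_subgradient:
  fixes w y :: "'a::real_inner"
  assumes "0 \<le> c"
  shows "c * norm (shrink c w) + (w - shrink c w) \<bullet> (y - shrink c w) \<le> c * norm y"
proof -
  have "(w - shrink c w) \<bullet> y \<le> norm (w - shrink c w) * norm y" by (rule norm_cauchy_schwarz)
  also have "\<dots> \<le> c * norm y" by (intro mult_right_mono shrink_residual(1) assms) simp
  finally show ?thesis using shrink_residual(2)[OF assms, of w] by (simp add: inner_diff_right)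
qed

lemma norm_shrink_le: "0 \<le> c \<Longrightarrow> norm (shrink c w) \<le> norm w"
proof (cases "norm w = 0")
  case False
  then have "norm (shrink c w) = max (norm w - c) 0" by (simp add: shrink_def)
  then show "0 \<le> c \<Longrightarrow> norm (shrink c w) \<le> norm w" by simp
qed (simp add: shrink_def)

lemma borel_measurable_shrink:
  fixes f :: "'a \<Rightarrow> 'b::euclidean_space"
  assumes [measurable]: "f \<in> borel_measurable M" "c \<in> borel_measurable M"
  shows "(\<lambda>x. shrink (c x) (f x)) \<in> borel_measurable M"
  unfolding shrink_def by measurable

lemma norm_abs_L2: "f \<in> L2_space UNIV \<Longrightarrow> norm (abs_L2 f) = L2_norm UNIV f"
  by (simp add: norm_eq_sqrt_inner[of "abs_L2 f"] inner_abs_L2 L2_norm_def)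

text \<open>
  With \<open>c = a / \<lambda>\<close> and \<open>g = \<nabla>u_f\<close>, both extended by zero, this is the objective of the primal problem
  divided by \<open>\<lambda>\<close>, as a function of the gradient of \<open>v - u_f\<close>. The resolvent \<open>shrink_map\<close> defined
  next is the update of \<open>d\<close> in the algorithm; where \<open>c = 0\<close>, in particular outside \<open>\<Omega>\<close>, it is the identity.
\<close>

definition weighted_norm_integral ::
  "(real^'n \<Rightarrow> real) \<Rightarrow> (real^'n \<Rightarrow> real^'n) \<Rightarrow> ('n, real^'n) L2 \<Rightarrow> real" where
  "weighted_norm_integral c g Z = (LINT x|lebesgue_on UNIV. c x * norm (rep_L2 Z x + g x))"

definition shrink_map ::
  "(real^'n \<Rightarrow> real) \<Rightarrow> (real^'n \<Rightarrow> real^'n) \<Rightarrow> ('n, real^'n) L2 \<Rightarrow> ('n, real^'n) L2" where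
  "shrink_map c g Z = abs_L2 (\<lambda>x. shrink (c x) (rep_L2 Z x + g x) - g x)"

context
  fixes c :: "real^'n \<Rightarrow> real" and g :: "real^'n \<Rightarrow> real^'n"
  assumes c: "c \<in> L2_space UNIV" and c0: "AE x in lebesgue_on UNIV. 0 \<le> c x" and g: "g \<in> L2_space UNIV"
begin

lemma shrink_field_L2:
  assumes f: "f \<in> L2_space UNIV" shows "(\<lambda>x. shrink (c x) (f x)) \<in> L2_space UNIV"
proof (rule L2_space_bound[OF f])
  show "(\<lambda>x. shrink (c x) (f x)) \<in> borel_measurable (lebesgue_on UNIV)"
    by (rule borel_measurable_shrink[OF L2_space_measurable[OF f] L2_space_measurable[OF c]])
  show "AE x in lebesgue_on UNIV. norm (shrink (c x) (f x)) \<le> norm (f x)"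
    using c0 by eventually_elim (rule norm_shrink_le)
qed

lemma shrink_map_field_L2: "(\<lambda>x. shrink (c x) (rep_L2 Z x + g x) - g x) \<in> L2_space UNIV"
  by (intro L2_space_diff[OF _ g] shrink_field_L2 L2_space_add[OF rep_L2_in g])

lemma rep_shrink_map:
  "AE x in lebesgue_on UNIV. rep_L2 (shrink_map c g Z) x = shrink (c x) (rep_L2 Z x + g x) - g x"
  unfolding shrink_map_def by (rule rep_abs_L2[OF shrink_map_field_L2])

lemma weighted_norm_integrable:
  assumes f: "f \<in> L2_space UNIV" shows "integrable (lebesgue_on UNIV) (\<lambda>x. c x * norm (f x))"
proof (rule Bochner_Integration.integrable_bound[OF L2_integrable_norm_mult[OF c f]])
  show "(\<lambda>x. c x * norm (f x)) \<in> borel_measurable (lebesgue_on UNIV)"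
    using L2_space_measurable[OF c] L2_space_measurable[OF f] by simp
qed (simp add: abs_mult)

lemma shrink_map_resolvent:
  "weighted_norm_integral c g (shrink_map c g Z) + (Z - shrink_map c g Z) \<bullet> (Y - shrink_map c g Z)
     \<le> weighted_norm_integral c g Y"
proof -
  let ?s = "\<lambda>x. shrink (c x) (rep_L2 Z x + g x)"
  let ?f = "\<lambda>x. ?s x - g x"
  let ?M = "lebesgue_on UNIV :: (real^'n) measure"
  have f: "?f \<in> L2_space UNIV" by (rule shrink_map_field_L2)
  have s: "?s \<in> L2_space UNIV" by (intro shrink_field_L2 L2_space_add[OF rep_L2_in g])
  have minus: "X - shrink_map c g Z = abs_L2 (\<lambda>x. rep_L2 X x - ?f x)" for X
    unfolding shrink_map_def using abs_L2_minus[OF rep_L2_in f, of X] by (simp add: abs_rep_L2)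
  note df = L2_space_diff[OF rep_L2_in f]
  have inner: "(Z - shrink_map c g Z) \<bullet> (Y - shrink_map c g Z)
      = (LINT x|?M. (rep_L2 Z x - ?f x) \<bullet> (rep_L2 Y x - ?f x))"
    unfolding minus by (simp only: inner_abs_L2[OF df df] L2_inner_def)
  have GJ: "weighted_norm_integral c g (shrink_map c g Z) = (LINT x|?M. c x * norm (?s x))"
    unfolding weighted_norm_integral_def
  proof (rule integral_cong_AE)
    show "AE x in ?M. c x * norm (rep_L2 (shrink_map c g Z) x + g x) = c x * norm (?s x)"
      using rep_shrink_map[of Z] by eventually_elim simp
    show "(\<lambda>x. c x * norm (rep_L2 (shrink_map c g Z) x + g x)) \<in> borel_measurable ?M"
      using weighted_norm_integrable[OF L2_space_add[OF rep_L2_in g]] by auto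
    show "(\<lambda>x. c x * norm (?s x)) \<in> borel_measurable ?M" using weighted_norm_integrable[OF s] by auto
  qed
  have "(LINT x|?M. c x * norm (?s x)) + (LINT x|?M. (rep_L2 Z x - ?f x) \<bullet> (rep_L2 Y x - ?f x))
      = (LINT x|?M. c x * norm (?s x) + (rep_L2 Z x - ?f x) \<bullet> (rep_L2 Y x - ?f x))"
    by (rule Bochner_Integration.integral_add[symmetric, OF weighted_norm_integrable[OF s] L2_integrable_inner[OF df df]])
  also have "\<dots> \<le> (LINT x|?M. c x * norm (rep_L2 Y x + g x))"
  proof (rule integral_mono_AE)
    show "integrable ?M (\<lambda>x. c x * norm (?s x) + (rep_L2 Z x - ?f x) \<bullet> (rep_L2 Y x - ?f x))"
      by (rule Bochner_Integration.integrable_add[OF weighted_norm_integrable[OF s] L2_integrable_inner[OF df df]])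
    show "integrable ?M (\<lambda>x. c x * norm (rep_L2 Y x + g x))"
      by (rule weighted_norm_integrable[OF L2_space_add[OF rep_L2_in g]])
    show "AE x in ?M. c x * norm (?s x) + (rep_L2 Z x - ?f x) \<bullet> (rep_L2 Y x - ?f x) \<le> c x * norm (rep_L2 Y x + g x)"
      using c0
    proof eventually_elim
      case (elim x)
      have e: "X - ?f x = X + g x - ?s x" for X by simp
      show ?case unfolding e by (rule shrink_subgradient[OF elim])
    qed
  qed
  finally show ?thesis unfolding inner GJ by (simp add: weighted_norm_integral_def)
qed

lemma weighted_norm_integral_lipschitz:
  "weighted_norm_integral c g X - weighted_norm_integral c g Y \<le> norm (abs_L2 c) * norm (X - Y)"
proof -
  let ?M = "lebesgue_on UNIV :: (real^'n) measure"
  let ?d = "\<lambda>x. rep_L2 X x - rep_L2 Y x"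
  have d: "?d \<in> L2_space UNIV" by (rule L2_space_diff[OF rep_L2_in rep_L2_in])
  have nd: "(\<lambda>x. norm (?d x)) \<in> L2_space UNIV"
    by (rule L2_space_bound[OF d]) (use L2_space_measurable[OF d] in auto)
  have XY: "X - Y = abs_L2 ?d" using abs_L2_minus[OF rep_L2_in rep_L2_in, of X Y] by (simp add: abs_rep_L2)
  have i: "integrable ?M (\<lambda>x. c x * norm (rep_L2 Z x + g x))" for Z
    by (rule weighted_norm_integrable[OF L2_space_add[OF rep_L2_in g]])
  have "weighted_norm_integral c g X - weighted_norm_integral c g Y
      = (LINT x|?M. c x * norm (rep_L2 X x + g x) - c x * norm (rep_L2 Y x + g x))"
    unfolding weighted_norm_integral_def by (rule Bochner_Integration.integral_diff[symmetric, OF i i])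
  also have "\<dots> \<le> (LINT x|?M. c x * norm (?d x))"
  proof (rule integral_mono_AE[OF Bochner_Integration.integrable_diff[OF i i] weighted_norm_integrable[OF d]])
    show "AE x in ?M. c x * norm (rep_L2 X x + g x) - c x * norm (rep_L2 Y x + g x) \<le> c x * norm (?d x)"
      using c0
    proof eventually_elim
      case (elim x)
      have "norm (rep_L2 X x + g x) - norm (rep_L2 Y x + g x) \<le> norm (?d x)"
        using norm_triangle_ineq2[of "rep_L2 X x + g x" "rep_L2 Y x + g x"] by simp
      then show ?case using mult_left_mono[OF _ elim] by (simp add: right_diff_distrib[symmetric])
    qed
  qed
  also have "\<dots> = abs_L2 c \<bullet> abs_L2 (\<lambda>x. norm (?d x))"
    by (simp add: inner_abs_L2[OF c nd] L2_inner_def)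
  also have "\<dots> \<le> norm (abs_L2 c) * norm (abs_L2 (\<lambda>x. norm (?d x)))" by (rule norm_cauchy_schwarz)
  also have "norm (abs_L2 (\<lambda>x. norm (?d x))) = norm (X - Y)"
    unfolding XY norm_abs_L2[OF nd] norm_abs_L2[OF d]
    by (simp add: L2_norm_def L2_inner_def dot_square_norm power2_eq_square)
  finally show ?thesis .
qed

text \<open>
  A resolvent pair \<open>(D, B)\<close> satisfies the pointwise extremality relations: \<open>B\<close> is bounded by \<open>c\<close> and is
  aligned with \<open>D + g\<close>.
\<close>

lemma shrink_map_fixed_pair:
  assumes "shrink_map c g (D + B) = D"
  shows "AE x in lebesgue_on UNIV. norm (rep_L2 B x) \<le> c x \<and>
     rep_L2 B x \<bullet> (rep_L2 D x + g x) = c x * norm (rep_L2 D x + g x)"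
  using c0 rep_L2_plus[of D B] rep_shrink_map[of "D + B", unfolded assms]
proof eventually_elim
  case (elim x)
  let ?w = "rep_L2 (D + B) x + g x"
  have s: "shrink (c x) ?w = rep_L2 D x + g x" using elim(3) by simp
  have B: "rep_L2 B x = ?w - shrink (c x) ?w" unfolding s using elim(2) by simp
  show ?case using shrink_residual[OF elim(1), of ?w] unfolding B[symmetric] unfolding s by simp
qed

end

text \<open>
  Measurability transfers because Lebesgue measure is complete. The iterates are only prescribed almost
  everywhere, so their measurability has to be derived.
\<close>

lemma L2_space_cong_AE:
  fixes f h :: "real^'n \<Rightarrow> 'b::euclidean_space"
  assumes \<Omega>: "\<Omega> \<in> sets lebesgue" and f: "f \<in> L2_space \<Omega>" and ae: "AE x in lebesgue_on \<Omega>. f x = h x"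
  shows "h \<in> L2_space \<Omega>"
proof (rule L2_space_bound[OF f])
  have "(\<lambda>x. if x \<in> \<Omega> then h x else 0) \<in> borel_measurable lebesgue"
  proof (rule borel_measurable_AE)
    show "(\<lambda>x. if x \<in> \<Omega> then f x else 0) \<in> borel_measurable lebesgue"
      by (rule borel_measurable_if_I[OF L2_space_measurable[OF f] \<Omega>])
    show "AE x in lebesgue. (if x \<in> \<Omega> then f x else 0) = (if x \<in> \<Omega> then h x else 0)"
      using ae unfolding AE_lebesgue_on_iff[OF \<Omega>] lebesgue_on_UNIV_eq by eventually_elim simp
  qed
  then show "h \<in> borel_measurable (lebesgue_on \<Omega>)" by (rule borel_measurable_if_D)
  show "AE x in lebesgue_on \<Omega>. norm (h x) \<le> norm (f x)" using ae by eventually_elim simp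
qed

lemma AE_lebesgue_on_if_AE:
  "\<Omega> \<in> sets lebesgue \<Longrightarrow> AE x in lebesgue_on UNIV. P x \<Longrightarrow> AE x in lebesgue_on \<Omega>. P x"
  unfolding AE_lebesgue_on_iff by (auto elim: eventually_mono)

section \<open>Convergence of the split Bregman algorithm\<close>

text \<open>
  The equality case of Cauchy--Schwarz: \<open>v \<bullet> w = r * norm w\<close> forces the component of \<open>v\<close> along
  \<open>w\<close> to be \<open>r\<close>, and the bound on \<open>norm v\<close> leaves no room for an orthogonal component.
\<close>

lemma Cauchy_Schwarz_equality_direction:
  fixes v w :: "'a::real_inner"
  assumes v: "norm v \<le> r" "v \<bullet> w = r * norm w" and w: "w \<noteq> 0"
  shows "v = r *\<^sub>R (w /\<^sub>R norm w)"
proof -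
  let ?e = "r *\<^sub>R (w /\<^sub>R norm w)"
  have r: "0 \<le> r" using v(1) norm_ge_zero order_trans by blast
  have "norm (w /\<^sub>R norm w) = 1" using w by simp
  then have e: "norm ?e = r" using r by (simp only: norm_scaleR)
  have "(norm (v - ?e))\<^sup>2 = (norm v)\<^sup>2 - 2 * (v \<bullet> ?e) + (norm ?e)\<^sup>2"
    unfolding power2_norm_eq_inner by (simp add: inner_diff_left inner_diff_right inner_commute)
  also have "v \<bullet> ?e = r\<^sup>2" using v(2) w by (simp add: power2_eq_square)
  also note e
  finally have "(norm (v - ?e))\<^sup>2 = (norm v)\<^sup>2 - r\<^sup>2" by simp
  moreover have "(norm v)\<^sup>2 \<le> r\<^sup>2" using v(1) by (intro power_mono) auto
  ultimately have "(norm (v - ?e))\<^sup>2 \<le> 0" by simp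
  then show ?thesis by simp
qed

text \<open>
  A trace is a coset of the subspace $H^1_0$ of $H^1$, so equality of traces means that the difference lies
  in $H^1_0$.
\<close>

lemma boundary_trace_iff:
  assumes op: "open \<Omega>" and uf: "uf \<in> H1 \<Omega>" and v: "v \<in> H1 \<Omega>"
  shows "boundary_trace \<Omega> v = boundary_trace \<Omega> uf \<longleftrightarrow> (\<lambda>x. v x - uf x) \<in> H10 \<Omega>"
proof
  assume eq: "boundary_trace \<Omega> v = boundary_trace \<Omega> uf"
  have "(\<lambda>x. v x - v x) \<in> H10 \<Omega>"
    unfolding H10_iff[OF op] H1_diff[OF op v v]
    using H1_diff(1)[OF op v v] subspace_0[OF subspace_H10_pairs[OF op]] by simp
  then have "v \<in> boundary_trace \<Omega> v" using v by (simp add: boundary_trace_def)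
  then show "(\<lambda>x. v x - uf x) \<in> H10 \<Omega>" unfolding eq by (simp add: boundary_trace_def)
next
  assume d: "(\<lambda>x. v x - uf x) \<in> H10 \<Omega>"
  have "(\<lambda>x. w x - v x) \<in> H10 \<Omega> \<longleftrightarrow> (\<lambda>x. w x - uf x) \<in> H10 \<Omega>" for w
  proof
    assume "(\<lambda>x. w x - v x) \<in> H10 \<Omega>"
    from H10_combination[OF op this d, of 1 1] show "(\<lambda>x. w x - uf x) \<in> H10 \<Omega>" by simp
  next
    assume "(\<lambda>x. w x - uf x) \<in> H10 \<Omega>"
    from H10_combination[OF op this d, of 1 "-1"] show "(\<lambda>x. w x - v x) \<in> H10 \<Omega>" by simp
  qed
  then show "boundary_trace \<Omega> v = boundary_trace \<Omega> uf" unfolding boundary_trace_def by blast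
qed

lemma distr_div_eq: "distr_div \<Omega> g \<phi> = - L2_inner \<Omega> g (grad \<phi>)"
  by (simp add: distr_div_def L2_inner_def grad_def[abs_def])

text \<open>
  The weak form of the Poisson equation is the orthogonality relation that characterises the projection
  onto the gradients of $H^1_0$.
\<close>

lemma weak_poisson_solution_grad:
  assumes op: "open \<Omega>" and bd: "bounded \<Omega>" and g: "g \<in> L2_space \<Omega>"
    and sol: "weak_poisson_solution \<Omega> g v"
  shows "to_L2 \<Omega> (weak_grad \<Omega> v) = orth_proj (H10_grads \<Omega>) (to_L2 \<Omega> g)"
proof (rule orth_proj_unique[OF closed_H10_grads[OF op bd] subspace_H10_grads[OF op], symmetric])
  have m: "\<Omega> \<in> sets lebesgue" using op by simp
  have v: "v \<in> H10 \<Omega>" using sol by (simp add: weak_poisson_solution_def)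
  note vG = weak_grad_L2[OF op H10_H1[OF op v]]
  show "to_L2 \<Omega> (weak_grad \<Omega> v) \<in> H10_grads \<Omega>"
    using H10_pair[OF op v] unfolding H10_grads_def sobolev_pair_def by force
  have "\<forall>\<phi>\<in>test_functions \<Omega>. (to_L2 \<Omega> g - to_L2 \<Omega> (weak_grad \<Omega> v)) \<bullet> to_L2 \<Omega> (grad \<phi>) = 0"
  proof
    fix \<phi> assume \<phi>: "\<phi> \<in> test_functions \<Omega>"
    have "distr_div \<Omega> (weak_grad \<Omega> v) \<phi> = distr_div \<Omega> g \<phi>"
      using sol \<phi> by (simp add: weak_poisson_solution_def)
    then show "(to_L2 \<Omega> g - to_L2 \<Omega> (weak_grad \<Omega> v)) \<bullet> to_L2 \<Omega> (grad \<phi>) = 0"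
      by (simp add: distr_div_eq inner_diff_left inner_to_L2[OF m] g vG test_function_L2(3)[OF m \<phi>])
  qed
  then show "(to_L2 \<Omega> g - to_L2 \<Omega> (weak_grad \<Omega> v)) \<bullet> w = 0" if "w \<in> H10_grads \<Omega>" for w
    using orthogonal_H10_grads_iff[OF op] that by blast
qed

lemma orthogonal_iff_divergence_free:
  assumes op: "open \<Omega>" and g: "g \<in> L2_space \<Omega>"
  shows "divergence_free \<Omega> g \<longleftrightarrow> (\<forall>G\<in>H10_grads \<Omega>. to_L2 \<Omega> g \<bullet> G = 0)"
proof -
  have m: "\<Omega> \<in> sets lebesgue" using op by simp
  show ?thesis
    unfolding divergence_free_def orthogonal_H10_grads_iff[OF op]
    by (intro ball_cong refl) (simp add: distr_div_eq inner_to_L2[OF m g test_function_L2(3)[OF m]])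
qed

lemma weakly_converges_L2:
  fixes F :: "nat \<Rightarrow> real^'n \<Rightarrow> 'b::euclidean_space"
  assumes m: "\<Omega> \<in> sets lebesgue" and F: "\<And>k. F k \<in> L2_space \<Omega>"
    and lim: "\<And>h. (\<lambda>k. to_L2 \<Omega> (F k) \<bullet> h) \<longlonglongrightarrow> Z \<bullet> h"
  shows "weakly_converges (L2_space \<Omega>) (L2_inner \<Omega>) F (rep_L2 Z)"
  unfolding weakly_converges_def
proof (intro conjI allI ballI F rep_L2_in_Omega[OF m])
  fix h :: "real^'n \<Rightarrow> 'b" assume h: "h \<in> L2_space \<Omega>"
  show "(\<lambda>k. L2_inner \<Omega> (F k) h) \<longlonglongrightarrow> L2_inner \<Omega> (rep_L2 Z) h"
    using lim[of "to_L2 \<Omega> h"] unfolding inner_to_L2[OF m F h] unfolding inner_rep_to_L2[OF m h] .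
qed

theorem theorem4p2:
  fixes \<Omega> :: "(real^'n) set"
    and a uf :: "real^'n \<Rightarrow> real"
    and f :: "(real^'n \<Rightarrow> real) set"
    and lam :: real
    and \<alpha> :: "nat \<Rightarrow> real"
    and b d :: "nat \<Rightarrow> real^'n \<Rightarrow> real^'n"
    and u :: "nat \<Rightarrow> real^'n \<Rightarrow> real"
  assumes "CARD('n) \<ge> 2"
    and "open \<Omega>" and "connected \<Omega>" and "\<Omega> \<noteq> {}" and "bounded \<Omega>"
    and "a \<in> L2_space \<Omega>" and "AE x in lebesgue_on \<Omega>. 0 \<le> a x"
    and "f \<in> H_half \<Omega>"
    and "lam > 0"
    and "\<exists>v. primal_solution \<Omega> a f v"
    and "\<And>k. k \<ge> 1 \<Longrightarrow> \<alpha> k \<ge> 0" and "summable (\<lambda>k. \<alpha> (Suc k))"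
    and "uf \<in> H1 \<Omega>" and "boundary_trace \<Omega> uf = f"
    and "b 0 \<in> L2_space \<Omega>" and "d 0 \<in> L2_space \<Omega>"
    and "approx_split_bregman \<Omega> a lam \<alpha> uf b d u"
  shows "\<exists>bhat dhat uhat.
      weakly_converges (L2_space \<Omega>) (L2_inner \<Omega>) b bhat \<and>
      weakly_converges (L2_space \<Omega>) (L2_inner \<Omega>) d dhat \<and>
      weakly_converges (H10 \<Omega>) (H1_inner \<Omega>) (\<lambda>k. u (Suc k)) uhat \<and>
      (\<lambda>k. L2_norm \<Omega> (\<lambda>x. weak_grad \<Omega> (u (Suc k)) x - d k x)) \<longlonglongrightarrow> 0 \<and>
      summable (\<lambda>k. (L2_norm \<Omega> (\<lambda>x. weak_grad \<Omega> (u (Suc k)) x - d k x))\<^sup>2) \<and>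
      (let ubar = (\<lambda>x. uhat x + uf x) in
        primal_solution \<Omega> a f ubar \<and>
        dual_solution \<Omega> a uf (\<lambda>x. lam *\<^sub>R bhat x) \<and>
        (AE x in lebesgue_on \<Omega>. dhat x = weak_grad \<Omega> uhat x) \<and>
        divergence_free \<Omega> bhat \<and>
        (AE x in lebesgue_on \<Omega>.
          \<not> (norm (weak_grad \<Omega> ubar x) = 0 \<and> a x \<noteq> 0) \<longrightarrow>
          bhat x = (if a x = 0 then 0
            else (1 / lam) *\<^sub>R a x *\<^sub>R (weak_grad \<Omega> ubar x /\<^sub>R norm (weak_grad \<Omega> ubar x)))))"
proof -
  note op = assms(2) and bd = assms(5) and a = assms(6) and a0 = assms(7) and lam = assms(9)
    and uf = assms(13) and uff = assms(14) and b0 = assms(15) and d0 = assms(16)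
    and alg = assms(17)[unfolded approx_split_bregman_def Let_def, rule_format]
  have m: "\<Omega> \<in> sets lebesgue" using op by simp
  let ?guf = "weak_grad \<Omega> uf"
  have guf: "?guf \<in> L2_space \<Omega>" by (rule weak_grad_L2[OF op uf])
  define c where "c x = indicator \<Omega> x *\<^sub>R ((1 / lam) *\<^sub>R a x)" for x
  define g where "g x = indicator \<Omega> x *\<^sub>R ?guf x" for x
  have c: "c \<in> L2_space UNIV" unfolding c_def by (rule L2_space_extend[OF m L2_space_scale[OF a]])
  have g: "g \<in> L2_space UNIV" unfolding g_def by (rule L2_space_extend[OF m guf])
  have c0: "AE x in lebesgue_on UNIV. 0 \<le> c x"
    using a0 lam unfolding AE_lebesgue_on_iff[OF m] by (auto simp: c_def elim!: eventually_mono)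
  let ?V = "H10_grads \<Omega>" and ?G = "weighted_norm_integral c g" and ?J = "shrink_map c g"
  let ?tg = "\<lambda>v. to_L2 \<Omega> (weak_grad \<Omega> v)"
  let ?F = "\<lambda>v. LINT x|lebesgue_on \<Omega>. a x * norm (weak_grad \<Omega> v x)"
  have wgL: "weak_grad \<Omega> v \<in> L2_space \<Omega>" if "v \<in> H10 \<Omega>" for v
    by (rule weak_grad_L2[OF op H10_H1[OF op that]])
  have tgV: "?tg p \<in> ?V" if p: "p \<in> H10 \<Omega>" for p
    using H10_pair[OF op p] unfolding H10_grads_def sobolev_pair_def by force
  have Vtg: "\<exists>p\<in>H10 \<Omega>. ?tg p = G" if G: "G \<in> ?V" for G
  proof -
    obtain w where w: "w \<in> H10_pairs \<Omega>" "G = snd w" using G unfolding H10_grads_def by blast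
    have "(fst w, G) \<in> H10_pairs \<Omega>" unfolding w(2) using w(1) by (simp only: prod.collapse)
    from H10_pair_exists[OF op this] show ?thesis unfolding sobolev_pair_def by blast
  qed
  \<comment> \<open>Competitors of the primal problem are the functions \<open>p + uf\<close> with \<open>p\<close> in $H^1_0$; \<open>G\<close> evaluates the objective at them.\<close>
  have add: "(\<lambda>x. p x + uf x) \<in> H1 \<Omega> \<and>
      (AE x in lebesgue_on \<Omega>. weak_grad \<Omega> (\<lambda>x. p x + uf x) x = weak_grad \<Omega> p x + ?guf x) \<and>
      boundary_trace \<Omega> (\<lambda>x. p x + uf x) = f" if p: "p \<in> H10 \<Omega>" for p
  proof -
    note pH = H10_H1[OF op p]
    note S = H1_add[OF op pH uf]
    have "to_L2 \<Omega> (weak_grad \<Omega> (\<lambda>x. p x + uf x)) = to_L2 \<Omega> (\<lambda>x. weak_grad \<Omega> p x + ?guf x)"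
      using S(2) unfolding sobolev_pair_def to_L2_add[OF m wgL[OF p] guf] by simp
    moreover have "(\<lambda>x. (p x + uf x) - uf x) \<in> H10 \<Omega>" using p by simp
    ultimately show ?thesis
      using S(1) to_L2_eq_iff[OF m weak_grad_L2[OF op S(1)] L2_space_add[OF wgL[OF p] guf]]
        boundary_trace_iff[OF op uf S(1)] uff by blast
  qed
  have GF: "?G (?tg p) = ?F (\<lambda>x. p x + uf x) / lam" if p: "p \<in> H10 \<Omega>" for p
  proof -
    let ?w = "weak_grad \<Omega> (\<lambda>x. p x + uf x)"
    have "?G (?tg p) = (LINT x|lebesgue_on UNIV. indicator \<Omega> x *\<^sub>R ((1 / lam) * (a x * norm (?w x))))"
      unfolding weighted_norm_integral_def
    proof (rule integral_cong_AE)
      show "AE x in lebesgue_on UNIV. c x * norm (rep_L2 (?tg p) x + g x) =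
          indicator \<Omega> x *\<^sub>R ((1 / lam) * (a x * norm (?w x)))"
        using rep_to_L2[OF m wgL[OF p]] add[OF p, unfolded AE_lebesgue_on_iff[OF m], THEN conjunct2, THEN conjunct1]
        by eventually_elim (auto simp: c_def g_def indicator_def)
      show "(\<lambda>x. c x * norm (rep_L2 (?tg p) x + g x)) \<in> borel_measurable (lebesgue_on UNIV)"
        using weighted_norm_integrable[OF c c0 g L2_space_add[OF rep_L2_in g]] by auto
      have "(\<lambda>x. c x * norm (indicator \<Omega> x *\<^sub>R ?w x)) \<in> borel_measurable (lebesgue_on UNIV)"
        using weighted_norm_integrable[OF c c0 g L2_space_extend[OF m weak_grad_L2[OF op]], of "\<lambda>x. p x + uf x"] add[OF p]
        by auto
      moreover have "(\<lambda>x. c x * norm (indicator \<Omega> x *\<^sub>R ?w x)) = (\<lambda>x. indicator \<Omega> x *\<^sub>R ((1 / lam) * (a x * norm (?w x))))"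
        by (auto simp: c_def indicator_def fun_eq_iff)
      ultimately show "(\<lambda>x. indicator \<Omega> x *\<^sub>R ((1 / lam) * (a x * norm (?w x)))) \<in> borel_measurable (lebesgue_on UNIV)"
        by simp
    qed
    also have "\<dots> = (LINT x|lebesgue_on \<Omega>. (1 / lam) * (a x * norm (?w x)))"
      unfolding lebesgue_on_UNIV_eq by (rule integral_restrict_space[symmetric]) (use m in simp)
    also have "\<dots> = ?F (\<lambda>x. p x + uf x) / lam" by simp
    finally show ?thesis .
  qed
  obtain v0 where v0: "primal_solution \<Omega> a f v0" using assms(10) by blast
  have v0H: "v0 \<in> H1 \<Omega>" "boundary_trace \<Omega> v0 = f"
    and v0min: "\<And>v. v \<in> H1 \<Omega> \<Longrightarrow> boundary_trace \<Omega> v = f \<Longrightarrow> ?F v0 \<le> ?F v"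
    using v0 unfolding primal_solution_def is_arg_min_linorder by auto
  define p0 where "p0 x = v0 x - uf x" for x
  have p0: "p0 \<in> H10 \<Omega>"
    using boundary_trace_iff[OF op uf v0H(1)] v0H(2) uff unfolding p0_def[abs_def] by simp
  have v0p: "v0 = (\<lambda>x. p0 x + uf x)" by (simp add: p0_def)
  interpret dr: douglas_rachford ?V ?J ?G "norm (abs_L2 c)" "?tg p0"
  proof
    show "closed ?V" by (rule closed_H10_grads[OF op bd])
    show "subspace ?V" by (rule subspace_H10_grads[OF op])
    show "?G (?J z) + (z - ?J z) \<bullet> (y - ?J z) \<le> ?G y" for z y by (rule shrink_map_resolvent[OF c c0 g])
    show "?G x - ?G y \<le> norm (abs_L2 c) * norm (x - y)" for x y
      by (rule weighted_norm_integral_lipschitz[OF c c0 g])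
    show "?tg p0 \<in> ?V" by (rule tgV[OF p0])
    show "?G (?tg p0) \<le> ?G v" if vV: "v \<in> ?V" for v
    proof -
      obtain p where p: "p \<in> H10 \<Omega>" "?tg p = v" using Vtg[OF vV] by blast
      have "?F v0 \<le> ?F (\<lambda>x. p x + uf x)" using add[OF p(1)] by (intro v0min) auto
      then show ?thesis using lam unfolding p(2)[symmetric] GF[OF p0] GF[OF p(1)] v0p[symmetric]
        by (simp add: divide_right_mono)
    qed
  qed
  have uH: "u (Suc k) \<in> H10 \<Omega>" for k using alg[of k] by blast
  have dstep: "AE x in lebesgue_on \<Omega>. shrink (c x) (weak_grad \<Omega> (u (Suc k)) x + ?guf x + b k x) - ?guf x = d (Suc k) x" for k
  proof -
    have 1: "AE x in lebesgue_on \<Omega>. d (Suc k) x =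
       (if norm (weak_grad \<Omega> (u (Suc k)) x + weak_grad \<Omega> uf x + b k x) \<noteq> 0
        then (max (norm (weak_grad \<Omega> (u (Suc k)) x + weak_grad \<Omega> uf x + b k x) - a x / lam) 0) *\<^sub>R
          ((weak_grad \<Omega> (u (Suc k)) x + weak_grad \<Omega> uf x + b k x) /\<^sub>R
           norm (weak_grad \<Omega> (u (Suc k)) x + weak_grad \<Omega> uf x + b k x)) - weak_grad \<Omega> uf x
        else - weak_grad \<Omega> uf x)"
      using alg[of k] by blast
    have 2: "AE x in lebesgue_on \<Omega>. c x = a x / lam"
      by (rule AE_I2) (simp add: c_def space_restrict_space)
    from 1 2 show ?thesis by eventually_elim (simp add: shrink_def)
  qed
  have bstep: "AE x in lebesgue_on \<Omega>. b k x + weak_grad \<Omega> (u (Suc k)) x - d (Suc k) x = b (Suc k) x" for k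
  proof -
    have "AE x in lebesgue_on \<Omega>. b (Suc k) x = b k x + weak_grad \<Omega> (u (Suc k)) x - d (Suc k) x"
      using alg[of k] by blast
    then show ?thesis by eventually_elim simp
  qed
  have L: "b k \<in> L2_space \<Omega> \<and> d k \<in> L2_space \<Omega>" for k
  proof (induction k)
    case 0 show ?case using b0 d0 by simp
  next
    case (Suc k)
    then have bk: "b k \<in> L2_space \<Omega>" by simp
    let ?w = "\<lambda>x. weak_grad \<Omega> (u (Suc k)) x + ?guf x + b k x"
    have w: "?w \<in> L2_space \<Omega>" by (intro L2_space_add wgL uH guf bk)
    have "(\<lambda>x. shrink (c x) (?w x)) \<in> L2_space \<Omega>"
    proof (rule L2_space_bound[OF w])
      show "(\<lambda>x. shrink (c x) (?w x)) \<in> borel_measurable (lebesgue_on \<Omega>)"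
        by (rule borel_measurable_shrink[OF L2_space_measurable[OF w] L2_space_measurable[OF L2_space_subset[OF m c]]])
      show "AE x in lebesgue_on \<Omega>. norm (shrink (c x) (?w x)) \<le> norm (?w x)"
        using AE_lebesgue_on_if_AE[OF m c0] by eventually_elim (rule norm_shrink_le)
    qed
    from L2_space_cong_AE[OF m L2_space_diff[OF this guf] dstep]
    have dS: "d (Suc k) \<in> L2_space \<Omega>" .
    have "b (Suc k) \<in> L2_space \<Omega>"
      by (rule L2_space_cong_AE[OF m L2_space_diff[OF L2_space_add[OF bk wgL[OF uH]] dS] bstep])
    with dS show ?case by simp
  qed
  then have bL: "\<And>k. b k \<in> L2_space \<Omega>" and dL: "\<And>k. d k \<in> L2_space \<Omega>" by blast+
  define B where "B k = to_L2 \<Omega> (b k)" for k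
  define D where "D k = to_L2 \<Omega> (d k)" for k
  define P where "P k = ?tg (u (Suc k))" for k
  note wu = wgL[OF uH]
  have Pstep: "norm (P k - orth_proj ?V (D k - B k)) \<le> \<alpha> (Suc k)" for k
  proof -
    obtain uex where uex: "weak_poisson_solution \<Omega> (\<lambda>x. d k x - b k x) uex"
      "L2_norm \<Omega> (\<lambda>x. weak_grad \<Omega> (u (Suc k)) x - weak_grad \<Omega> uex x) \<le> \<alpha> (Suc k)"
      using alg[of k] by blast
    then have ex: "uex \<in> H10 \<Omega>" by (simp add: weak_poisson_solution_def)
    have "orth_proj ?V (D k - B k) = ?tg uex"
      using weak_poisson_solution_grad[OF op bd L2_space_diff[OF dL bL] uex(1)]
      unfolding D_def B_def to_L2_diff[OF m dL bL] by simp
    then have "norm (P k - orth_proj ?V (D k - B k)) = L2_norm \<Omega> (\<lambda>x. weak_grad \<Omega> (u (Suc k)) x - weak_grad \<Omega> uex x)"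
      unfolding P_def by (simp add: norm_to_L2[OF m L2_space_diff[OF wu wgL[OF ex]], symmetric] to_L2_diff[OF m wu wgL[OF ex]])
    then show ?thesis using uex(2) by simp
  qed
  have Dstep: "D (Suc k) = ?J (B k + P k)" for k
  proof -
    have "AE x in lebesgue_on UNIV. indicator \<Omega> x *\<^sub>R d (Suc k) x = shrink (c x) (rep_L2 (B k + P k) x + g x) - g x"
      using dstep[of k, unfolded AE_lebesgue_on_iff[OF m]] rep_L2_plus[of "B k" "P k"]
        rep_to_L2[OF m bL[of k]] rep_to_L2[OF m wu[of k]]
    proof eventually_elim
      case (elim x)
      then show ?case
        by (cases "x \<in> \<Omega>") (auto simp: B_def P_def g_def c_def shrink_def add_ac)
    qed
    then show ?thesis unfolding D_def shrink_map_def to_L2_def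
      by (subst abs_L2_eq_iff[OF L2_space_extend[OF m dL] shrink_map_field_L2[OF c c0 g]])
  qed
  have Bstep: "B (Suc k) = B k + P k - D (Suc k)" for k
    using to_L2_eq_iff[OF m L2_space_diff[OF L2_space_add[OF bL wu] dL] bL, of k k "Suc k" "Suc k"] bstep[of k]
    unfolding B_def P_def D_def
    by (simp add: to_L2_diff[OF m L2_space_add[OF bL wu] dL] to_L2_add[OF m bL wu])
  obtain Dh Bh where DV: "Dh \<in> ?V" and PB: "orth_proj ?V Bh = 0" and fx: "?J (Dh + Bh) = Dh"
    and Bw: "\<And>h. (\<lambda>k. B k \<bullet> h) \<longlonglongrightarrow> Bh \<bullet> h" and Dw: "\<And>h. (\<lambda>k. D k \<bullet> h) \<longlonglongrightarrow> Dh \<bullet> h"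
    and Pw: "\<And>h. (\<lambda>k. P k \<bullet> h) \<longlonglongrightarrow> Dh \<bullet> h"
    using dr.inexact_douglas_rachford(1)[OF Pstep assms(12) Dstep Bstep] by blast
  note sm = dr.inexact_douglas_rachford(2)[OF Pstep assms(12) Dstep Bstep]
  obtain uhat where uh: "uhat \<in> H10 \<Omega>" and tuh: "?tg uhat = Dh" using Vtg[OF DV] by blast
  let ?bh = "rep_L2 Bh" and ?dh = "rep_L2 Dh"
  let ?ub = "\<lambda>x. uhat x + uf x"
  let ?gb = "weak_grad \<Omega> ?ub"
  note ub = add[OF uh]
  have gbL: "?gb \<in> L2_space \<Omega>" using ub by (intro weak_grad_L2[OF op]) blast
  have bhL: "?bh \<in> L2_space \<Omega>" by (rule rep_L2_in_Omega[OF m])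
  have nrm: "L2_norm \<Omega> (\<lambda>x. weak_grad \<Omega> (u (Suc k)) x - d k x) = norm (P k - D k)" for k
    unfolding P_def D_def by (simp add: norm_to_L2[OF m L2_space_diff[OF wu dL], symmetric] to_L2_diff[OF m wu dL])
  have dh: "AE x in lebesgue_on \<Omega>. ?dh x = weak_grad \<Omega> uhat x"
    using rep_to_L2[OF m wgL[OF uh]] unfolding tuh AE_lebesgue_on_iff[OF m] by eventually_elim simp
  \<comment> \<open>The extremality relations between \<open>\<lambda> bhat\<close> and the gradient of \<open>ubar\<close>, from which all optimality claims follow.\<close>
  have pair: "AE x in lebesgue_on \<Omega>. norm (?bh x) \<le> a x / lam \<and> ?bh x \<bullet> ?gb x = a x / lam * norm (?gb x)"
    using shrink_map_fixed_pair[OF c c0 g fx] dh conjunct1[OF conjunct2[OF ub]]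
    unfolding AE_lebesgue_on_iff[OF m]
    by eventually_elim (auto simp: c_def g_def)
  have orth: "Bh \<bullet> G = 0" if "G \<in> ?V" for G
    using dr.P_orth[OF that, of Bh] unfolding PB by simp
  have df: "divergence_free \<Omega> ?bh"
    unfolding orthogonal_iff_divergence_free[OF op bhL] orthogonal_H10_grads_iff[OF op]
  proof
    fix \<phi> assume \<phi>: "\<phi> \<in> test_functions \<Omega>"
    note gL = test_function_L2(3)[OF m \<phi>]
    have "Bh \<bullet> to_L2 \<Omega> (grad \<phi>) = 0"
      using orth orthogonal_H10_grads_iff[OF op] \<phi> by blast
    then show "to_L2 \<Omega> ?bh \<bullet> to_L2 \<Omega> (grad \<phi>) = 0"
      unfolding inner_to_L2[OF m bhL gL] inner_rep_to_L2[OF m gL, symmetric] .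
  qed
  \<comment> \<open>A divergence-free field pairs in the same way with the gradients of all competitors, because these differ by gradients of $H^1_0$.\<close>
  have split: "L2_inner \<Omega> q (weak_grad \<Omega> v) = L2_inner \<Omega> q ?guf"
    if q: "q \<in> L2_space \<Omega>" "divergence_free \<Omega> q" and v: "v \<in> H1 \<Omega>" "boundary_trace \<Omega> v = f" for q v
  proof -
    have p: "(\<lambda>x. v x - uf x) \<in> H10 \<Omega>" using boundary_trace_iff[OF op uf v(1)] v(2) uff by simp
    have "?tg (\<lambda>x. v x - uf x) = ?tg v - ?tg uf"
      using H1_diff(2)[OF op v(1) uf] unfolding sobolev_pair_def by simp
    moreover have "to_L2 \<Omega> q \<bullet> ?tg (\<lambda>x. v x - uf x) = 0"
      using q(2) tgV[OF p] unfolding orthogonal_iff_divergence_free[OF op q(1)] by blast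
    ultimately show ?thesis
      by (simp add: inner_diff_right inner_to_L2[OF m q(1)] weak_grad_L2[OF op v(1)] guf)
  qed
  have aint: "integrable (lebesgue_on \<Omega>) (\<lambda>x. a x * norm (weak_grad \<Omega> v x))" if v: "v \<in> H1 \<Omega>" for v
  proof (rule Bochner_Integration.integrable_bound[OF L2_integrable_norm_mult[OF a weak_grad_L2[OF op v]]])
    show "(\<lambda>x. a x * norm (weak_grad \<Omega> v x)) \<in> borel_measurable (lebesgue_on \<Omega>)"
      using L2_space_measurable[OF a] L2_space_measurable[OF weak_grad_L2[OF op v]] by simp
  qed (simp add: abs_mult)
  \<comment> \<open>Weak duality: together with the previous fact, every dual value is at most every primal value.\<close>
  have weak: "L2_inner \<Omega> q (weak_grad \<Omega> v) \<le> ?F v"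
    if q: "q \<in> L2_space \<Omega>" "AE x in lebesgue_on \<Omega>. norm (q x) \<le> a x" and v: "v \<in> H1 \<Omega>" for q v
    unfolding L2_inner_def
  proof (rule integral_mono_AE[OF L2_integrable_inner[OF q(1) weak_grad_L2[OF op v]] aint[OF v]])
    show "AE x in lebesgue_on \<Omega>. q x \<bullet> weak_grad \<Omega> v x \<le> a x * norm (weak_grad \<Omega> v x)"
      using q(2)
    proof eventually_elim
      case (elim x)
      then show ?case
        using norm_cauchy_schwarz[of "q x" "weak_grad \<Omega> v x"] mult_right_mono[OF elim, of "norm (weak_grad \<Omega> v x)"] by simp
    qed
  qed
  let ?q = "\<lambda>x. lam *\<^sub>R ?bh x"
  have qL: "?q \<in> L2_space \<Omega>" by (rule L2_space_scale[OF bhL])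
  have qa: "AE x in lebesgue_on \<Omega>. norm (?q x) \<le> a x"
    using pair by eventually_elim (use lam in \<open>simp add: field_simps\<close>)
  have qdf: "divergence_free \<Omega> ?q"
    using df unfolding divergence_free_def distr_div_eq by (simp add: L2_inner_def)
  \<comment> \<open>For the limits the two values coincide, so both are optimal.\<close>
  have strong: "L2_inner \<Omega> ?q ?gb = ?F ?ub"
    unfolding L2_inner_def
  proof (rule integral_cong_AE)
    show "AE x in lebesgue_on \<Omega>. ?q x \<bullet> ?gb x = a x * norm (?gb x)"
      using pair by eventually_elim (use lam in simp)
    show "(\<lambda>x. ?q x \<bullet> ?gb x) \<in> borel_measurable (lebesgue_on \<Omega>)"
      using L2_integrable_inner[OF qL gbL] by auto
    show "(\<lambda>x. a x * norm (?gb x)) \<in> borel_measurable (lebesgue_on \<Omega>)"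
      using aint[of ?ub] ub by auto
  qed
  have ubf: "?ub \<in> H1 \<Omega>" "boundary_trace \<Omega> ?ub = f" using ub by auto
  have primal: "primal_solution \<Omega> a f ?ub"
    unfolding primal_solution_def is_arg_min_linorder
  proof (intro conjI allI impI ubf)
    fix v assume v: "v \<in> H1 \<Omega> \<and> boundary_trace \<Omega> v = f"
    have "?F ?ub = L2_inner \<Omega> ?q ?guf" using strong split[OF qL qdf ubf] by simp
    also have "\<dots> = L2_inner \<Omega> ?q (weak_grad \<Omega> v)" using split[OF qL qdf] v by simp
    also have "\<dots> \<le> ?F v" using weak[OF qL qa] v by simp
    finally show "?F ?ub \<le> ?F v" .
  qed
  have comm: "L2_inner \<Omega> x y = L2_inner \<Omega> y x" for x y :: "real^'n \<Rightarrow> real^'n"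
    by (simp add: L2_inner_def inner_commute)
  have dual: "dual_solution \<Omega> a uf ?q"
    unfolding dual_solution_def is_arg_max_linorder
  proof (intro conjI allI impI qL qa qdf)
    fix q assume q: "q \<in> L2_space \<Omega> \<and> (AE x in lebesgue_on \<Omega>. norm (q x) \<le> a x) \<and> divergence_free \<Omega> q"
    have "L2_inner \<Omega> ?guf q = L2_inner \<Omega> q ?gb" using split[OF _ _ ubf, of q] q comm by simp
    also have "\<dots> \<le> ?F ?ub" using weak[OF _ _ ubf(1)] q by blast
    also have "\<dots> = L2_inner \<Omega> ?guf ?q" using strong split[OF qL qdf ubf] comm by simp
    finally show "L2_inner \<Omega> ?guf q \<le> L2_inner \<Omega> ?guf ?q" .
  qed
  have formula: "AE x in lebesgue_on \<Omega>. \<not> (norm (?gb x) = 0 \<and> a x \<noteq> 0) \<longrightarrow>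
      ?bh x = (if a x = 0 then 0 else (1 / lam) *\<^sub>R a x *\<^sub>R (?gb x /\<^sub>R norm (?gb x)))"
    using pair
  proof eventually_elim
    case (elim x)
    show ?case
    proof (intro impI)
      assume ne: "\<not> (norm (?gb x) = 0 \<and> a x \<noteq> 0)"
      show "?bh x = (if a x = 0 then 0 else (1 / lam) *\<^sub>R a x *\<^sub>R (?gb x /\<^sub>R norm (?gb x)))"
      proof (cases "a x = 0")
        case True
        then show ?thesis using elim by simp
      next
        case False
        then have "?gb x \<noteq> 0" using ne by simp
        with elim have "?bh x = (a x / lam) *\<^sub>R (?gb x /\<^sub>R norm (?gb x))"
          by (intro Cauchy_Schwarz_equality_direction) auto
        then show ?thesis using False by simp
      qed
    qed
  qed
  have "(\<lambda>k. sqrt ((norm (P k - D k))\<^sup>2)) \<longlonglongrightarrow> sqrt 0"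
    by (intro tendsto_intros summable_LIMSEQ_zero[OF sm])
  then have to0: "(\<lambda>k. norm (P k - D k)) \<longlonglongrightarrow> 0" by simp
  have wb: "weakly_converges (L2_space \<Omega>) (L2_inner \<Omega>) b ?bh"
    by (rule weakly_converges_L2[OF m bL]) (use Bw in \<open>simp add: B_def\<close>)
  have wd: "weakly_converges (L2_space \<Omega>) (L2_inner \<Omega>) d ?dh"
    by (rule weakly_converges_L2[OF m dL]) (use Dw in \<open>simp add: D_def\<close>)
  have wu: "weakly_converges (H10 \<Omega>) (H1_inner \<Omega>) (\<lambda>k. u (Suc k)) uhat"
    by (rule weakly_converges_H10[OF op bd uH uh]) (use Pw in \<open>simp add: P_def tuh\<close>)
  show ?thesis
    unfolding Let_def nrm
    by (intro exI[of _ ?bh] exI[of _ ?dh] exI[of _ uhat] conjI wb wd wu to0 sm primal dual dh df formula)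
qed

end
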